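(* Let $A$ be a Pickands dependence function that is differentiable on $(0,1)$, with derivative $\dot A$, and let $\mathbb A_{\mathrm r}^{\mathrm P}$ and $\mathbb A_{\mathrm r}^{\mathrm{CFG}}$ be the centered Gaussian processes defined in the context. For $t\in(0,1)$ let $\mu(t)=A(t)-t\dot A(t)$, $\nu(t)=A(t)+(1-t)\dot A(t)$, $A_1(t)=A(t)/t$, $A_2(t)=A(t)/(1-t)$, $\bar\mu(t)=1-\mu(t)$ and $\bar\nu(t)=1-\nu(t)$. Then for every $t\in(0,1)$, $A^{-2}(t)\,\mathrm{var}\,\mathbb A_{\mathrm r}^{\mathrm P}(t)$ equals $$2-\{\mu(t)+\nu(t)-1\}^2-\frac{2\mu(t)\bar\mu(t)A_2(t)}{2A_2(t)-1}-\frac{2\nu(t)\bar\nu(t)A_1(t)}{2A_1(t)-1}$$ $$+2\mu(t)\nu(t)A_1(t)A_2(t)\int_0^1\{A(s)+sA_1(t)+(1-s)A_2(t)-1\}^{-2}\,ds$$ $$-2\mu(t)A_1(t)A_2(t)\int_0^t[A(s)+(1-s)\{A_2(t)-1\}]^{-2}\,ds$$ $$-2\nu(t)A_1(t)A_2(t)\int_t^1[A(s)+s\{A_1(t)-1\}]^{-2}\,ds,$$ while $A^{-2}(t)\,\mathrm{var}\,\mathbb A_{\mathrm r}^{\mathrm{CFG}}(t)$ equals $$\{1+\mu^2(t)+\nu^2(t)-\mu(t)-\nu(t)\}L_2(1)-2\mu(t)\bar\mu(t)L_2\{-1+1/A_2(t)\}-2\nu(t)\bar\nu(t)L_2\{-1+1/A_1(t)\}$$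 $$-2\mu(t)\nu(t)\int_0^1\log\left\{1-\frac{t(1-t)}{A(t)}\,\frac{1-A(s)}{t(1-s)+(1-t)s}\right\}\frac{ds}{s(1-s)}$$ $$+2\mu(t)\int_0^t\log\left[1-\frac{t(1-t)}{A(t)}\,\frac{1-A(s)+s\{A_1(t)-1\}}{t(1-s)+(1-t)s}\right]\frac{ds}{s(1-s)}$$ $$+2\nu(t)\int_t^1\log\left[1-\frac{t(1-t)}{A(t)}\,\frac{1-A(s)+(1-s)\{A_2(t)-1\}}{t(1-s)+(1-t)s}\right]\frac{ds}{s(1-s)}.$$
   Context: A Pickands dependence function is a convex function $A:[0,1]\to[1/2,1]$ with $\max(t,1-t)\le A(t)\le1$ for all $t\in[0,1]$. The associated extreme-value copula is the copula $C$ with $C(u,v)=(uv)^{A\{\log(v)/\log(uv)\}}$ for $(u,v)\in(0,1)^2$. $\alpha$ is a bivariate pinned $C$-Brownian sheet: a centered Gaussian random field on $[0,1]^2$ (with continuous sample paths) with covariance $\mathrm{cov}\{\alpha(u,v),\alpha(u',v')\}=C(u\wedge u',v\wedge v')-C(u,v)C(u',v')$, where $x\wedge y=\min(x,y)$. With $\dot C_1=\partial C/\partial u$, $\dot C_2=\partial C/\partial v$, $$\mathbb C(u,v)=\alpha(u,v)-\dot C_1(u,v)\alpha(u,1)-\dot C_2(u,v)\alpha(1,v),$$ and $$\mathbb A_{\mathrm r}^{\mathrm P}(t)=-A^2(t)\int_0^1\mathbb C(u^{1-t},u^t)\,\frac{du}{u},\qquad \mathbb A_{\mathrm r}^{\mathrm{CFG}}(t)=A(t)\int_0^1\mathbb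 C(u^{1-t},u^t)\,\frac{du}{u\log u}.$$ Equivalently, with $\sigma(u,v;t)=\mathrm{cov}\{\mathbb C(u^{1-t},u^t),\mathbb C(v^{1-t},v^t)\}$, $$\mathrm{var}\,\mathbb A_{\mathrm r}^{\mathrm P}(t)=A^4(t)\int_0^1\!\!\int_0^1\sigma(u,v;t)\frac{du}{u}\frac{dv}{v},\qquad \mathrm{var}\,\mathbb A_{\mathrm r}^{\mathrm{CFG}}(t)=A^2(t)\int_0^1\!\!\int_0^1\sigma(u,v;t)\frac{du}{u\log u}\frac{dv}{v\log v}.$$ (These processes are the weak limits of the normalized rank-based Pickands and CFG estimators of $A$.) $L_2$ is the dilogarithm: $L_2(x)=-\int_0^x\log(1-z)\,\frac{dz}{z}=\sum_{k\ge1}x^k/k^2$ for $x\in[-1,1]$. *)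

theory Defs
  imports "HOL-Probability.Probability"
begin

definition pickands_function :: "(real \<Rightarrow> real) \<Rightarrow> bool" where
  "pickands_function A \<longleftrightarrow>
     A \<in> {0..1} \<rightarrow> {1/2..1} \<and> convex_on {0..1} A \<and>
     (\<forall>t\<in>{0..1}. max t (1 - t) \<le> A t \<and> A t \<le> 1)"

definition copula :: "(real \<Rightarrow> real \<Rightarrow> real) \<Rightarrow> bool" where
  "copula C \<longleftrightarrow>
     (\<forall>u\<in>{0..1}. C u 0 = 0 \<and> C 0 u = 0 \<and> C u 1 = u \<and> C 1 u = u) \<and>
     (\<forall>u u' v v'. 0 \<le> u \<and> u \<le> u' \<and> u' \<le> 1 \<and> 0 \<le> v \<and> v \<le> v' \<and> v' \<le> 1
        \<longrightarrow> 0 \<le> C u' v' - C u v' - C u' v + C u v)"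

definition extreme_value_copula :: "(real \<Rightarrow> real) \<Rightarrow> (real \<Rightarrow> real \<Rightarrow> real) \<Rightarrow> bool" where
  "extreme_value_copula A C \<longleftrightarrow> copula C \<and>
     (\<forall>u\<in>{0<..<1}. \<forall>v\<in>{0<..<1}. C u v = (u * v) powr A (ln v / ln (u * v)))"

(* Point masses count as (degenerate) normal laws: the pinned sheet vanishes
   identically on part of the boundary of the unit square. *)
definition normal_rv :: "'w measure \<Rightarrow> ('w \<Rightarrow> real) \<Rightarrow> bool" where
  "normal_rv M X \<longleftrightarrow> X \<in> borel_measurable M \<and>
     (\<exists>m. (AE \<omega> in M. X \<omega> = m) \<or>
          (\<exists>\<sigma>>0. distributed M lborel X (\<lambda>x. ennreal (normal_density m \<sigma> x))))"

definition gaussian_process :: "'w measure \<Rightarrow> 'i set \<Rightarrow> ('i \<Rightarrow> 'w \<Rightarrow> real) \<Rightarrow> bool" where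
  "gaussian_process M T X \<longleftrightarrow>
     (\<forall>F c. finite F \<and> F \<subseteq> T \<longrightarrow> normal_rv M (\<lambda>\<omega>. \<Sum>i\<in>F. c i * X i \<omega>))"

definition cov :: "'w measure \<Rightarrow> ('w \<Rightarrow> real) \<Rightarrow> ('w \<Rightarrow> real) \<Rightarrow> real" where
  "cov M X Y = prob_space.expectation M
     (\<lambda>\<omega>. (X \<omega> - prob_space.expectation M X) * (Y \<omega> - prob_space.expectation M Y))"

definition pinned_brownian_sheet ::
    "'w measure \<Rightarrow> (real \<Rightarrow> real \<Rightarrow> real) \<Rightarrow> (real \<times> real \<Rightarrow> 'w \<Rightarrow> real) \<Rightarrow> bool" where
  "pinned_brownian_sheet M C \<alpha> \<longleftrightarrow>
     gaussian_process M ({0..1} \<times> {0..1}) \<alpha> \<and>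
     (\<forall>p\<in>{0..1} \<times> {0..1}. prob_space.expectation M (\<alpha> p) = 0) \<and>
     (\<forall>\<omega>\<in>space M. continuous_on ({0..1} \<times> {0..1}) (\<lambda>p. \<alpha> p \<omega>)) \<and>
     (\<forall>u\<in>{0..1}. \<forall>v\<in>{0..1}. \<forall>u'\<in>{0..1}. \<forall>v'\<in>{0..1}.
        cov M (\<alpha> (u, v)) (\<alpha> (u', v')) = C (min u u') (min v v') - C u v * C u' v')"

definition partial1 :: "(real \<Rightarrow> real \<Rightarrow> real) \<Rightarrow> real \<Rightarrow> real \<Rightarrow> real" where
  "partial1 C u v = deriv (\<lambda>x. C x v) u"

definition partial2 :: "(real \<Rightarrow> real \<Rightarrow> real) \<Rightarrow> real \<Rightarrow> real \<Rightarrow> real" where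
  "partial2 C u v = deriv (\<lambda>y. C u y) v"

(* Only evaluated in the open unit square below, where the partial derivatives
   of an extreme-value copula exist as soon as A is differentiable. *)
definition copula_process ::
    "(real \<Rightarrow> real \<Rightarrow> real) \<Rightarrow> (real \<times> real \<Rightarrow> 'w \<Rightarrow> real) \<Rightarrow> real \<Rightarrow> real \<Rightarrow> 'w \<Rightarrow> real" where
  "copula_process C \<alpha> u v \<omega> =
     \<alpha> (u, v) \<omega> - partial1 C u v * \<alpha> (u, 1) \<omega> - partial2 C u v * \<alpha> (1, v) \<omega>"

definition A_r_P ::
    "(real \<Rightarrow> real) \<Rightarrow> (real \<Rightarrow> real \<Rightarrow> real) \<Rightarrow> (real \<times> real \<Rightarrow> 'w \<Rightarrow> real) \<Rightarrow> real \<Rightarrow> 'w \<Rightarrow> real" where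
  "A_r_P A C \<alpha> t \<omega> =
     - (A t)\<^sup>2 * (LBINT u:{0<..<1}. copula_process C \<alpha> (u powr (1 - t)) (u powr t) \<omega> / u)"

definition A_r_CFG ::
    "(real \<Rightarrow> real) \<Rightarrow> (real \<Rightarrow> real \<Rightarrow> real) \<Rightarrow> (real \<times> real \<Rightarrow> 'w \<Rightarrow> real) \<Rightarrow> real \<Rightarrow> 'w \<Rightarrow> real" where
  "A_r_CFG A C \<alpha> t \<omega> =
     A t * (LBINT u:{0<..<1}. copula_process C \<alpha> (u powr (1 - t)) (u powr t) \<omega> / (u * ln u))"

(* The dilogarithm. The interval integral is oriented, as needed for x < 0. *)
definition L2 :: "real \<Rightarrow> real" where
  "L2 x = - (LBINT z=0..ereal x. ln (1 - z) / z)"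

end

(*
  Put u = exp(-x). Up to the factors 1, mu(t), nu(t) the three terms of the process under the integral
  are of the form exp(-e x) alpha(exp(-p x), exp(-q x)), and e plus the tail exponent of (p, q) is A(t)
  for each of them. By homogeneity of the exponent the covariance of two such terms at x and y = x w is
  exp(-x phi(w)) - exp(-A(t) x (1 + w)). By Fubini the variance is a combination of double integrals of
  these covariances; in the coordinates (x, w) the x-integral is elementary and leaves
  1/phi^2 - 1/(A(t) (1 + w))^2 for Pickands, and ln (A(t) (1 + w) / phi) / w (a Frullani integral) for CFG.
  For w < 1 the function phi is affine, except for the covariance of the second and third terms; where phi
  is not explicit, a fractional linear substitution turns its tail exponent into A(s).
*)
theory Submission
  imports Defs
begin

text \<open>The exponents \<open>e\<close> come from differentiating the copula: at the point in
  question \<open>C = exp(-A(t) x)\<close>, and the partial derivatives are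
  \<open>\<mu> * C / u\<close> and \<open>\<nu> * C / v\<close>. Hence all three terms share the
  total exponent A(t), the product of copula values subtracted in a covariance is the same for every
  pair of terms, and only the rate phi varies. The delicate step is exchanging expectation and path
  integral. The CFG weight becomes 1/x, which is not integrable at 0, so the second moments have to
  vanish there; they are at most exp(-A(t) x) min(1, x), and the square root of this bound tames
  1/x. Subadditivity of the tail exponent under maxima makes all covariances nonnegative, so the
  passage to (x, w) is a computation with nonnegative integrals, and the one-dimensional integrands
  inherit integrability from the quadrant instead of being estimated. On w < 1 the slope of phi is
  the exponent \<open>e\<close> of the second term of the pair. It produces the rational terms and
  the dilogarithms; for a term paired with itself, w -> 1/w returns the other half.\<close>

section \<open>Integrals on the half-line and the quadrant\<close>

text \<open>The change of variables theorem speaks of absolute integrability for the completed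
  measure; Borel measurability of both integrands carries it over to \<open>lborel\<close>. The
  equality of the integrals needs no integrability assumption, so integrands containing
  \<open>A\<close> can be substituted directly.\<close>

lemma
  fixes f g g' :: "real \<Rightarrow> real"
  assumes S: "S \<in> sets borel" and T: "g ` S = T"
    and der: "\<And>x. x \<in> S \<Longrightarrow> (g has_real_derivative g' x) (at x)"
    and inj: "inj_on g S"
    and f: "set_borel_measurable lborel T f"
    and fg: "set_borel_measurable lborel S (\<lambda>x. \<bar>g' x\<bar> * f (g x))"
  shows set_integrable_substitution:
      "set_integrable lborel T f \<longleftrightarrow> set_integrable lborel S (\<lambda>x. \<bar>g' x\<bar> * f (g x))"
    and set_integral_substitution:
      "(LBINT y:T. f y) = (LBINT x:S. \<bar>g' x\<bar> * f (g x))"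
proof -
  have der': "\<And>x. x \<in> S \<Longrightarrow> (g has_real_derivative g' x) (at x within S)"
    by (rule has_field_derivative_at_within[OF der])
  have S': "S \<in> sets lebesgue" using S by auto
  have cT: "set_integrable lebesgue T f \<longleftrightarrow> set_integrable lborel T f"
    using f unfolding set_integrable_def set_borel_measurable_def by (rule integrable_completion)
  have cS: "set_integrable lebesgue S (\<lambda>x. \<bar>g' x\<bar> * f (g x)) \<longleftrightarrow> set_integrable lborel S (\<lambda>x. \<bar>g' x\<bar> * f (g x))"
    using fg unfolding set_integrable_def set_borel_measurable_def by (rule integrable_completion)
  have eT: "set_lebesgue_integral lebesgue T f = (LBINT y:T. f y)"
    using f unfolding set_lebesgue_integral_def set_borel_measurable_def by (rule integral_completion)
  have eS: "set_lebesgue_integral lebesgue S (\<lambda>x. \<bar>g' x\<bar> * f (g x)) = (LBINT x:S. \<bar>g' x\<bar> * f (g x))"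
    using fg unfolding set_lebesgue_integral_def set_borel_measurable_def by (rule integral_completion)
  have ch: "(\<lambda>x. \<bar>g' x\<bar> * f (g x)) absolutely_integrable_on S \<and> integral S (\<lambda>x. \<bar>g' x\<bar> * f (g x)) = b
     \<longleftrightarrow> f absolutely_integrable_on T \<and> integral T f = b" for b
    unfolding T[symmetric] by (rule has_absolute_integral_change_of_variables_1'[OF S' der' inj])
  have ii: "f absolutely_integrable_on T \<longleftrightarrow> (\<lambda>x. \<bar>g' x\<bar> * f (g x)) absolutely_integrable_on S"
    using ch[of "integral T f"] ch[of "integral S (\<lambda>x. \<bar>g' x\<bar> * f (g x))"] by auto
  show iff: "set_integrable lborel T f \<longleftrightarrow> set_integrable lborel S (\<lambda>x. \<bar>g' x\<bar> * f (g x))"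
    using ii unfolding cT cS .
  show "(LBINT y:T. f y) = (LBINT x:S. \<bar>g' x\<bar> * f (g x))"
  proof (cases "set_integrable lborel T f")
    case True
    then have T': "f absolutely_integrable_on T" unfolding cT .
    then have S'': "(\<lambda>x. \<bar>g' x\<bar> * f (g x)) absolutely_integrable_on S" unfolding ii .
    have "(LBINT x:S. \<bar>g' x\<bar> * f (g x)) = integral S (\<lambda>x. \<bar>g' x\<bar> * f (g x))"
      unfolding eS[symmetric] by (rule set_lebesgue_integral_eq_integral(2)[OF S''])
    also have "\<dots> = integral T f" using ch[of "integral T f"] T' by simp
    also have "\<dots> = (LBINT y:T. f y)"
      unfolding eT[symmetric] by (rule set_lebesgue_integral_eq_integral(2)[OF T', symmetric])
    finally show ?thesis by simp
  next
    \<comment> \<open>Neither side is integrable, so both integrals have the default value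
      0.\<close>
    case False
    then show ?thesis using iff
      by (simp add: set_integrable_def set_lebesgue_integral_def not_integrable_integral_eq)
  qed
qed

lemma tendsto_mult_exp_neg:
  fixes \<alpha> :: real assumes "\<alpha> > 0"
  shows "((\<lambda>x. x * exp (- (\<alpha> * x))) \<longlongrightarrow> 0) at_top" "((\<lambda>x. exp (- (\<alpha> * x))) \<longlongrightarrow> 0) at_top"
proof -
  have f: "filterlim (\<lambda>x. \<alpha> * x) at_top at_top"
    using assms by (intro filterlim_tendsto_pos_mult_at_top[OF tendsto_const]) (auto intro: filterlim_ident)
  have "((\<lambda>x. (\<alpha> * x) ^ 1 / exp (\<alpha> * x)) \<longlongrightarrow> 0) at_top"
    by (rule filterlim_compose[OF tendsto_power_div_exp_0 f])
  then have "((\<lambda>x. inverse \<alpha> * ((\<alpha> * x) ^ 1 / exp (\<alpha> * x))) \<longlongrightarrow> inverse \<alpha> * 0) at_top"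
    by (intro tendsto_intros)
  then show "((\<lambda>x. x * exp (- (\<alpha> * x))) \<longlongrightarrow> 0) at_top"
    using assms by (simp add: exp_minus field_simps)
  have "((\<lambda>x. (\<alpha> * x) ^ 0 / exp (\<alpha> * x)) \<longlongrightarrow> 0) at_top"
    by (rule filterlim_compose[OF tendsto_power_div_exp_0 f])
  then show "((\<lambda>x. exp (- (\<alpha> * x))) \<longlongrightarrow> 0) at_top"
    by (simp add: exp_minus field_simps)
qed

lemma nn_integral_indicator_Ioi:
  "(\<integral>\<^sup>+x. f x * indicator {a<..} x \<partial>lborel) = (\<integral>\<^sup>+x. f x * indicator {a..} x \<partial>lborel)" for a :: real
proof (rule nn_integral_cong_AE)
  show "AE x in lborel. f x * indicator {a<..} x = f x * indicator {a..} x"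
    using AE_lborel_singleton[of a] by eventually_elim (auto split: split_indicator)
qed

text \<open>The inner integral for Pickands: the factor \<open>x\<close> is the Jacobian of
  \<open>y = x * w\<close>.\<close>

lemma nn_integral_exp_diff_mult:
  fixes \<alpha> \<beta> :: real
  assumes "0 < \<alpha>" "\<alpha> \<le> \<beta>"
  shows "(\<integral>\<^sup>+x. ennreal (x * (exp (- (\<alpha> * x)) - exp (- (\<beta> * x)))) * indicator {0<..} x \<partial>lborel) = ennreal (1 / \<alpha>\<^sup>2 - 1 / \<beta>\<^sup>2)"
proof -
  let ?F = "\<lambda>x. (x * exp (- (\<beta> * x)) / \<beta> + exp (- (\<beta> * x)) / \<beta>\<^sup>2) - (x * exp (- (\<alpha> * x)) / \<alpha> + exp (- (\<alpha> * x)) / \<alpha>\<^sup>2)"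
  have "(\<integral>\<^sup>+x. ennreal (x * (exp (- (\<alpha> * x)) - exp (- (\<beta> * x)))) * indicator {0..} x \<partial>lborel) = ennreal (0 - ?F 0)"
  proof (rule nn_integral_FTC_atLeast[where F = ?F])
    show "DERIV ?F x :> x * (exp (- (\<alpha> * x)) - exp (- (\<beta> * x)))" for x
      using assms by (auto intro!: derivative_eq_intros simp: field_simps power2_eq_square)
    show "0 \<le> x * (exp (- (\<alpha> * x)) - exp (- (\<beta> * x)))" if "0 \<le> x" for x
      using that assms by (intro mult_nonneg_nonneg) (auto intro: mult_right_mono)
    have "(?F \<longlongrightarrow> (0 / \<beta> + 0 / \<beta>\<^sup>2) - (0 / \<alpha> + 0 / \<alpha>\<^sup>2)) at_top"
      using assms by (intro tendsto_diff tendsto_add tendsto_divide tendsto_const tendsto_mult_exp_neg) auto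
    then show "(?F \<longlongrightarrow> 0) at_top" by simp
  qed auto
  then show ?thesis by (simp add: nn_integral_indicator_Ioi)
qed

lemma nn_integral_exp_Ioi:
  fixes s :: real assumes "0 < s"
  shows "(\<integral>\<^sup>+x. ennreal (exp (- (s * x))) * indicator {0<..} x \<partial>lborel) = ennreal (1 / s)"
proof -
  let ?F = "\<lambda>x. - exp (- (s * x)) / s"
  have "(\<integral>\<^sup>+x. ennreal (exp (- (s * x))) * indicator {0..} x \<partial>lborel) = ennreal (0 - ?F 0)"
  proof (rule nn_integral_FTC_atLeast[where F = ?F])
    show "DERIV ?F x :> exp (- (s * x))" for x
      using assms by (auto intro!: derivative_eq_intros simp: field_simps)
    have "(?F \<longlongrightarrow> - 0 / s) at_top"
      using assms by (intro tendsto_divide tendsto_minus tendsto_const tendsto_mult_exp_neg) auto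
    then show "(?F \<longlongrightarrow> 0) at_top" by simp
  qed auto
  then show ?thesis by (simp add: nn_integral_indicator_Ioi)
qed

text \<open>The quotient is the integral of \<open>exp (- (s * x))\<close> over \<open>s\<close>
  between \<open>\<alpha>\<close> and \<open>\<beta>\<close>. Exchanging the order by Tonelli leaves
  the integral of \<open>1 / s\<close>. In the CFG case the weight 1/(x y) and the Jacobian x leave
  exactly such a quotient, divided by w.\<close>

lemma nn_integral_Frullani_exp:
  fixes \<alpha> \<beta> :: real
  assumes "0 < \<alpha>" "\<alpha> \<le> \<beta>"
  shows "(\<integral>\<^sup>+x. ennreal ((exp (- (\<alpha> * x)) - exp (- (\<beta> * x))) / x) * indicator {0<..} x \<partial>lborel) = ennreal (ln (\<beta> / \<alpha>))"
proof -
  have inner: "(\<integral>\<^sup>+s. ennreal (exp (- (s * x))) * indicator {\<alpha>..\<beta>} s \<partial>lborel)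
     = ennreal ((exp (- (\<alpha> * x)) - exp (- (\<beta> * x))) / x)" if "x > 0" for x
  proof -
    have "(\<integral>\<^sup>+s. ennreal (exp (- (s * x))) * indicator {\<alpha>..\<beta>} s \<partial>lborel)
      = ennreal (- exp (- (\<beta> * x)) / x - (- exp (- (\<alpha> * x)) / x))"
    proof (rule nn_integral_FTC_Icc[where F = "\<lambda>s. - exp (- (s * x)) / x"])
      show "DERIV (\<lambda>s. - exp (- (s * x)) / x) s :> exp (- (s * x))" for s
        using that by (auto intro!: derivative_eq_intros)
    qed (use assms in auto)
    then show ?thesis by (simp add: diff_divide_distrib)
  qed
  have "(\<integral>\<^sup>+x. ennreal ((exp (- (\<alpha> * x)) - exp (- (\<beta> * x))) / x) * indicator {0<..} x \<partial>lborel)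
    = (\<integral>\<^sup>+x. (\<integral>\<^sup>+s. ennreal (exp (- (s * x))) * indicator {\<alpha>..\<beta>} s * indicator {0<..} x \<partial>lborel) \<partial>lborel)"
    by (intro nn_integral_cong) (auto simp: inner split: split_indicator)
  also have "\<dots> = (\<integral>\<^sup>+s. (\<integral>\<^sup>+x. ennreal (exp (- (s * x))) * indicator {\<alpha>..\<beta>} s * indicator {0<..} x \<partial>lborel) \<partial>lborel)"
    by (rule lborel_pair.Fubini') measurable
  also have "\<dots> = (\<integral>\<^sup>+s. ennreal (1 / s) * indicator {\<alpha>..\<beta>} s \<partial>lborel)"
  proof (intro nn_integral_cong)
    fix s :: real
    show "(\<integral>\<^sup>+x. ennreal (exp (- (s * x))) * indicator {\<alpha>..\<beta>} s * indicator {0<..} x \<partial>lborel) = ennreal (1 / s) * indicator {\<alpha>..\<beta>} s"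
      using assms nn_integral_exp_Ioi[of s] by (auto split: split_indicator)
  qed
  also have "\<dots> = ennreal (ln \<beta> - ln \<alpha>)"
  proof (rule nn_integral_FTC_Icc)
    show "DERIV ln s :> 1 / s" if "s \<in> {\<alpha>..\<beta>}" for s
      using that assms by (auto intro!: derivative_eq_intros)
  qed (use assms in auto)
  finally show ?thesis using assms by (simp add: ln_div)
qed

text \<open>Substitute \<open>y = x * w\<close> for fixed \<open>x\<close>, then exchange the order
  of integration by Tonelli.\<close>

lemma nn_integral_quadrant_polar:
  fixes J :: "real \<Rightarrow> real \<Rightarrow> ennreal"
  assumes [measurable]: "(\<lambda>(x, y). J x y) \<in> borel_measurable (lborel \<Otimes>\<^sub>M lborel)"
  shows "(\<integral>\<^sup>+x. \<integral>\<^sup>+y. J x y * indicator {0<..} y * indicator {0<..} x \<partial>lborel \<partial>lborel)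
    = (\<integral>\<^sup>+w. (\<integral>\<^sup>+x. ennreal x * J x (x * w) * indicator {0<..} x \<partial>lborel) * indicator {0<..} w \<partial>lborel)"
proof -
  have "(\<integral>\<^sup>+y. J x y * indicator {0<..} y * indicator {0<..} x \<partial>lborel)
      = (\<integral>\<^sup>+w. ennreal x * J x (x * w) * indicator {0<..} w * indicator {0<..} x \<partial>lborel)" for x
  proof (cases "x > 0")
    case True
    have "(\<integral>\<^sup>+y. J x y * indicator {0<..} y * indicator {0<..} x \<partial>lborel)
       = ennreal \<bar>x\<bar> * (\<integral>\<^sup>+w. J x (0 + x * w) * indicator {0<..} (0 + x * w) * indicator {0<..} x \<partial>lborel)"
      using True by (intro nn_integral_real_affine) auto
    also have "\<dots> = (\<integral>\<^sup>+w. ennreal x * (J x (x * w) * indicator {0<..} (x * w) * indicator {0<..} x) \<partial>lborel)"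
      using True by (subst nn_integral_cmult) auto
    also have "\<dots> = (\<integral>\<^sup>+w. ennreal x * J x (x * w) * indicator {0<..} w * indicator {0<..} x \<partial>lborel)"
      using True by (intro nn_integral_cong) (auto split: split_indicator simp: zero_less_mult_iff)
    finally show ?thesis .
  qed auto
  then have "(\<integral>\<^sup>+x. \<integral>\<^sup>+y. J x y * indicator {0<..} y * indicator {0<..} x \<partial>lborel \<partial>lborel)
    = (\<integral>\<^sup>+x. \<integral>\<^sup>+w. ennreal x * J x (x * w) * indicator {0<..} w * indicator {0<..} x \<partial>lborel \<partial>lborel)" by simp
  also have "\<dots> = (\<integral>\<^sup>+w. \<integral>\<^sup>+x. ennreal x * J x (x * w) * indicator {0<..} w * indicator {0<..} x \<partial>lborel \<partial>lborel)"
    by (rule lborel_pair.Fubini') measurable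
  also have "\<dots> = (\<integral>\<^sup>+w. (\<integral>\<^sup>+x. ennreal x * J x (x * w) * indicator {0<..} x \<partial>lborel) * indicator {0<..} w \<partial>lborel)"
    by (subst nn_integral_multc[symmetric]) (auto intro!: nn_integral_cong simp: mult_ac)
  finally show ?thesis .
qed

text \<open>Since \<open>J\<close> and \<open>G\<close> are nonnegative, one identity of extended
  nonnegative integrals yields both claims: the values agree, and a finite quadrant integral forces
  a finite integral of \<open>G\<close>.\<close>

lemma
  fixes J :: "real \<Rightarrow> real \<Rightarrow> real" and G :: "real \<Rightarrow> real"
  defines "JQ \<equiv> (\<lambda>(x, y). indicator {0<..} x * indicator {0<..} y * J x y)"
  assumes J [measurable]: "(\<lambda>(x, y). J x y) \<in> borel_measurable (lborel \<Otimes>\<^sub>M lborel)"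
    and G [measurable]: "G \<in> borel_measurable borel"
    and J_nonneg: "\<And>x y. x > 0 \<Longrightarrow> y > 0 \<Longrightarrow> 0 \<le> J x y"
    and G_nonneg: "\<And>w. w > 0 \<Longrightarrow> 0 \<le> G w"
    and inner: "\<And>w. w > 0 \<Longrightarrow>
      (\<integral>\<^sup>+x. ennreal (x * J x (x * w)) * indicator {0<..} x \<partial>lborel) = ennreal (G w)"
  shows integral_quadrant_polar: "(\<integral>z. JQ z \<partial>(lborel \<Otimes>\<^sub>M lborel)) = (LBINT w:{0<..}. G w)"
    and integrable_quadrant_polar: "integrable (lborel \<Otimes>\<^sub>M lborel) JQ \<Longrightarrow> set_integrable lborel {0<..} G"
proof -
  have JQ_m [measurable]: "JQ \<in> borel_measurable (lborel \<Otimes>\<^sub>M lborel)"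
    unfolding JQ_def by measurable
  have JQ_nonneg: "0 \<le> JQ z" for z
    unfolding JQ_def by (cases z) (auto simp: J_nonneg split: split_indicator)
  have "(\<integral>\<^sup>+z. ennreal (JQ z) \<partial>(lborel \<Otimes>\<^sub>M lborel))
      = (\<integral>\<^sup>+x. \<integral>\<^sup>+y. ennreal (JQ (x, y)) \<partial>lborel \<partial>lborel)"
    by (rule lborel.nn_integral_fst[symmetric]) measurable
  also have "\<dots> = (\<integral>\<^sup>+x. \<integral>\<^sup>+y. ennreal (J x y) * indicator {0<..} y * indicator {0<..} x \<partial>lborel \<partial>lborel)"
    by (intro nn_integral_cong) (auto simp: JQ_def split: split_indicator)
  also have "\<dots> = (\<integral>\<^sup>+w. (\<integral>\<^sup>+x. ennreal x * ennreal (J x (x * w)) * indicator {0<..} x \<partial>lborel) * indicator {0<..} w \<partial>lborel)"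
    by (rule nn_integral_quadrant_polar) measurable
  also have "\<dots> = (\<integral>\<^sup>+w. ennreal (indicator {0<..} w * G w) \<partial>lborel)"
  proof (rule nn_integral_cong)
    fix w :: real
    have "(\<integral>\<^sup>+x. ennreal x * ennreal (J x (x * w)) * indicator {0<..} x \<partial>lborel) = ennreal (G w)" if "w > 0"
      unfolding inner[OF that, symmetric]
      by (intro nn_integral_cong) (use that in \<open>auto simp: ennreal_mult' split: split_indicator\<close>)
    then show "(\<integral>\<^sup>+x. ennreal x * ennreal (J x (x * w)) * indicator {0<..} x \<partial>lborel) * indicator {0<..} w
        = ennreal (indicator {0<..} w * G w)"
      by (auto split: split_indicator)
  qed
  finally have eq: "(\<integral>\<^sup>+z. ennreal (JQ z) \<partial>(lborel \<Otimes>\<^sub>M lborel)) = (\<integral>\<^sup>+w. ennreal (indicator {0<..} w * G w) \<partial>lborel)" .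
  have G'_nonneg: "0 \<le> indicator {0<..} w * G w" for w
    by (auto simp: G_nonneg split: split_indicator)
  show "(\<integral>z. JQ z \<partial>(lborel \<Otimes>\<^sub>M lborel)) = (LBINT w:{0<..}. G w)"
    unfolding set_lebesgue_integral_def real_scaleR_def
    by (subst (1 2) integral_eq_nn_integral) (auto simp: eq JQ_nonneg G'_nonneg)
  show "set_integrable lborel {0<..} G" if "integrable (lborel \<Otimes>\<^sub>M lborel) JQ"
    unfolding set_integrable_def real_scaleR_def
  proof (rule integrableI_nonneg)
    have "(\<integral>\<^sup>+z. ennreal (JQ z) \<partial>(lborel \<Otimes>\<^sub>M lborel)) < \<infinity>"
      using that JQ_nonneg by (simp add: integrable_iff_bounded)
    then show "(\<integral>\<^sup>+w. ennreal (indicator {0<..} w * G w) \<partial>lborel) < \<infinity>" unfolding eq .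
  qed (auto simp: G'_nonneg)
qed

section \<open>Second moments of integrated processes\<close>

text \<open>Round the time \<open>x\<close> down to a grid of mesh \<open>1 / Suc n\<close>. The
  rounded process takes countably many times and is jointly measurable; by continuity of the paths
  it converges to the process itself.\<close>

lemma borel_measurable_continuous_process:
  fixes Z :: "real \<Rightarrow> 'w \<Rightarrow> real"
  assumes Z [measurable]: "\<And>x. Z x \<in> borel_measurable M"
    and cont: "\<And>\<omega>. \<omega> \<in> space M \<Longrightarrow> continuous_on UNIV (\<lambda>x. Z x \<omega>)"
  shows "(\<lambda>(x, \<omega>). Z x \<omega>) \<in> borel_measurable (lborel \<Otimes>\<^sub>M M)"
proof (rule borel_measurable_LIMSEQ_metric)
  let ?d = "\<lambda>n x. real_of_int \<lfloor>real (Suc n) * x\<rfloor> / real (Suc n)"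
  fix n
  have "(\<lambda>z. Z (real_of_int \<lfloor>real (Suc n) * fst z\<rfloor> / real (Suc n)) (snd z)) \<in> borel_measurable (lborel \<Otimes>\<^sub>M M)"
    by (rule measurable_compose_countable[where g = "\<lambda>z. \<lfloor>real (Suc n) * fst z\<rfloor>"
          and f = "\<lambda>i z. Z (real_of_int i / real (Suc n)) (snd z)"]) measurable
  then show "(\<lambda>z. Z (?d n (fst z)) (snd z)) \<in> borel_measurable (lborel \<Otimes>\<^sub>M M)" .
next
  let ?d = "\<lambda>n x. real_of_int \<lfloor>real (Suc n) * x\<rfloor> / real (Suc n)"
  fix z assume "z \<in> space ((lborel :: real measure) \<Otimes>\<^sub>M M)"
  then have sp: "snd z \<in> space M" by (auto simp: space_pair_measure)
  have "(\<lambda>n. ?d n x) \<longlonglongrightarrow> x" for x :: real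
  proof (rule LIMSEQ_I)
    fix e :: real assume "e > 0"
    then obtain N where N: "inverse (real (Suc N)) < e" using reals_Archimedean by blast
    have "norm (?d n x - x) < e" if "n \<ge> N" for n
    proof -
      have "?d n x - x = (real_of_int \<lfloor>real (Suc n) * x\<rfloor> - real (Suc n) * x) / real (Suc n)"
        by (simp add: diff_divide_distrib)
      then have "\<bar>?d n x - x\<bar> = \<bar>real_of_int \<lfloor>real (Suc n) * x\<rfloor> - real (Suc n) * x\<bar> / real (Suc n)"
        by (simp only: abs_divide abs_of_nat)
      also have "\<dots> \<le> 1 / real (Suc n)"
        by (intro divide_right_mono) linarith+
      finally have "\<bar>?d n x - x\<bar> \<le> inverse (real (Suc n))" by (simp only: inverse_eq_divide)
      also have "\<dots> \<le> inverse (real (Suc N))" using that by (simp add: field_simps)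
      finally show ?thesis using N by simp
    qed
    then show "\<exists>no. \<forall>n\<ge>no. norm (?d n x - x) < e" by blast
  qed
  then show "(\<lambda>n. Z (?d n (fst z)) (snd z)) \<longlonglongrightarrow> (case z of (x, \<omega>) \<Rightarrow> Z x \<omega>)"
    using continuous_on_tendsto_compose[OF cont[OF sp], of "\<lambda>n. ?d n (fst z)" "fst z"]
    by (simp add: case_prod_unfold)
qed

lemma (in pair_sigma_finite)
  fixes f :: "'a \<Rightarrow> real" and g :: "'b \<Rightarrow> real"
  assumes f: "integrable M1 f" and g: "integrable M2 g"
  shows integrable_pair_mult: "integrable (M1 \<Otimes>\<^sub>M M2) (\<lambda>z. f (fst z) * g (snd z))"
    and integral_pair_mult: "(\<integral>z. f (fst z) * g (snd z) \<partial>(M1 \<Otimes>\<^sub>M M2)) = integral\<^sup>L M1 f * integral\<^sup>L M2 g"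
proof -
  note [measurable] = borel_measurable_integrable[OF f] borel_measurable_integrable[OF g]
  show *: "integrable (M1 \<Otimes>\<^sub>M M2) (\<lambda>z. f (fst z) * g (snd z))"
    by (rule Fubini_integrable) (auto simp: abs_mult f g)
  show "(\<integral>z. f (fst z) * g (snd z) \<partial>(M1 \<Otimes>\<^sub>M M2)) = integral\<^sup>L M1 f * integral\<^sup>L M2 g"
    using integral_fst'[OF *] by simp
qed

text \<open>Cauchy-Schwarz from the weighted inequality of arithmetic and geometric means. The
  weight \<open>c = s / r\<close> balances the two squares, so that the bound becomes
  \<open>r * s\<close>; the strict positivity of \<open>r\<close> and \<open>s\<close> allows this
  weight.\<close>

lemma (in prob_space)
  fixes X Y :: "'a \<Rightarrow> real" and r s :: real
  assumes [measurable]: "X \<in> borel_measurable M" "Y \<in> borel_measurable M"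
    and X2: "integrable M (\<lambda>\<omega>. (X \<omega>)\<^sup>2)" and Y2: "integrable M (\<lambda>\<omega>. (Y \<omega>)\<^sup>2)"
  shows integrable_mult_L2: "integrable M (\<lambda>\<omega>. X \<omega> * Y \<omega>)"
    and expectation_abs_mult_le:
      "0 < r \<Longrightarrow> 0 < s \<Longrightarrow> expectation (\<lambda>\<omega>. (X \<omega>)\<^sup>2) \<le> r\<^sup>2 \<Longrightarrow> expectation (\<lambda>\<omega>. (Y \<omega>)\<^sup>2) \<le> s\<^sup>2
        \<Longrightarrow> expectation (\<lambda>\<omega>. \<bar>X \<omega> * Y \<omega>\<bar>) \<le> r * s"
proof -
  have amgm: "\<bar>x * y\<bar> \<le> (c * x\<^sup>2 + y\<^sup>2 / c) / 2" if "c > 0" for c x y :: real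
  proof -
    have "0 \<le> (sqrt c * \<bar>x\<bar> - \<bar>y\<bar> / sqrt c)\<^sup>2" by simp
    also have "\<dots> = c * x\<^sup>2 + y\<^sup>2 / c - 2 * \<bar>x * y\<bar>"
      using that by (simp add: power2_diff power_mult_distrib power_divide abs_mult)
    finally show ?thesis by simp
  qed
  show int: "integrable M (\<lambda>\<omega>. X \<omega> * Y \<omega>)"
    by (rule Bochner_Integration.integrable_bound[where f = "\<lambda>\<omega>. (1 * (X \<omega>)\<^sup>2 + (Y \<omega>)\<^sup>2 / 1) / 2"])
       (use X2 Y2 amgm[of 1] in \<open>auto intro!: AE_I2\<close>)
  assume rs: "0 < r" "0 < s" and XY: "expectation (\<lambda>\<omega>. (X \<omega>)\<^sup>2) \<le> r\<^sup>2" "expectation (\<lambda>\<omega>. (Y \<omega>)\<^sup>2) \<le> s\<^sup>2"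
  have "expectation (\<lambda>\<omega>. \<bar>X \<omega> * Y \<omega>\<bar>) \<le> expectation (\<lambda>\<omega>. (s / r * (X \<omega>)\<^sup>2 + (Y \<omega>)\<^sup>2 / (s / r)) / 2)"
    using rs by (intro integral_mono amgm) (auto simp: X2 Y2 int simp del: times_divide_eq_left divide_divide_eq_right)
  also have "\<dots> = (s / r * expectation (\<lambda>\<omega>. (X \<omega>)\<^sup>2) + expectation (\<lambda>\<omega>. (Y \<omega>)\<^sup>2) / (s / r)) / 2"
    using X2 Y2 by simp
  also have "\<dots> \<le> (s / r * r\<^sup>2 + s\<^sup>2 / (s / r)) / 2"
    using rs XY by (intro divide_right_mono add_mono mult_left_mono) auto
  also have "\<dots> = r * s" using rs by (simp add: power2_eq_square field_simps)
  finally show "expectation (\<lambda>\<omega>. \<bar>X \<omega> * Y \<omega>\<bar>) \<le> r * s" .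
qed

text \<open>Fubini is applied twice: on time and probability space for the mean, and on pairs of
  times and probability space for the square. The dominating functions are
  \<open>\<bar>h x\<bar> * r x\<close> and its product with itself. Assumptions on \<open>Z\<close>
  are made only where \<open>h\<close> does not vanish, because the moment estimates hold only for
  positive times.\<close>

lemma (in prob_space) variance_lborel_integral:
  fixes Z :: "real \<Rightarrow> 'a \<Rightarrow> real" and h r :: "real \<Rightarrow> real"
  assumes Zm [measurable]: "(\<lambda>(x, \<omega>). Z x \<omega>) \<in> borel_measurable (lborel \<Otimes>\<^sub>M M)"
    and h [measurable]: "h \<in> borel_measurable borel"
    and sq: "\<And>x. h x \<noteq> 0 \<Longrightarrow> integrable M (\<lambda>\<omega>. (Z x \<omega>)\<^sup>2)"
    and centered: "\<And>x. h x \<noteq> 0 \<Longrightarrow> expectation (Z x) = 0"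
    and r: "\<And>x. h x \<noteq> 0 \<Longrightarrow> 0 < r x" "\<And>x. h x \<noteq> 0 \<Longrightarrow> expectation (\<lambda>\<omega>. (Z x \<omega>)\<^sup>2) \<le> (r x)\<^sup>2"
    and hr: "integrable lborel (\<lambda>x. \<bar>h x\<bar> * r x)"
  shows "variance (\<lambda>\<omega>. \<integral>x. h x * Z x \<omega> \<partial>lborel)
    = (\<integral>z. h (fst z) * h (snd z) * expectation (\<lambda>\<omega>. Z (fst z) \<omega> * Z (snd z) \<omega>) \<partial>(lborel \<Otimes>\<^sub>M lborel))"
proof -
  interpret P: pair_sigma_finite lborel M ..
  interpret Q: pair_sigma_finite "lborel \<Otimes>\<^sub>M lborel" M ..
  have Z1 [measurable]: "Z x \<in> borel_measurable M" for x
    using measurable_compose[OF measurable_Pair1' Zm, of x] by simp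
  have Z'm [measurable]: "(\<lambda>z. Z (fst z) (snd z)) \<in> borel_measurable (lborel \<Otimes>\<^sub>M M)"
    using Zm by (simp add: case_prod_unfold)
  have m1 [measurable]: "(\<lambda>z. Z (fst (fst z)) (snd z)) \<in> borel_measurable ((lborel \<Otimes>\<^sub>M lborel) \<Otimes>\<^sub>M M)"
    using measurable_compose[OF _ Z'm, of "\<lambda>z. (fst (fst z), snd z)" "(lborel \<Otimes>\<^sub>M lborel) \<Otimes>\<^sub>M M"] by simp
  have m2 [measurable]: "(\<lambda>z. Z (snd (fst z)) (snd z)) \<in> borel_measurable ((lborel \<Otimes>\<^sub>M lborel) \<Otimes>\<^sub>M M)"
    using measurable_compose[OF _ Z'm, of "\<lambda>z. (snd (fst z), snd z)" "(lborel \<Otimes>\<^sub>M lborel) \<Otimes>\<^sub>M M"] by simp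
  \<comment> \<open>Pairing with the constant 1 turns the second-moment bound into a first-moment
    bound.\<close>
  have absZ: "integrable M (Z x)" "expectation (\<lambda>\<omega>. \<bar>Z x \<omega>\<bar>) \<le> r x" if "h x \<noteq> 0" for x
    using integrable_mult_L2[of "Z x" "\<lambda>_. 1"] expectation_abs_mult_le[of "Z x" "\<lambda>_. 1" "r x" 1]
      that sq r by (auto simp: prob_space)
  have I1: "integrable (lborel \<Otimes>\<^sub>M M) (\<lambda>(x, \<omega>). h x * Z x \<omega>)"
  proof (rule P.Fubini_integrable)
    show "(\<lambda>(x, \<omega>). h x * Z x \<omega>) \<in> borel_measurable (lborel \<Otimes>\<^sub>M M)"
      by (simp add: case_prod_unfold)
    show "integrable lborel (\<lambda>x. \<integral>\<omega>. norm (case (x, \<omega>) of (x, \<omega>) \<Rightarrow> h x * Z x \<omega>) \<partial>M)"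
    proof (rule Bochner_Integration.integrable_bound[OF hr])
      show "(\<lambda>x. \<integral>\<omega>. norm (case (x, \<omega>) of (x, \<omega>) \<Rightarrow> h x * Z x \<omega>) \<partial>M) \<in> borel_measurable lborel"
        by (simp add: case_prod_unfold)
      show "AE x in lborel. norm (\<integral>\<omega>. norm (case (x, \<omega>) of (x, \<omega>) \<Rightarrow> h x * Z x \<omega>) \<partial>M) \<le> norm (\<bar>h x\<bar> * r x)"
      proof (rule AE_I2)
        fix x
        show "norm (\<integral>\<omega>. norm (case (x, \<omega>) of (x, \<omega>) \<Rightarrow> h x * Z x \<omega>) \<partial>M) \<le> norm (\<bar>h x\<bar> * r x)"
          using absZ(2)[of x] r(1)[of x] by (cases "h x = 0") (auto simp: abs_mult intro!: mult_left_mono)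
      qed
    qed
    show "AE x in lborel. integrable M (\<lambda>\<omega>. case (x, \<omega>) of (x, \<omega>) \<Rightarrow> h x * Z x \<omega>)"
    proof (rule AE_I2)
      fix x show "integrable M (\<lambda>\<omega>. case (x, \<omega>) of (x, \<omega>) \<Rightarrow> h x * Z x \<omega>)"
        using absZ(1)[of x] by (cases "h x = 0") auto
    qed
  qed
  have prodint: "integrable M (\<lambda>\<omega>. Z x \<omega> * Z y \<omega>)" "expectation (\<lambda>\<omega>. \<bar>Z x \<omega> * Z y \<omega>\<bar>) \<le> r x * r y"
    if "h x \<noteq> 0" "h y \<noteq> 0" for x y
    using integrable_mult_L2[of "Z x" "Z y"] expectation_abs_mult_le[of "Z x" "Z y" "r x" "r y"] that sq r by auto
  let ?F = "\<lambda>z \<omega>. (h (fst z) * h (snd z)) * (Z (fst z) \<omega> * Z (snd z) \<omega>)"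
  have hr2: "integrable (lborel \<Otimes>\<^sub>M lborel) (\<lambda>z. (\<bar>h (fst z)\<bar> * r (fst z)) * (\<bar>h (snd z)\<bar> * r (snd z)))"
    by (rule lborel_pair.integrable_pair_mult[OF hr hr])
  have I2: "integrable ((lborel \<Otimes>\<^sub>M lborel) \<Otimes>\<^sub>M M) (\<lambda>(z, \<omega>). ?F z \<omega>)"
  proof (rule Q.Fubini_integrable)
    show "(\<lambda>(z, \<omega>). ?F z \<omega>) \<in> borel_measurable ((lborel \<Otimes>\<^sub>M lborel) \<Otimes>\<^sub>M M)"
      by (simp add: case_prod_unfold)
    show "integrable (lborel \<Otimes>\<^sub>M lborel) (\<lambda>z. \<integral>\<omega>. norm (case (z, \<omega>) of (z, \<omega>) \<Rightarrow> ?F z \<omega>) \<partial>M)"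
    proof (rule Bochner_Integration.integrable_bound[OF hr2])
      show "(\<lambda>z. \<integral>\<omega>. norm (case (z, \<omega>) of (z, \<omega>) \<Rightarrow> ?F z \<omega>) \<partial>M) \<in> borel_measurable (lborel \<Otimes>\<^sub>M lborel)"
        by (simp add: case_prod_unfold)
      show "AE z in lborel \<Otimes>\<^sub>M lborel. norm (\<integral>\<omega>. norm (case (z, \<omega>) of (z, \<omega>) \<Rightarrow> ?F z \<omega>) \<partial>M)
          \<le> norm ((\<bar>h (fst z)\<bar> * r (fst z)) * (\<bar>h (snd z)\<bar> * r (snd z)))"
      proof (rule AE_I2)
        fix z :: "real \<times> real"
        show "norm (\<integral>\<omega>. norm (case (z, \<omega>) of (z, \<omega>) \<Rightarrow> ?F z \<omega>) \<partial>M)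
          \<le> norm ((\<bar>h (fst z)\<bar> * r (fst z)) * (\<bar>h (snd z)\<bar> * r (snd z)))"
        proof (cases "h (fst z) = 0 \<or> h (snd z) = 0")
          case False
          then have "\<bar>h (fst z) * h (snd z)\<bar> * expectation (\<lambda>\<omega>. \<bar>Z (fst z) \<omega> * Z (snd z) \<omega>\<bar>)
              \<le> \<bar>h (fst z) * h (snd z)\<bar> * (r (fst z) * r (snd z))"
            by (intro mult_left_mono prodint) auto
          moreover have "0 \<le> expectation (\<lambda>\<omega>. \<bar>Z (fst z) \<omega> * Z (snd z) \<omega>\<bar>)" by simp
          ultimately show ?thesis using False r(1)[of "fst z"] r(1)[of "snd z"]
            by (simp add: abs_mult mult_ac)
        qed auto
      qed
    qed
    show "AE z in lborel \<Otimes>\<^sub>M lborel. integrable M (\<lambda>\<omega>. case (z, \<omega>) of (z, \<omega>) \<Rightarrow> ?F z \<omega>)"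
    proof (rule AE_I2)
      fix z :: "real \<times> real" show "integrable M (\<lambda>\<omega>. case (z, \<omega>) of (z, \<omega>) \<Rightarrow> ?F z \<omega>)"
        using prodint(1)[of "fst z" "snd z"] by (cases "h (fst z) = 0 \<or> h (snd z) = 0") auto
    qed
  qed
  let ?I = "\<lambda>\<omega>. \<integral>x. h x * Z x \<omega> \<partial>lborel"
  have "expectation ?I = (\<integral>x. expectation (\<lambda>\<omega>. h x * Z x \<omega>) \<partial>lborel)"
    using P.Fubini_integral[OF I1] by simp
  also have "\<dots> = (\<integral>x. 0 \<partial>(lborel :: real measure))"
    by (rule Bochner_Integration.integral_cong) (use centered in auto)
  finally have EI: "expectation ?I = 0" by simp
  have Im [measurable]: "?I \<in> borel_measurable M"
    using P.integrable_snd[OF I1] by (rule borel_measurable_integrable)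
  have "variance ?I = expectation (\<lambda>\<omega>. (?I \<omega>)\<^sup>2)" by (simp add: EI)
  also have "\<dots> = expectation (\<lambda>\<omega>. \<integral>z. ?F z \<omega> \<partial>(lborel \<Otimes>\<^sub>M lborel))"
  proof (rule integral_cong_AE)
    show "(\<lambda>\<omega>. \<integral>z. ?F z \<omega> \<partial>(lborel \<Otimes>\<^sub>M lborel)) \<in> borel_measurable M"
      using Q.integrable_snd[OF I2] by (rule borel_measurable_integrable)
    \<comment> \<open>Almost every path is absolutely integrable against \<open>h\<close>; for such
      a path the square of the integral is an integral over the product.\<close>
    show "AE \<omega> in M. (?I \<omega>)\<^sup>2 = (\<integral>z. ?F z \<omega> \<partial>(lborel \<Otimes>\<^sub>M lborel))"
      using P.AE_integrable_snd[OF I1]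
    proof eventually_elim
      case (elim \<omega>)
      then show ?case using lborel_pair.integral_pair_mult[OF elim elim]
        by (simp add: power2_eq_square mult_ac)
    qed
  qed simp
  also have "\<dots> = (\<integral>z. expectation (?F z) \<partial>(lborel \<Otimes>\<^sub>M lborel))"
    using Q.Fubini_integral[OF I2] by simp
  finally show ?thesis by simp
qed

section \<open>Extreme-value copulas\<close>

text \<open>
  The values of \<open>A\<close> at the endpoints are irrelevant and set to \<open>1\<close>, so that the formula
  \<open>C(exp(-p), exp(-q)) = exp(-tail_dep A p q)\<close> holds for all \<open>p, q \<ge> 0\<close> (\<open>0 / 0 = 0\<close> at \<open>p = q = 0\<close>).
\<close>
definition tail_dep :: "(real \<Rightarrow> real) \<Rightarrow> real \<Rightarrow> real \<Rightarrow> real" where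
  "tail_dep A p q = (p + q) * (if q / (p + q) \<in> {0<..<1} then A (q / (p + q)) else 1)"

lemma tail_dep_zero [simp]: "tail_dep A p 0 = p" "tail_dep A 0 q = q"
  by (cases "q = 0"; simp add: tail_dep_def)+

lemma tail_dep_pos: "p > 0 \<Longrightarrow> q > 0 \<Longrightarrow> tail_dep A p q = (p + q) * A (q / (p + q))"
  by (simp add: tail_dep_def)

lemma tail_dep_scale: "r > 0 \<Longrightarrow> tail_dep A (r * p) (r * q) = r * tail_dep A p q"
proof -
  assume r: "r > 0"
  have "r * q / (r * p + r * q) = q / (p + q)"
    using r by (simp flip: distrib_left)
  then show ?thesis unfolding tail_dep_def by (simp add: algebra_simps)
qed

lemma pickands_function_bounds:
  assumes "pickands_function A" "s \<in> {0..1}"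
  shows "s \<le> A s" "1 - s \<le> A s" "A s \<le> 1" "1 / 2 \<le> A s"
  using assms unfolding pickands_function_def by (auto simp: Pi_iff)

lemma tail_dep_bounds:
  assumes A: "pickands_function A" and "0 \<le> p" "0 \<le> q"
  shows "p \<le> tail_dep A p q" "q \<le> tail_dep A p q" "tail_dep A p q \<le> p + q"
proof -
  have "p \<le> tail_dep A p q \<and> q \<le> tail_dep A p q \<and> tail_dep A p q \<le> p + q"
  proof (cases "p = 0 \<or> q = 0")
    case False
    then have pq: "0 < p" "0 < q" using assms by auto
    let ?s = "q / (p + q)"
    have s: "?s \<in> {0..1}" using pq by auto
    have "(p + q) * ?s = q" "(p + q) * (1 - ?s) = p" using pq by (auto simp: field_simps)
    then have "q \<le> (p + q) * A ?s" "p \<le> (p + q) * A ?s" "(p + q) * A ?s \<le> (p + q) * 1"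
      using pickands_function_bounds[OF A s] pq mult_left_mono[of _ "A ?s" "p + q"]
        mult_left_mono[of "A ?s" 1 "p + q"] by fastforce+
    then show ?thesis using pq by (simp add: tail_dep_pos)
  qed (use assms in auto)
  then show "p \<le> tail_dep A p q" "q \<le> tail_dep A p q" "tail_dep A p q \<le> p + q" by auto
qed

text \<open>If both maxima come from the same pair, the other summand is nonnegative. Otherwise
  \<open>tail_dep\<close> of the mixed pair is at most the sum of its entries, and each entry is
  bounded by the \<open>tail_dep\<close> of the pair it comes from. Since minima of copula arguments
  are maxima of exponents, this is what makes the covariances nonnegative.\<close>

lemma tail_dep_max_le:
  assumes A: "pickands_function A" and "0 \<le> p" "0 \<le> q" "0 \<le> p'" "0 \<le> q'"
  shows "tail_dep A (max p p') (max q q') \<le> tail_dep A p q + tail_dep A p' q'"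
  using assms tail_dep_bounds[OF A, of p q] tail_dep_bounds[OF A, of p' q']
    tail_dep_bounds[OF A, of p q'] tail_dep_bounds[OF A, of p' q]
  by (auto simp: max_def)

text \<open>Differentiability gives continuity of \<open>A\<close> inside the unit interval;
  replacing \<open>A\<close> by 1 elsewhere gives a Borel function whatever the other values of
  \<open>A\<close> are.\<close>

lemma borel_measurable_tail_dep:
  assumes "\<forall>s\<in>{0<..<1}. A differentiable (at s)"
    and [measurable]: "f \<in> borel_measurable M" "g \<in> borel_measurable M"
  shows "(\<lambda>x. tail_dep A (f x) (g x)) \<in> borel_measurable M"
proof -
  have "continuous_on {0<..<1} A"
    using assms(1) by (auto intro!: continuous_at_imp_continuous_on differentiable_imp_continuous_within)
  then have "(\<lambda>s. if s \<in> {0<..<1} then A s else 1) \<in> borel_measurable borel"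
    by (intro borel_measurable_continuous_on_if) auto
  then have "(\<lambda>x. (\<lambda>s. if s \<in> {0<..<1} then A s else 1) (g x / (f x + g x))) \<in> borel_measurable M"
    by (rule measurable_compose[rotated]) measurable
  then show ?thesis unfolding tail_dep_def by measurable
qed

lemma extreme_value_copula_exp:
  assumes C: "extreme_value_copula A C" and "0 \<le> p" "0 \<le> q"
  shows "C (exp (- p)) (exp (- q)) = exp (- tail_dep A p q)"
proof (cases "p = 0 \<or> q = 0")
  case True
  \<comment> \<open>The power formula is available only on the open square; on the edges the uniform
    margins take over.\<close>
  have "C u 1 = u" "C 1 u = u" if "u \<in> {0..1}" for u
    using C that by (auto simp: extreme_value_copula_def copula_def)
  then show ?thesis using True assms by auto
next
  case False
  then have pq: "0 < p" "0 < q" using assms by auto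
  have "C (exp (- p)) (exp (- q)) = (exp (- p) * exp (- q)) powr A (ln (exp (- q)) / ln (exp (- p) * exp (- q)))"
    using C pq by (simp add: extreme_value_copula_def)
  also have "exp (- p) * exp (- q) = exp (- (p + q))" by (simp add: exp_add[symmetric])
  also have "ln (exp (- q)) / ln (exp (- (p + q))) = q / (p + q)"
    using pq by (simp add: field_simps)
  also have "exp (- (p + q)) powr A (q / (p + q)) = exp (- tail_dep A p q)"
    using pq by (simp add: powr_def tail_dep_pos algebra_simps)
  finally show ?thesis .
qed

text \<open>The logarithm of \<open>C\<close> is
  \<open>A (ln v / (ln u + ln v)) * (ln u + ln v)\<close>. Its derivatives in \<open>u\<close> and
  \<open>v\<close> are \<open>(A s - s * D) / u\<close> and \<open>(A s + (1 - s) * D) / v\<close>,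
  and \<open>exp (- (A s * x))\<close> is the value of \<open>C\<close> at this point. This is the
  origin of \<open>\<mu>\<close>, \<open>\<nu>\<close> and of the exponents
  \<open>A t - (1 - t)\<close> and \<open>A t - t\<close>.\<close>

lemma extreme_value_copula_derivs:
  assumes C: "extreme_value_copula A C" and s: "s \<in> {0<..<1}" and D: "(A has_real_derivative D) (at s)"
    and x: "x > 0"
  defines "u \<equiv> exp (- ((1 - s) * x))" and "v \<equiv> exp (- (s * x))"
  shows "partial1 C u v = (A s - s * D) * (exp (- (A s * x)) / u)"
    and "partial2 C u v = (A s + (1 - s) * D) * (exp (- (A s * x)) / v)"
proof -
  have uv: "0 < u" "u < 1" "0 < v" "v < 1" using s x unfolding u_def v_def by auto
  have lnu: "ln u = - ((1 - s) * x)" and lnv: "ln v = - (s * x)" unfolding u_def v_def by auto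
  have luv: "ln u + ln v = - x" by (simp add: lnu lnv algebra_simps)
  have sv: "ln v / (ln u + ln v) = s" unfolding luv using x by (simp add: lnv)
  have Cuv: "C y z = exp (A (ln z / (ln y + ln z)) * (ln y + ln z))"
    if "y \<in> {0<..<1}" "z \<in> {0<..<1}" for y z
    using C that by (simp add: extreme_value_copula_def powr_def ln_mult)
  have D': "(A has_real_derivative D) (at (ln v / (ln u + ln v)))" using D sv by simp
  have d1: "((\<lambda>y. ln v / (ln y + ln v)) has_real_derivative - ln v * (1 / u) / (ln u + ln v)\<^sup>2) (at u)"
    using uv luv x by (auto intro!: derivative_eq_intros simp: power2_eq_square)
  have "((\<lambda>y. exp (A (ln v / (ln y + ln v)) * (ln y + ln v))) has_real_derivative
      exp (A (ln v / (ln u + ln v)) * (ln u + ln v)) *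
      (D * (- ln v * (1 / u) / (ln u + ln v)\<^sup>2) * (ln u + ln v) + 1 / u * A (ln v / (ln u + ln v)))) (at u)"
    by (rule derivative_eq_intros DERIV_chain2[OF D' d1] refl | use uv in simp)+
  also have "exp (A (ln v / (ln u + ln v)) * (ln u + ln v)) *
      (D * (- ln v * (1 / u) / (ln u + ln v)\<^sup>2) * (ln u + ln v) + 1 / u * A (ln v / (ln u + ln v)))
      = (A s - s * D) * (exp (- (A s * x)) / u)"
    unfolding sv unfolding luv unfolding lnv using x uv by (simp add: field_simps power2_eq_square)
  finally have "((\<lambda>y. C y v) has_real_derivative (A s - s * D) * (exp (- (A s * x)) / u)) (at u)"
    \<comment> \<open>The explicit formula for \<open>C\<close> holds only near \<open>u\<close>,
      inside the open square, so the derivative is transferred along an eventual equality.\<close>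
    by (rule DERIV_cong_ev[THEN iffD1, rotated -1])
       (use uv in \<open>auto intro!: eventually_mono[OF eventually_nhds_in_open[of "{0<..<1}"]] simp: Cuv\<close>)
  then show "partial1 C u v = (A s - s * D) * (exp (- (A s * x)) / u)"
    unfolding partial1_def by (rule DERIV_imp_deriv)
  have "((\<lambda>y. ln y / (ln u + ln y)) has_real_derivative
      (1 / v * (ln u + ln v) - ln v * (1 / v)) / ((ln u + ln v) * (ln u + ln v))) (at v)"
    using uv luv x by (intro DERIV_divide) (auto intro!: derivative_eq_intros)
  also have "1 / v * (ln u + ln v) - ln v * (1 / v) = ln u * (1 / v)" by (simp add: algebra_simps)
  finally have d2: "((\<lambda>y. ln y / (ln u + ln y)) has_real_derivative ln u * (1 / v) / (ln u + ln v)\<^sup>2) (at v)"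
    by (simp only: power2_eq_square)
  have "((\<lambda>y. exp (A (ln y / (ln u + ln y)) * (ln u + ln y))) has_real_derivative
      exp (A (ln v / (ln u + ln v)) * (ln u + ln v)) *
      (D * (ln u * (1 / v) / (ln u + ln v)\<^sup>2) * (ln u + ln v) + 1 / v * A (ln v / (ln u + ln v)))) (at v)"
    by (rule derivative_eq_intros DERIV_chain2[OF D' d2] refl | use uv in simp)+
  also have "exp (A (ln v / (ln u + ln v)) * (ln u + ln v)) *
      (D * (ln u * (1 / v) / (ln u + ln v)\<^sup>2) * (ln u + ln v) + 1 / v * A (ln v / (ln u + ln v)))
      = (A s + (1 - s) * D) * (exp (- (A s * x)) / v)"
    unfolding sv unfolding luv unfolding lnu using x uv by (simp add: field_simps power2_eq_square)
  finally have "((\<lambda>y. C u y) has_real_derivative (A s + (1 - s) * D) * (exp (- (A s * x)) / v)) (at v)"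
    by (rule DERIV_cong_ev[THEN iffD1, rotated -1])
       (use uv in \<open>auto intro!: eventually_mono[OF eventually_nhds_in_open[of "{0<..<1}"]] simp: Cuv\<close>)
  then show "partial2 C u v = (A s + (1 - s) * D) * (exp (- (A s * x)) / v)"
    unfolding partial2_def by (rule DERIV_imp_deriv)
qed

lemma (in prob_space)
  assumes "normal_rv M X"
  shows normal_rv_measurable: "X \<in> borel_measurable M"
    and normal_rv_square_integrable: "integrable M (\<lambda>\<omega>. (X \<omega>)\<^sup>2)"
proof -
  show [measurable]: "X \<in> borel_measurable M" using assms by (simp add: normal_rv_def)
  from assms obtain m where "(AE \<omega> in M. X \<omega> = m) \<or>
      (\<exists>\<sigma>>0. distributed M lborel X (\<lambda>x. ennreal (normal_density m \<sigma> x)))"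
    unfolding normal_rv_def by auto
  then show "integrable M (\<lambda>\<omega>. (X \<omega>)\<^sup>2)"
  proof (elim disjE exE conjE)
    assume "AE \<omega> in M. X \<omega> = m"
    then have "AE \<omega> in M. (X \<omega>)\<^sup>2 = m\<^sup>2" by eventually_elim simp
    then have "integrable M (\<lambda>\<omega>. (X \<omega>)\<^sup>2) \<longleftrightarrow> integrable M (\<lambda>\<omega>. m\<^sup>2)"
      by (intro integrable_cong_AE) auto
    then show ?thesis by simp
  next
    fix \<sigma> :: real assume \<sigma>: "\<sigma> > 0" and d: "distributed M lborel X (\<lambda>x. ennreal (normal_density m \<sigma> x))"
    \<comment> \<open>The second moment is expanded around the mean,
      \<open>x^2 = (x - m)^2 + 2 m (x - m) + m^2\<close>, to reduce it to central moments.\<close>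
    have "integrable lborel (\<lambda>x. normal_density m \<sigma> x * (x - m)^2 + 2 * m * (normal_density m \<sigma> x * (x - m)^1) + m\<^sup>2 * normal_density m \<sigma> x)"
      using \<sigma> by (intro Bochner_Integration.integrable_add integrable_mult_right integrable_normal_moment integrable_normal_density)
    also have "(\<lambda>x. normal_density m \<sigma> x * (x - m)^2 + 2 * m * (normal_density m \<sigma> x * (x - m)^1) + m\<^sup>2 * normal_density m \<sigma> x)
        = (\<lambda>x. normal_density m \<sigma> x * x\<^sup>2)"
      by (auto simp: algebra_simps power2_eq_square)
    finally show ?thesis
      by (subst (asm) distributed_integrable[OF d]) auto
  qed
qed

section \<open>Covariances of the rescaled sheet\<close>

text \<open>
  A triple \<open>(e, p, q)\<close> encodes the process \<open>x \<mapsto> exp(-e x) \<alpha>(exp(-p x), exp(-q x))\<close>. With \<open>u = exp(-x)\<close>,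
  the three terms of the copula process at \<open>(u^(1-t), u^t)\<close> are of this form up to the factors \<open>1\<close>, \<open>\<mu>(t)\<close> and \<open>\<nu>(t)\<close>.
  The absolute values only serve to make it continuous on the whole line.
\<close>
definition scaled_sheet ::
    "(real \<times> real \<Rightarrow> 'w \<Rightarrow> real) \<Rightarrow> real \<times> real \<times> real \<Rightarrow> real \<Rightarrow> 'w \<Rightarrow> real" where
  "scaled_sheet \<alpha> T x \<omega> = (case T of (e, p, q) \<Rightarrow>
     exp (- (e * x)) * \<alpha> (exp (- (p * \<bar>x\<bar>)), exp (- (q * \<bar>x\<bar>))) \<omega>)"

text \<open>The last equation says that
  \<open>exp (- (e * x)) * C (exp (- (p * x))) (exp (- (q * x)))\<close> equals
  \<open>exp (- (a * x))\<close>; thus the subtracted term of every covariance is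
  \<open>exp (- (a * (x + y)))\<close>. The condition \<open>p + q \<le> 1\<close> keeps
  \<open>tail_dep A p q\<close> at most 1, which enters the second-moment bound.\<close>

definition admissible :: "(real \<Rightarrow> real) \<Rightarrow> real \<Rightarrow> real \<times> real \<times> real \<Rightarrow> bool" where
  "admissible A a T \<longleftrightarrow> (case T of (e, p, q) \<Rightarrow>
     0 \<le> e \<and> 0 \<le> p \<and> 0 \<le> q \<and> p + q \<le> 1 \<and> e + tail_dep A p q = a)"

text \<open>The decay rate of the joint term of the covariance along the ray
  \<open>y = x * w\<close>; the maxima stem from the minima in the covariance of the sheet.\<close>

definition joint_rate ::
    "(real \<Rightarrow> real) \<Rightarrow> real \<times> real \<times> real \<Rightarrow> real \<times> real \<times> real \<Rightarrow> real \<Rightarrow> real" where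
  "joint_rate A T T' w = (case T of (e, p, q) \<Rightarrow> case T' of (e', p', q') \<Rightarrow>
     e + e' * w + tail_dep A (max p (p' * w)) (max q (q' * w)))"

text \<open>The covariance at times \<open>x, y > 0\<close>. Writing it through \<open>y / x\<close>
  makes it a difference of two exponentials in \<open>x\<close> along each ray.\<close>

definition cov_kernel ::
    "(real \<Rightarrow> real) \<Rightarrow> real \<Rightarrow> real \<times> real \<times> real \<Rightarrow> real \<times> real \<times> real \<Rightarrow> real \<Rightarrow> real \<Rightarrow> real" where
  "cov_kernel A a T T' x y = exp (- (x * joint_rate A T T' (y / x))) - exp (- (a * (x + y)))"

text \<open>Positivity: \<open>a > 0\<close> forces one of \<open>e\<close>, \<open>p\<close>,
  \<open>q\<close> to be positive, and each of them is a lower bound for the rate. The upper bound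
  is subadditivity under maxima combined with homogeneity; it amounts to the covariance being
  nonnegative.\<close>

lemma joint_rate_bounds:
  assumes A: "pickands_function A" and T: "admissible A a T" "admissible A a T'" and a: "0 < a" and w: "0 < w"
  shows "0 < joint_rate A T T' w" "joint_rate A T T' w \<le> a * (1 + w)"
proof -
  obtain e p q e' p' q' where TT: "T = (e, p, q)" "T' = (e', p', q')" by (cases T; cases T')
  have 1: "0 \<le> e" "0 \<le> p" "0 \<le> q" "e + tail_dep A p q = a"
    and 2: "0 \<le> e'" "0 \<le> p'" "0 \<le> q'" "e' + tail_dep A p' q' = a"
    using T by (auto simp: admissible_def TT)
  have 3: "0 \<le> e' * w" "0 \<le> p' * w" "0 \<le> q' * w" using 2 w by auto
  have "tail_dep A p q \<le> p + q" using tail_dep_bounds[OF A] 1 by auto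
  then have "0 < e \<or> 0 < p \<or> 0 < q" using 1 a by linarith
  moreover have "max p (p' * w) \<le> tail_dep A (max p (p' * w)) (max q (q' * w))"
      "max q (q' * w) \<le> tail_dep A (max p (p' * w)) (max q (q' * w))"
    using tail_dep_bounds[OF A, of "max p (p' * w)" "max q (q' * w)"] 1 by auto
  ultimately show "0 < joint_rate A T T' w"
    using 1 3 by (auto simp: joint_rate_def TT)
  have "tail_dep A (max p (p' * w)) (max q (q' * w)) \<le> tail_dep A p q + tail_dep A (w * p') (w * q')"
    using tail_dep_max_le[OF A, of p q "p' * w" "q' * w"] 1 3 by (simp add: mult.commute)
  also have "tail_dep A (w * p') (w * q') = w * tail_dep A p' q'" by (rule tail_dep_scale[OF w])
  finally have "joint_rate A T T' w \<le> (e + tail_dep A p q) + w * (e' + tail_dep A p' q')"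
    by (simp add: joint_rate_def TT algebra_simps)
  then show "joint_rate A T T' w \<le> a * (1 + w)"
    unfolding 1(4) 2(4) by (simp add: algebra_simps)
qed

lemma borel_measurable_joint_rate:
  assumes "\<forall>s\<in>{0<..<1}. A differentiable (at s)" and [measurable]: "f \<in> borel_measurable M"
  shows "(\<lambda>x. joint_rate A T T' (f x)) \<in> borel_measurable M"
proof -
  obtain e p q e' p' q' where TT: "T = (e, p, q)" "T' = (e', p', q')" by (cases T; cases T')
  have [measurable]: "(\<lambda>x. tail_dep A (max p (p' * f x)) (max q (q' * f x))) \<in> borel_measurable M"
    by (rule borel_measurable_tail_dep[OF assms(1)]) measurable
  show ?thesis unfolding joint_rate_def TT by simp
qed

lemma borel_measurable_cov_kernel:
  assumes "\<forall>s\<in>{0<..<1}. A differentiable (at s)"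
    and [measurable]: "f \<in> borel_measurable M" "g \<in> borel_measurable M"
  shows "(\<lambda>x. cov_kernel A a T T' (f x) (g x)) \<in> borel_measurable M"
proof -
  have [measurable]: "(\<lambda>x. joint_rate A T T' (g x / f x)) \<in> borel_measurable M"
    by (rule borel_measurable_joint_rate[OF assms(1)]) measurable
  show ?thesis unfolding cov_kernel_def by measurable
qed

lemma cov_kernel_nonneg:
  assumes A: "pickands_function A" and T: "admissible A a T" "admissible A a T'" and a: "0 < a"
    and xy: "0 < x" "0 < y"
  shows "0 \<le> cov_kernel A a T T' x y"
proof -
  have "joint_rate A T T' (y / x) \<le> a * (1 + y / x)"
    using joint_rate_bounds(2)[OF A T a] xy by simp
  then have "x * joint_rate A T T' (y / x) \<le> x * (a * (1 + y / x))"
    using xy by (intro mult_left_mono) auto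
  also have "\<dots> = a * (x + y)" using xy by (simp add: field_simps)
  finally show ?thesis by (simp add: cov_kernel_def)
qed

locale pickands_sheet = prob_space M
  for M :: "'w measure" and A :: "real \<Rightarrow> real" and C :: "real \<Rightarrow> real \<Rightarrow> real"
    and \<alpha> :: "real \<times> real \<Rightarrow> 'w \<Rightarrow> real" +
  assumes A: "pickands_function A"
    and A_diff: "\<forall>s\<in>{0<..<1}. A differentiable (at s)"
    and C: "extreme_value_copula A C"
    and sheet: "pinned_brownian_sheet M C \<alpha>"
begin

lemma sheet_moments:
  assumes "u \<in> {0..1}" "v \<in> {0..1}"
  shows "\<alpha> (u, v) \<in> borel_measurable M" "integrable M (\<lambda>\<omega>. (\<alpha> (u, v) \<omega>)\<^sup>2)"
    "expectation (\<alpha> (u, v)) = 0"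
proof -
  have "normal_rv M (\<lambda>\<omega>. \<Sum>i\<in>{(u, v)}. 1 * \<alpha> i \<omega>)"
    using sheet assms unfolding pinned_brownian_sheet_def gaussian_process_def
    by (elim conjE allE[of _ "{(u, v)}"] allE[of _ "\<lambda>_. 1"]) auto
  then have "normal_rv M (\<alpha> (u, v))" by simp
  then show "\<alpha> (u, v) \<in> borel_measurable M" "integrable M (\<lambda>\<omega>. (\<alpha> (u, v) \<omega>)\<^sup>2)"
    by (rule normal_rv_measurable, rule normal_rv_square_integrable)
  show "expectation (\<alpha> (u, v)) = 0"
    using sheet assms unfolding pinned_brownian_sheet_def by auto
qed

lemma sheet_cov:
  assumes "u \<in> {0..1}" "v \<in> {0..1}" "u' \<in> {0..1}" "v' \<in> {0..1}"
  shows "expectation (\<lambda>\<omega>. \<alpha> (u, v) \<omega> * \<alpha> (u', v') \<omega>) = C (min u u') (min v v') - C u v * C u' v'"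
proof -
  have "cov M (\<alpha> (u, v)) (\<alpha> (u', v')) = C (min u u') (min v v') - C u v * C u' v'"
    using sheet assms unfolding pinned_brownian_sheet_def by auto
  then show ?thesis using assms by (simp add: cov_def sheet_moments)
qed

lemma scaled_sheet_moments:
  assumes T: "admissible A a T"
  shows "scaled_sheet \<alpha> T x \<in> borel_measurable M" "integrable M (\<lambda>\<omega>. (scaled_sheet \<alpha> T x \<omega>)\<^sup>2)"
    "expectation (scaled_sheet \<alpha> T x) = 0"
proof -
  obtain e p q where TT: "T = (e, p, q)" by (cases T)
  have "exp (- (p * \<bar>x\<bar>)) \<in> {0..1}" "exp (- (q * \<bar>x\<bar>)) \<in> {0..1}"
    using T by (auto simp: TT admissible_def)
  note m = sheet_moments[OF this]
  have [measurable]: "\<alpha> (exp (- (p * \<bar>x\<bar>)), exp (- (q * \<bar>x\<bar>))) \<in> borel_measurable M" by (rule m)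
  have eq: "scaled_sheet \<alpha> T x = (\<lambda>\<omega>. exp (- (e * x)) * \<alpha> (exp (- (p * \<bar>x\<bar>)), exp (- (q * \<bar>x\<bar>))) \<omega>)"
    by (auto simp: scaled_sheet_def TT)
  show "scaled_sheet \<alpha> T x \<in> borel_measurable M" unfolding eq by measurable
  show "integrable M (\<lambda>\<omega>. (scaled_sheet \<alpha> T x \<omega>)\<^sup>2)" unfolding eq power_mult_distrib
    using m(2) by simp
  show "expectation (scaled_sheet \<alpha> T x) = 0" unfolding eq using m(3) by simp
qed

lemma scaled_sheet_continuous:
  assumes T: "admissible A a T" and \<omega>: "\<omega> \<in> space M"
  shows "continuous_on UNIV (\<lambda>x. scaled_sheet \<alpha> T x \<omega>)"
proof -
  obtain e p q where TT: "T = (e, p, q)" by (cases T)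
  have c: "continuous_on ({0..1} \<times> {0..1}) (\<lambda>z. \<alpha> z \<omega>)"
    using sheet \<omega> unfolding pinned_brownian_sheet_def by auto
  have "continuous_on UNIV (\<lambda>x. \<alpha> (exp (- (p * \<bar>x\<bar>)), exp (- (q * \<bar>x\<bar>))) \<omega>)"
    by (rule continuous_on_compose2[OF c])
       (use T in \<open>auto intro!: continuous_intros simp: admissible_def TT\<close>)
  then show ?thesis unfolding scaled_sheet_def TT by (auto intro!: continuous_intros)
qed

lemma scaled_sheet_jointly_measurable:
  assumes T: "admissible A a T"
  shows "(\<lambda>z. scaled_sheet \<alpha> T (fst z) (snd z)) \<in> borel_measurable (lborel \<Otimes>\<^sub>M M)"
  using borel_measurable_continuous_process[of "scaled_sheet \<alpha> T" M,
      OF scaled_sheet_moments(1)[OF T] scaled_sheet_continuous[OF T]]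
  by (simp add: case_prod_unfold)

lemma scaled_sheet_cov:
  assumes T: "admissible A a T" "admissible A a T'" and xy: "0 < x" "0 < y"
  shows "expectation (\<lambda>\<omega>. scaled_sheet \<alpha> T x \<omega> * scaled_sheet \<alpha> T' y \<omega>) = cov_kernel A a T T' x y"
proof -
  obtain e p q e' p' q' where TT: "T = (e, p, q)" "T' = (e', p', q')" by (cases T; cases T')
  have 1: "0 \<le> e" "0 \<le> p" "0 \<le> q" "e + tail_dep A p q = a"
    and 2: "0 \<le> e'" "0 \<le> p'" "0 \<le> q'" "e' + tail_dep A p' q' = a"
    using T by (auto simp: admissible_def TT)
  have m: "min (exp (- r)) (exp (- s)) = exp (- max r s)" for r s :: real by (auto simp: min_def max_def)
  have scale: "tail_dep A (p * x) (q * x) = x * tail_dep A p q" "tail_dep A (p' * y) (q' * y) = y * tail_dep A p' q'"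
    using tail_dep_scale[of x A p q] tail_dep_scale[of y A p' q'] xy by (simp_all add: mult.commute)
  have mx: "max (p * x) (p' * y) = x * max p (p' * (y / x))" "max (q * x) (q' * y) = x * max q (q' * (y / x))"
    using xy by (auto simp: max_mult_distrib_left mult.commute)
  have "expectation (\<lambda>\<omega>. scaled_sheet \<alpha> T x \<omega> * scaled_sheet \<alpha> T' y \<omega>)
    = expectation (\<lambda>\<omega>. (exp (- (e * x)) * exp (- (e' * y))) *
        (\<alpha> (exp (- (p * x)), exp (- (q * x))) \<omega> * \<alpha> (exp (- (p' * y)), exp (- (q' * y))) \<omega>))"
    using xy by (simp add: scaled_sheet_def TT mult_ac)
  also have "\<dots> = (exp (- (e * x)) * exp (- (e' * y))) *
     (C (min (exp (- (p * x))) (exp (- (p' * y)))) (min (exp (- (q * x))) (exp (- (q' * y))))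
      - C (exp (- (p * x))) (exp (- (q * x))) * C (exp (- (p' * y))) (exp (- (q' * y))))"
    using 1 2 xy by (subst integral_mult_right_zero, subst sheet_cov) auto
  also have "\<dots> = (exp (- (e * x)) * exp (- (e' * y))) *
     (exp (- tail_dep A (max (p * x) (p' * y)) (max (q * x) (q' * y)))
      - exp (- tail_dep A (p * x) (q * x)) * exp (- tail_dep A (p' * y) (q' * y)))"
    unfolding m using 1 2 xy by (simp add: extreme_value_copula_exp[OF C] le_max_iff_disj)
  also have "\<dots> = exp (- (e * x + e' * y + tail_dep A (max (p * x) (p' * y)) (max (q * x) (q' * y))))
      - exp (- (e * x + e' * y + tail_dep A (p * x) (q * x) + tail_dep A (p' * y) (q' * y)))"
    by (simp add: right_diff_distrib mult_exp_exp algebra_simps)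
  also have "e * x + e' * y + tail_dep A (p * x) (q * x) + tail_dep A (p' * y) (q' * y)
      = (e + tail_dep A p q) * x + (e' + tail_dep A p' q') * y"
    unfolding scale by (simp add: algebra_simps)
  also have "\<dots> = a * (x + y)" unfolding 1 2 by (simp add: algebra_simps)
  also have "e * x + e' * y + tail_dep A (max (p * x) (p' * y)) (max (q * x) (q' * y)) = x * joint_rate A T T' (y / x)"
    unfolding mx tail_dep_scale[OF xy(1)] using xy by (simp add: joint_rate_def TT algebra_simps)
  finally show ?thesis by (simp add: cov_kernel_def)
qed

text \<open>With \<open>l = tail_dep A p q\<close> the second moment is
  \<open>exp (- (a * x)) * exp (- (e * x)) * (1 - exp (- (l * x)))\<close>. The last factor is at
  most both 1 and \<open>x\<close>: the linear decay at 0 serves the CFG weight, the exponential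
  serves the tail.\<close>

lemma scaled_sheet_second_moment_le:
  assumes T: "admissible A a T" and x: "0 < x"
  shows "expectation (\<lambda>\<omega>. (scaled_sheet \<alpha> T x \<omega>)\<^sup>2) \<le> exp (- (a * x)) * min 1 x"
proof -
  obtain e p q where TT: "T = (e, p, q)" by (cases T)
  have 1: "0 \<le> e" "0 \<le> p" "0 \<le> q" "p + q \<le> 1" "e + tail_dep A p q = a"
    using T by (auto simp: admissible_def TT)
  let ?l = "tail_dep A p q"
  have l: "0 \<le> ?l" "?l \<le> 1" using tail_dep_bounds[OF A, of p q] 1 by auto
  have "expectation (\<lambda>\<omega>. (scaled_sheet \<alpha> T x \<omega>)\<^sup>2) = cov_kernel A a T T x x"
    unfolding power2_eq_square by (rule scaled_sheet_cov[OF T T x x])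
  also have "\<dots> = exp (- (a * x)) * (exp (- (e * x)) * (1 - exp (- (?l * x))))"
  proof -
    have "x * joint_rate A T T 1 = a * x + e * x" using 1 by (simp add: joint_rate_def TT algebra_simps flip: 1(5))
    then have j1: "- (x * joint_rate A T T 1) = - (a * x) + - (e * x)" by simp
    have "a * x = e * x + ?l * x" by (simp add: algebra_simps flip: 1(5))
    then have "a * (x + x) = a * x + e * x + ?l * x" by (simp only: distrib_left add.assoc)
    then have j2: "- (a * (x + x)) = - (a * x) + (- (e * x) + - (?l * x))"
      by (simp only: minus_add_distrib add.assoc)
    have "cov_kernel A a T T x x = exp (- (a * x) + - (e * x)) - exp (- (a * x) + (- (e * x) + - (?l * x)))"
      unfolding cov_kernel_def divide_self[OF less_imp_neq[OF x, symmetric]] j1 j2 ..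
    then show ?thesis unfolding exp_add by (simp add: algebra_simps)
  qed
  also have "\<dots> \<le> exp (- (a * x)) * min 1 x"
  proof (rule mult_left_mono)
    have "1 - exp (- (?l * x)) \<le> ?l * x" using exp_ge_add_one_self[of "- (?l * x)"] by linarith
    also have "\<dots> \<le> x" using l x by (simp add: mult_left_le_one_le)
    finally have "1 - exp (- (?l * x)) \<le> min 1 x" by simp
    moreover have "0 \<le> 1 - exp (- (?l * x))" using l x by simp
    moreover have "exp (- (e * x)) \<le> 1" using 1 x by simp
    ultimately show "exp (- (e * x)) * (1 - exp (- (?l * x))) \<le> min 1 x"
      by (intro order_trans[OF mult_left_le_one_le]) auto
  qed simp
  finally show ?thesis .
qed

text \<open>By Cauchy-Schwarz every kernel is dominated by a product of square roots of
  second-moment bounds. Hence each double integral exists on its own and the variance of the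
  combination can be expanded term by term.\<close>

lemma
  fixes h :: "real \<Rightarrow> real" and \<mu> \<nu> a :: real
  defines "S \<equiv> (\<lambda>T T'. \<integral>z. h (fst z) * h (snd z) * cov_kernel A a T T' (fst z) (snd z) \<partial>(lborel \<Otimes>\<^sub>M lborel))"
  assumes h [measurable]: "h \<in> borel_measurable borel" and h_pos: "\<And>x. x \<le> 0 \<Longrightarrow> h x = 0"
    and hr: "integrable lborel (\<lambda>x. \<bar>h x\<bar> * sqrt (exp (- (a * x)) * min 1 x))"
  shows integrable_cov_kernel: "\<And>T T'. admissible A a T \<Longrightarrow> admissible A a T' \<Longrightarrow>
      integrable (lborel \<Otimes>\<^sub>M lborel) (\<lambda>z. h (fst z) * h (snd z) * cov_kernel A a T T' (fst z) (snd z))"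
    and variance_scaled_sheet_combination: "\<And>T0 T1 T2. admissible A a T0 \<Longrightarrow> admissible A a T1 \<Longrightarrow> admissible A a T2 \<Longrightarrow>
      variance (\<lambda>\<omega>. \<integral>x. h x * (scaled_sheet \<alpha> T0 x \<omega> - \<mu> * scaled_sheet \<alpha> T1 x \<omega> - \<nu> * scaled_sheet \<alpha> T2 x \<omega>) \<partial>lborel)
      = S T0 T0 + \<mu>\<^sup>2 * S T1 T1 + \<nu>\<^sup>2 * S T2 T2 - 2 * \<mu> * S T0 T1 - 2 * \<nu> * S T0 T2 + 2 * \<mu> * \<nu> * S T1 T2"
proof -
  let ?r = "\<lambda>x. sqrt (exp (- (a * x)) * min 1 x)"
  have r: "0 < ?r x" "(?r x)\<^sup>2 = exp (- (a * x)) * min 1 x" if "x > 0" for x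
    using that by auto
  have hx: "x > 0" if "h x \<noteq> 0" for x using h_pos[of x] that by force
  have hr2: "integrable (lborel \<Otimes>\<^sub>M lborel) (\<lambda>z. (\<bar>h (fst z)\<bar> * ?r (fst z)) * (\<bar>h (snd z)\<bar> * ?r (snd z)))"
    by (rule lborel_pair.integrable_pair_mult[OF hr hr])
  show I: "integrable (lborel \<Otimes>\<^sub>M lborel) (\<lambda>z. h (fst z) * h (snd z) * cov_kernel A a T T' (fst z) (snd z))"
    if T: "admissible A a T" "admissible A a T'" for T T'
  proof (rule Bochner_Integration.integrable_bound[OF hr2])
    have [measurable]: "(\<lambda>z. cov_kernel A a T T' (fst z) (snd z)) \<in> borel_measurable (lborel \<Otimes>\<^sub>M lborel)"
      by (rule borel_measurable_cov_kernel[OF A_diff]) measurable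
    show "(\<lambda>z. h (fst z) * h (snd z) * cov_kernel A a T T' (fst z) (snd z)) \<in> borel_measurable (lborel \<Otimes>\<^sub>M lborel)"
      by measurable
    show "AE z in lborel \<Otimes>\<^sub>M lborel. norm (h (fst z) * h (snd z) * cov_kernel A a T T' (fst z) (snd z))
        \<le> norm ((\<bar>h (fst z)\<bar> * ?r (fst z)) * (\<bar>h (snd z)\<bar> * ?r (snd z)))"
    proof (rule AE_I2)
      fix z :: "real \<times> real"
      obtain x y where z: "z = (x, y)" by (cases z)
      have "\<bar>cov_kernel A a T T' x y\<bar> \<le> ?r x * ?r y" if xy: "0 < x" "0 < y"
      proof -
        have "\<bar>cov_kernel A a T T' x y\<bar> \<le> expectation (\<lambda>\<omega>. \<bar>scaled_sheet \<alpha> T x \<omega> * scaled_sheet \<alpha> T' y \<omega>\<bar>)"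
          unfolding scaled_sheet_cov[OF T xy, symmetric] by (rule integral_abs_bound)
        also have "\<dots> \<le> ?r x * ?r y"
          using scaled_sheet_moments(1,2)[OF T(1), of x] scaled_sheet_moments(1,2)[OF T(2), of y] r(1)[OF xy(1)] r(1)[OF xy(2)]
            scaled_sheet_second_moment_le[OF T(1) xy(1)] scaled_sheet_second_moment_le[OF T(2) xy(2)]
          by (intro expectation_abs_mult_le) (auto simp: r(2)[OF xy(1)] r(2)[OF xy(2)] simp del: real_sqrt_pow2_iff)
        finally show ?thesis .
      qed
      note bound = this
      have "\<bar>h x * h y\<bar> * \<bar>cov_kernel A a T T' x y\<bar> \<le> \<bar>h x * h y\<bar> * (?r x * ?r y)"
      proof (cases "h x = 0 \<or> h y = 0")
        case False
        then show ?thesis using hx by (intro mult_left_mono bound) auto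
      qed auto
      also have "\<dots> \<le> norm ((\<bar>h x\<bar> * ?r x) * (\<bar>h y\<bar> * ?r y))"
        using abs_ge_self[of "(\<bar>h x\<bar> * ?r x) * (\<bar>h y\<bar> * ?r y)"] by (simp only: real_norm_def abs_mult[of "h x"] mult_ac)
      finally show "norm (h (fst z) * h (snd z) * cov_kernel A a T T' (fst z) (snd z))
        \<le> norm ((\<bar>h (fst z)\<bar> * ?r (fst z)) * (\<bar>h (snd z)\<bar> * ?r (snd z)))"
        by (simp add: z abs_mult)
    qed
  qed
  \<comment> \<open>The expansion contains every mixed pair in both orders. Swapping the coordinates
    identifies the two, since the kernel is a covariance; this produces the factors 2.\<close>
  have sym: "S T T' = S T' T" if T: "admissible A a T" "admissible A a T'" for T T'
  proof -
    have "(\<lambda>z. h (fst z) * h (snd z) * cov_kernel A a T T' (fst z) (snd z)) \<in> borel_measurable (lborel \<Otimes>\<^sub>M lborel)"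
      using I[OF T] by (rule borel_measurable_integrable)
    from lborel_pair.integral_product_swap[OF this]
    have "S T T' = (\<integral>z. h (snd z) * h (fst z) * cov_kernel A a T T' (snd z) (fst z) \<partial>(lborel \<Otimes>\<^sub>M lborel))"
      unfolding S_def by (simp add: case_prod_unfold)
    also have "\<dots> = S T' T"
      unfolding S_def
    proof (rule Bochner_Integration.integral_cong[OF refl])
      fix z :: "real \<times> real"
      have "cov_kernel A a T T' (snd z) (fst z) = cov_kernel A a T' T (fst z) (snd z)"
        if "0 < fst z" "0 < snd z"
        unfolding scaled_sheet_cov[OF T that(2,1), symmetric] scaled_sheet_cov[OF T(2,1) that, symmetric]
        by (simp add: mult.commute)
      then show "h (snd z) * h (fst z) * cov_kernel A a T T' (snd z) (fst z)
          = h (fst z) * h (snd z) * cov_kernel A a T' T (fst z) (snd z)"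
        using hx[of "fst z"] hx[of "snd z"] by (cases "h (fst z) = 0 \<or> h (snd z) = 0") auto
    qed
    finally show ?thesis .
  qed
  show "variance (\<lambda>\<omega>. \<integral>x. h x * (scaled_sheet \<alpha> T0 x \<omega> - \<mu> * scaled_sheet \<alpha> T1 x \<omega> - \<nu> * scaled_sheet \<alpha> T2 x \<omega>) \<partial>lborel)
      = S T0 T0 + \<mu>\<^sup>2 * S T1 T1 + \<nu>\<^sup>2 * S T2 T2 - 2 * \<mu> * S T0 T1 - 2 * \<nu> * S T0 T2 + 2 * \<mu> * \<nu> * S T1 T2"
    if T0: "admissible A a T0" and T1: "admissible A a T1" and T2: "admissible A a T2" for T0 T1 T2
  proof -
    let ?B = "scaled_sheet \<alpha>"
    define Z where "Z = (\<lambda>x \<omega>. ?B T0 x \<omega> - \<mu> * ?B T1 x \<omega> - \<nu> * ?B T2 x \<omega>)"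
    note Tm [measurable] = scaled_sheet_moments(1)[OF T0] scaled_sheet_moments(1)[OF T1] scaled_sheet_moments(1)[OF T2]
    have adm: "admissible A a T" if "T \<in> {T0, T1, T2}" for T
      using that T0 T1 T2 by blast
    have sq: "integrable M (\<lambda>\<omega>. ?B T x \<omega> * ?B T' y \<omega>)" if "T \<in> {T0, T1, T2}" "T' \<in> {T0, T1, T2}" for T T' x y
      by (intro integrable_mult_L2 scaled_sheet_moments(1,2)[of a] adm that)
    have int1: "integrable M (?B T x)" if "T \<in> {T0, T1, T2}" for T x
      using integrable_mult_L2[where Y = "\<lambda>_. 1", OF scaled_sheet_moments(1)[OF adm[OF that]] _ scaled_sheet_moments(2)[OF adm[OF that]]] by simp
    have ZZ: "expectation (\<lambda>\<omega>. Z x \<omega> * Z y \<omega>) =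
        cov_kernel A a T0 T0 x y + \<mu>\<^sup>2 * cov_kernel A a T1 T1 x y + \<nu>\<^sup>2 * cov_kernel A a T2 T2 x y
        - \<mu> * (cov_kernel A a T0 T1 x y + cov_kernel A a T1 T0 x y)
        - \<nu> * (cov_kernel A a T0 T2 x y + cov_kernel A a T2 T0 x y)
        + \<mu> * \<nu> * (cov_kernel A a T1 T2 x y + cov_kernel A a T2 T1 x y)" if xy: "0 < x" "0 < y" for x y
    proof -
      have "(\<lambda>\<omega>. Z x \<omega> * Z y \<omega>) = (\<lambda>\<omega>.
          ?B T0 x \<omega> * ?B T0 y \<omega> + \<mu>\<^sup>2 * (?B T1 x \<omega> * ?B T1 y \<omega>) + \<nu>\<^sup>2 * (?B T2 x \<omega> * ?B T2 y \<omega>)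
          - \<mu> * (?B T0 x \<omega> * ?B T1 y \<omega> + ?B T1 x \<omega> * ?B T0 y \<omega>)
          - \<nu> * (?B T0 x \<omega> * ?B T2 y \<omega> + ?B T2 x \<omega> * ?B T0 y \<omega>)
          + \<mu> * \<nu> * (?B T1 x \<omega> * ?B T2 y \<omega> + ?B T2 x \<omega> * ?B T1 y \<omega>))"
        by (auto simp: Z_def algebra_simps power2_eq_square)
      then show ?thesis using T0 T1 T2 by (simp add: sq scaled_sheet_cov[OF _ _ xy])
    qed
    \<comment> \<open>The constant that bounds the second moment of the combination: 3 from squaring
      a sum of three terms, and the squares of the coefficients 1, \<open>\<mu>\<close>,
      \<open>\<nu>\<close>.\<close>
    let ?k = "3 * (1 + \<mu>\<^sup>2 + \<nu>\<^sup>2)"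
    have k: "0 < ?k" by (simp add: add_pos_nonneg)
    have "variance (\<lambda>\<omega>. \<integral>x. h x * Z x \<omega> \<partial>lborel)
      = (\<integral>z. h (fst z) * h (snd z) * expectation (\<lambda>\<omega>. Z (fst z) \<omega> * Z (snd z) \<omega>) \<partial>(lborel \<Otimes>\<^sub>M lborel))"
    proof (rule variance_lborel_integral[where r = "\<lambda>x. sqrt ?k * ?r x"])
      note [measurable] = scaled_sheet_jointly_measurable[OF T0] scaled_sheet_jointly_measurable[OF T1]
        scaled_sheet_jointly_measurable[OF T2]
      show "(\<lambda>(x, \<omega>). Z x \<omega>) \<in> borel_measurable (lborel \<Otimes>\<^sub>M M)"
        unfolding Z_def case_prod_unfold by measurable
      have le: "(Z x \<omega>)\<^sup>2 \<le> 3 * ((?B T0 x \<omega>)\<^sup>2 + \<mu>\<^sup>2 * (?B T1 x \<omega>)\<^sup>2 + \<nu>\<^sup>2 * (?B T2 x \<omega>)\<^sup>2)" for x \<omega>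
      proof -
        have "(b0 - b1 - b2)\<^sup>2 \<le> 3 * (b0\<^sup>2 + b1\<^sup>2 + b2\<^sup>2)" for b0 b1 b2 :: real
        proof -
          \<comment> \<open>This sum of squares is exactly the right side minus the left
            side.\<close>
          have "0 \<le> (b0 + b1)\<^sup>2 + (b0 + b2)\<^sup>2 + (b1 - b2)\<^sup>2" by simp
          then show ?thesis by (simp add: power2_eq_square algebra_simps)
        qed
        from this[of "?B T0 x \<omega>" "\<mu> * ?B T1 x \<omega>" "\<nu> * ?B T2 x \<omega>"]
        show ?thesis by (simp add: Z_def power_mult_distrib)
      qed
      have Bsq: "integrable M (\<lambda>\<omega>. 3 * ((?B T0 x \<omega>)\<^sup>2 + \<mu>\<^sup>2 * (?B T1 x \<omega>)\<^sup>2 + \<nu>\<^sup>2 * (?B T2 x \<omega>)\<^sup>2))" for x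
        using scaled_sheet_moments(2)[OF T0] scaled_sheet_moments(2)[OF T1] scaled_sheet_moments(2)[OF T2] by simp
      have Zm: "Z x \<in> borel_measurable M" for x unfolding Z_def by measurable
      show Zsq: "integrable M (\<lambda>\<omega>. (Z x \<omega>)\<^sup>2)" for x
        by (rule Bochner_Integration.integrable_bound[OF Bsq[of x]])
           (use le[of x] Zm in \<open>auto intro!: AE_I2 order_trans[OF le] simp del: distrib_left_numeral\<close>)
      show "expectation (Z x) = 0" for x
        unfolding Z_def using scaled_sheet_moments(3)[OF T0] scaled_sheet_moments(3)[OF T1] scaled_sheet_moments(3)[OF T2]
        by (simp add: int1)
      fix x assume hx0: "h x \<noteq> 0"
      note x = hx[OF hx0]
      show "0 < sqrt ?k * ?r x" using k r(1)[OF x] by (intro mult_pos_pos) auto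
      have "expectation (\<lambda>\<omega>. (Z x \<omega>)\<^sup>2)
          \<le> expectation (\<lambda>\<omega>. 3 * ((?B T0 x \<omega>)\<^sup>2 + \<mu>\<^sup>2 * (?B T1 x \<omega>)\<^sup>2 + \<nu>\<^sup>2 * (?B T2 x \<omega>)\<^sup>2))"
        by (rule integral_mono[OF Zsq Bsq le])
      also have "\<dots> = 3 * (expectation (\<lambda>\<omega>. (?B T0 x \<omega>)\<^sup>2) + \<mu>\<^sup>2 * expectation (\<lambda>\<omega>. (?B T1 x \<omega>)\<^sup>2)
          + \<nu>\<^sup>2 * expectation (\<lambda>\<omega>. (?B T2 x \<omega>)\<^sup>2))"
        using scaled_sheet_moments(2)[OF T0] scaled_sheet_moments(2)[OF T1] scaled_sheet_moments(2)[OF T2] by simp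
      also have "\<dots> \<le> 3 * ((?r x)\<^sup>2 + \<mu>\<^sup>2 * (?r x)\<^sup>2 + \<nu>\<^sup>2 * (?r x)\<^sup>2)"
        unfolding r(2)[OF x]
        by (intro mult_left_mono add_mono scaled_sheet_second_moment_le T0 T1 T2 x) auto
      also have "\<dots> = (sqrt ?k * ?r x)\<^sup>2"
        unfolding power_mult_distrib using k by (simp add: algebra_simps)
      finally show "expectation (\<lambda>\<omega>. (Z x \<omega>)\<^sup>2) \<le> (sqrt ?k * ?r x)\<^sup>2" .
    next
      have "integrable lborel (\<lambda>x. sqrt ?k * (\<bar>h x\<bar> * ?r x))" by (rule integrable_mult_right[OF hr])
      then show "integrable lborel (\<lambda>x. \<bar>h x\<bar> * (sqrt ?k * ?r x))" by (simp only: mult.left_commute)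
    qed measurable
    also have "\<dots> = (\<integral>z.
        (h (fst z) * h (snd z) * cov_kernel A a T0 T0 (fst z) (snd z)
        + \<mu>\<^sup>2 * (h (fst z) * h (snd z) * cov_kernel A a T1 T1 (fst z) (snd z))
        + \<nu>\<^sup>2 * (h (fst z) * h (snd z) * cov_kernel A a T2 T2 (fst z) (snd z))
        - \<mu> * (h (fst z) * h (snd z) * cov_kernel A a T0 T1 (fst z) (snd z) + h (fst z) * h (snd z) * cov_kernel A a T1 T0 (fst z) (snd z))
        - \<nu> * (h (fst z) * h (snd z) * cov_kernel A a T0 T2 (fst z) (snd z) + h (fst z) * h (snd z) * cov_kernel A a T2 T0 (fst z) (snd z))
        + \<mu> * \<nu> * (h (fst z) * h (snd z) * cov_kernel A a T1 T2 (fst z) (snd z) + h (fst z) * h (snd z) * cov_kernel A a T2 T1 (fst z) (snd z)))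
        \<partial>(lborel \<Otimes>\<^sub>M lborel))"
    proof (rule Bochner_Integration.integral_cong[OF refl])
      fix z :: "real \<times> real"
      show "h (fst z) * h (snd z) * expectation (\<lambda>\<omega>. Z (fst z) \<omega> * Z (snd z) \<omega>) =
        h (fst z) * h (snd z) * cov_kernel A a T0 T0 (fst z) (snd z)
        + \<mu>\<^sup>2 * (h (fst z) * h (snd z) * cov_kernel A a T1 T1 (fst z) (snd z))
        + \<nu>\<^sup>2 * (h (fst z) * h (snd z) * cov_kernel A a T2 T2 (fst z) (snd z))
        - \<mu> * (h (fst z) * h (snd z) * cov_kernel A a T0 T1 (fst z) (snd z) + h (fst z) * h (snd z) * cov_kernel A a T1 T0 (fst z) (snd z))
        - \<nu> * (h (fst z) * h (snd z) * cov_kernel A a T0 T2 (fst z) (snd z) + h (fst z) * h (snd z) * cov_kernel A a T2 T0 (fst z) (snd z))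
        + \<mu> * \<nu> * (h (fst z) * h (snd z) * cov_kernel A a T1 T2 (fst z) (snd z) + h (fst z) * h (snd z) * cov_kernel A a T2 T1 (fst z) (snd z))"
      proof (cases "h (fst z) = 0 \<or> h (snd z) = 0")
        case False
        then have "0 < fst z" "0 < snd z" using hx by auto
        then show ?thesis unfolding ZZ[OF \<open>0 < fst z\<close> \<open>0 < snd z\<close>] by (simp add: algebra_simps)
      qed auto
    qed
    also have "\<dots> = S T0 T0 + \<mu>\<^sup>2 * S T1 T1 + \<nu>\<^sup>2 * S T2 T2 - \<mu> * (S T0 T1 + S T1 T0) - \<nu> * (S T0 T2 + S T2 T0)
        + \<mu> * \<nu> * (S T1 T2 + S T2 T1)"
      unfolding S_def using I T0 T1 T2 by (simp del: mult_cancel_left1)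
    also have "\<dots> = S T0 T0 + \<mu>\<^sup>2 * S T1 T1 + \<nu>\<^sup>2 * S T2 T2 - 2 * \<mu> * S T0 T1 - 2 * \<nu> * S T0 T2 + 2 * \<mu> * \<nu> * S T1 T2"
      using sym[OF T1 T0] sym[OF T2 T0] sym[OF T2 T1] by (simp add: algebra_simps)
    finally show ?thesis unfolding Z_def .
  qed
qed

end

section \<open>Integrability of the two weights against the second-moment bound\<close>

lemma integrable_inverse_sqrt: "set_integrable lborel {0<..<1::real} (\<lambda>y. 1 / sqrt y)"
proof -
  have im: "(\<lambda>x::real. x\<^sup>2) ` {0<..<1} = {0<..<1}"
  proof (intro equalityI subsetI)
    fix y :: real assume "y \<in> {0<..<1}"
    then show "y \<in> (\<lambda>x. x\<^sup>2) ` {0<..<1}" by (intro image_eqI[of _ _ "sqrt y"]) auto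
  qed (auto simp: power_less_one_iff)
  \<comment> \<open>Under \<open>y = x^2\<close> the Jacobian cancels the singularity and leaves the
    constant 2.\<close>
  have "set_integrable lborel {0<..<1} (\<lambda>x::real. \<bar>2 * x\<bar> * (1 / sqrt (x\<^sup>2)))"
  proof -
    have "set_integrable lborel {0<..<1::real} (\<lambda>x. 2::real)"
      by (simp add: set_integrable_def integrable_mult_left)
    moreover have "set_integrable lborel {0<..<1} (\<lambda>x::real. \<bar>2 * x\<bar> * (1 / sqrt (x\<^sup>2)))
        = set_integrable lborel {0<..<1::real} (\<lambda>x. 2::real)"
      by (rule set_integrable_cong) (auto simp: abs_mult)
    ultimately show ?thesis by simp
  qed
  then show ?thesis
    by (subst set_integrable_substitution[OF _ im, where g' = "\<lambda>x. 2 * x"])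
       (auto intro!: derivative_eq_intros inj_onI simp: set_borel_measurable_def)
qed

lemma integrable_exp_neg_Ioi: "0 < c \<Longrightarrow> set_integrable lborel {0<..} (\<lambda>x::real. exp (- (c * x)))"
  unfolding set_integrable_def
proof (rule integrableI_nonneg)
  assume c: "0 < c"
  have "(\<integral>\<^sup>+x. ennreal (indicator {0<..} x *\<^sub>R exp (- (c * x))) \<partial>lborel)
      = (\<integral>\<^sup>+x. ennreal (exp (- (c * x))) * indicator {0<..} x \<partial>lborel)"
    by (intro nn_integral_cong) (auto split: split_indicator)
  also have "\<dots> < \<infinity>" using nn_integral_exp_Ioi[OF c] by simp
  finally show "(\<integral>\<^sup>+x. ennreal (indicator {0<..} x *\<^sub>R exp (- (c * x))) \<partial>lborel) < \<infinity>" .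
qed auto

text \<open>The square root halves the exponential rate and leaves \<open>sqrt x\<close> near 0.
  Divided by \<open>x\<close> this is \<open>1 / sqrt x\<close>, still integrable on the unit
  interval; beyond 1 the weight \<open>1 / x\<close> is at most 1.\<close>

lemma
  fixes a :: real assumes a: "0 < a"
  shows integrable_moment_bound: "integrable lborel (\<lambda>x. \<bar>indicator {0<..} x\<bar> * sqrt (exp (- (a * x)) * min 1 x))"
    and integrable_moment_bound_div: "integrable lborel (\<lambda>x. \<bar>indicator {0<..} x / x\<bar> * sqrt (exp (- (a * x)) * min 1 x))"
proof -
  have sq: "sqrt (exp (- (a * x)) * m) = exp (- (a / 2 * x)) * sqrt m" for x m
  proof -
    have "exp (- (a * x)) = (exp (- (a / 2 * x)))\<^sup>2" by (simp add: exp_double[symmetric])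
    then show ?thesis by (simp add: real_sqrt_mult)
  qed
  have e: "set_integrable lborel {0<..} (\<lambda>x. exp (- (a / 2 * x)))"
    by (rule integrable_exp_neg_Ioi) (use a in simp)
  show "integrable lborel (\<lambda>x. \<bar>indicator {0<..} x\<bar> * sqrt (exp (- (a * x)) * min 1 x))"
  proof (rule Bochner_Integration.integrable_bound[OF e[unfolded set_integrable_def]])
    show "AE x in lborel. norm (\<bar>indicator {0<..} x\<bar> * sqrt (exp (- (a * x)) * min 1 x))
        \<le> norm (indicat_real {0<..} x *\<^sub>R exp (- (a / 2 * x)))"
      unfolding sq by (intro AE_I2) (auto split: split_indicator simp: abs_mult mult_left_le)
  qed measurable
  show "integrable lborel (\<lambda>x. \<bar>indicator {0<..} x / x\<bar> * sqrt (exp (- (a * x)) * min 1 x))"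
  proof (rule Bochner_Integration.integrable_bound)
    show "integrable lborel (\<lambda>x. indicat_real {0<..<1} x *\<^sub>R (1 / sqrt x) + indicat_real {0<..} x *\<^sub>R exp (- (a / 2 * x)))"
      using e integrable_inverse_sqrt unfolding set_integrable_def by (rule Bochner_Integration.integrable_add[rotated])
    show "AE x in lborel. norm (\<bar>indicator {0<..} x / x\<bar> * sqrt (exp (- (a * x)) * min 1 x))
        \<le> norm (indicat_real {0<..<1} x *\<^sub>R (1 / sqrt x) + indicat_real {0<..} x *\<^sub>R exp (- (a / 2 * x)))"
      unfolding sq
    proof (rule AE_I2)
      fix x :: real
      let ?E = "exp (- (a / 2 * x))"
      consider "x \<le> 0" | "0 < x" "x < 1" | "1 \<le> x" by linarith
      then show "norm (\<bar>indicator {0<..} x / x\<bar> * (?E * sqrt (min 1 x)))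
        \<le> norm (indicat_real {0<..<1} x *\<^sub>R (1 / sqrt x) + indicat_real {0<..} x *\<^sub>R ?E)"
      proof cases
        case 2
        have "?E \<le> 1" using a 2 by simp
        then have "?E * (1 / sqrt x) \<le> 1 / sqrt x"
          using 2 by (intro mult_left_le_one_le) auto
        moreover have "?E * (1 / sqrt x) = ?E * sqrt x / x"
          using 2 real_sqrt_mult_self[of x] by (simp add: divide_simps)
        ultimately have "?E * sqrt x / x \<le> 1 / sqrt x" by simp
        then show ?thesis using 2 by (simp add: abs_mult add_increasing2)
      next
        case 3
        then have "?E / x \<le> ?E" by (simp add: divide_le_eq)
        then show ?thesis using 3 by (simp add: abs_mult)
      qed auto
    qed
  qed measurable
qed

context pickands_sheet
begin

text \<open>The integrability claims are what later permits splitting the half-line at 1. They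
  follow from integrability on the quadrant, because the kernels are nonnegative. For CFG the
  weights are absorbed into the kernel, so that the same polar formula applies.\<close>

lemma
  fixes a :: real
  assumes a: "0 < a" and T: "admissible A a T" "admissible A a T'"
  shows integral_cov_kernel_P:
      "(\<integral>z. indicator {0<..} (fst z) * indicator {0<..} (snd z) * cov_kernel A a T T' (fst z) (snd z) \<partial>(lborel \<Otimes>\<^sub>M lborel))
      = (LBINT w:{0<..}. 1 / (joint_rate A T T' w)\<^sup>2 - 1 / (a * (1 + w))\<^sup>2)" (is ?P1)
    and integrable_rate_P:
      "set_integrable lborel {0<..} (\<lambda>w. 1 / (joint_rate A T T' w)\<^sup>2 - 1 / (a * (1 + w))\<^sup>2)" (is ?P2)
    and integral_cov_kernel_CFG:
      "(\<integral>z. indicator {0<..} (fst z) / fst z * (indicator {0<..} (snd z) / snd z) * cov_kernel A a T T' (fst z) (snd z) \<partial>(lborel \<Otimes>\<^sub>M lborel))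
      = (LBINT w:{0<..}. ln (a * (1 + w) / joint_rate A T T' w) / w)" (is ?C1)
    and integrable_rate_CFG:
      "set_integrable lborel {0<..} (\<lambda>w. ln (a * (1 + w) / joint_rate A T T' w) / w)" (is ?C2)
proof -
  note bnd = joint_rate_bounds[OF A T a]
  note nonneg = cov_kernel_nonneg[OF A T a]
  have [measurable]: "(\<lambda>z. cov_kernel A a T T' (fst z) (snd z)) \<in> borel_measurable (lborel \<Otimes>\<^sub>M lborel)"
    by (rule borel_measurable_cov_kernel[OF A_diff]) measurable
  have [measurable]: "joint_rate A T T' \<in> borel_measurable borel"
    using borel_measurable_joint_rate[OF A_diff, of "\<lambda>x. x" borel] by simp
  have K: "cov_kernel A a T T' x (x * w)
      = exp (- (joint_rate A T T' w * x)) - exp (- (a * (1 + w) * x))" if "x > 0" for x w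
    using that by (simp add: cov_kernel_def algebra_simps)
  have P: "(\<integral>\<^sup>+x. ennreal (x * cov_kernel A a T T' x (x * w)) * indicator {0<..} x \<partial>lborel)
      = ennreal (1 / (joint_rate A T T' w)\<^sup>2 - 1 / (a * (1 + w))\<^sup>2)" if w: "w > 0" for w
    unfolding nn_integral_exp_diff_mult[OF bnd[OF w], symmetric]
    by (intro nn_integral_cong) (auto simp: K split: split_indicator)
  have C: "(\<integral>\<^sup>+x. ennreal (x * (cov_kernel A a T T' x (x * w) / (x * (x * w)))) * indicator {0<..} x \<partial>lborel)
      = ennreal (ln (a * (1 + w) / joint_rate A T T' w) / w)" if w: "w > 0" for w
  proof -
    let ?f = "\<lambda>x. (exp (- (joint_rate A T T' w * x)) - exp (- (a * (1 + w) * x))) / x"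
    have "(\<integral>\<^sup>+x. ennreal (x * (cov_kernel A a T T' x (x * w) / (x * (x * w)))) * indicator {0<..} x \<partial>lborel)
      = (\<integral>\<^sup>+x. ennreal (1 / w) * (ennreal (?f x) * indicator {0<..} x) \<partial>lborel)"
      using w by (intro nn_integral_cong) (auto simp: K ennreal_mult'[symmetric] mult.assoc[symmetric] mult.commute[of w] split: split_indicator)
    also have "\<dots> = ennreal (1 / w) * ennreal (ln (a * (1 + w) / joint_rate A T T' w))"
      by (subst nn_integral_cmult) (simp_all add: nn_integral_Frullani_exp[OF bnd[OF w]])
    also have "\<dots> = ennreal (ln (a * (1 + w) / joint_rate A T T' w) / w)"
      using w by (simp add: ennreal_mult'[symmetric])
    finally show ?thesis .
  qed
  have P_nonneg: "0 \<le> 1 / (joint_rate A T T' w)\<^sup>2 - 1 / (a * (1 + w))\<^sup>2" if "w > 0" for w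
    using bnd[OF that] by (simp add: frac_le power_mono)
  have C_nonneg: "0 \<le> ln (a * (1 + w) / joint_rate A T T' w) / w" if "w > 0" for w
    using bnd[OF that] that by simp
  note polar_P = integral_quadrant_polar[of "cov_kernel A a T T'" "\<lambda>w. 1 / (joint_rate A T T' w)\<^sup>2 - 1 / (a * (1 + w))\<^sup>2"]
    integrable_quadrant_polar[of "cov_kernel A a T T'" "\<lambda>w. 1 / (joint_rate A T T' w)\<^sup>2 - 1 / (a * (1 + w))\<^sup>2"]
  show ?P1 using polar_P(1) P P_nonneg nonneg by (simp add: case_prod_unfold)
  have "integrable (lborel \<Otimes>\<^sub>M lborel)
      (\<lambda>z. indicator {0<..} (fst z) * indicator {0<..} (snd z) * cov_kernel A a T T' (fst z) (snd z))"
    by (rule integrable_cov_kernel[OF _ _ integrable_moment_bound[OF a] T]) auto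
  then show ?P2 using polar_P(2) P P_nonneg nonneg by (simp add: case_prod_unfold)
  let ?J = "\<lambda>x y. cov_kernel A a T T' x y / (x * y)" and ?G = "\<lambda>w. ln (a * (1 + w) / joint_rate A T T' w) / w"
  note polar_C = integral_quadrant_polar[of ?J ?G] integrable_quadrant_polar[of ?J ?G]
  have eq: "(\<lambda>z. indicator {0<..} (fst z) / fst z * (indicator {0<..} (snd z) / snd z) * cov_kernel A a T T' (fst z) (snd z))
     = (\<lambda>z. indicator {0<..} (fst z) * indicator {0<..} (snd z) * ?J (fst z) (snd z))"
    by (auto simp: fun_eq_iff)
  show ?C1 unfolding eq using polar_C(1) C C_nonneg nonneg by (simp add: case_prod_unfold)
  have "integrable (lborel \<Otimes>\<^sub>M lborel)
      (\<lambda>z. indicator {0<..} (fst z) / fst z * (indicator {0<..} (snd z) / snd z) * cov_kernel A a T T' (fst z) (snd z))"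
    by (rule integrable_cov_kernel[OF _ _ integrable_moment_bound_div[OF a] T]) auto
  then show ?C2 unfolding eq using polar_C(2) C C_nonneg nonneg by (simp add: case_prod_unfold)
qed

end

section \<open>The variances as combinations of half-line integrals\<close>

lemma (in prob_space) variance_cmult:
  fixes X :: "'a \<Rightarrow> real"
  shows "variance (\<lambda>\<omega>. c * X \<omega>) = c\<^sup>2 * variance X"
  by (simp add: power_mult_distrib flip: right_diff_distrib)

context pickands_sheet
begin

text \<open>The lower bound \<open>max t (1 - t) \<le> A t\<close> is what makes the exponents
  \<open>A t - (1 - t)\<close> and \<open>A t - t\<close> nonnegative.\<close>

lemma admissible_triples:
  assumes t: "t \<in> {0<..<1}"
  shows "admissible A (A t) (0, 1 - t, t)" "admissible A (A t) (A t - (1 - t), 1 - t, 0)"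
    "admissible A (A t) (A t - t, 0, t)"
  using t pickands_function_bounds[OF A, of t] by (auto simp: admissible_def tail_dep_pos)

context
  fixes t \<mu> \<nu> :: real
  assumes t: "t \<in> {0<..<1}"
    and \<mu>: "\<mu> = A t - t * deriv A t" and \<nu>: "\<nu> = A t + (1 - t) * deriv A t"
begin

text \<open>The copula process along the curve, in the variable \<open>x = - ln u\<close>. The
  coefficients are spelled out so that the definition depends on \<open>t\<close> but not on
  \<open>\<mu>\<close> and \<open>\<nu>\<close>.\<close>

definition transformed_process :: "real \<Rightarrow> 'w \<Rightarrow> real" where
  "transformed_process x \<omega> = scaled_sheet \<alpha> (0, 1 - t, t) x \<omega>
    - (A t - t * deriv A t) * scaled_sheet \<alpha> (A t - (1 - t), 1 - t, 0) x \<omega>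
    - (A t + (1 - t) * deriv A t) * scaled_sheet \<alpha> (A t - t, 0, t) x \<omega>"

lemma copula_process_exp:
  assumes u: "u \<in> {0<..<1}"
  shows "copula_process C \<alpha> (u powr (1 - t)) (u powr t) \<omega> = transformed_process (- ln u) \<omega>"
proof -
  define x where "x = - ln u"
  have x: "x > 0" using u by (simp add: x_def)
  have p: "u powr s = exp (- (s * x))" for s using u by (simp add: powr_def x_def)
  have D: "(A has_real_derivative deriv A t) (at t)"
    using A_diff t by (metis DERIV_deriv_iff_real_differentiable)
  note d = extreme_value_copula_derivs[OF C t D x]
  have q: "exp (- (A t * x)) / exp (- ((1 - t) * x)) = exp (- ((A t - (1 - t)) * x))"
    "exp (- (A t * x)) / exp (- (t * x)) = exp (- ((A t - t) * x))"
    by (simp_all add: exp_diff[symmetric] algebra_simps)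
  show ?thesis
    unfolding copula_process_def transformed_process_def p d q scaled_sheet_def x_def[symmetric]
    using x by simp
qed

lemma transformed_process_measurable:
  assumes "\<omega> \<in> space M" shows "(\<lambda>x. transformed_process x \<omega>) \<in> borel_measurable borel"
  unfolding transformed_process_def
  using scaled_sheet_continuous[OF admissible_triples(1)[OF t] assms]
    scaled_sheet_continuous[OF admissible_triples(2)[OF t] assms]
    scaled_sheet_continuous[OF admissible_triples(3)[OF t] assms]
  by (intro borel_measurable_continuous_onI continuous_intros)

text \<open>Since \<open>du / u\<close> turns into \<open>dx\<close>, one statement covers both
  estimators: \<open>k\<close> is the constant 1 for Pickands, and \<open>k x = - x\<close> recovers
  the factor \<open>ln u\<close> for CFG.\<close>

lemma integral_log_substitution:
  fixes g k :: "real \<Rightarrow> real"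
  assumes [measurable]: "g \<in> borel_measurable borel" "k \<in> borel_measurable borel"
  shows "(LBINT u:{0<..<1}. g (- ln u) / (u * k (- ln u))) = (LBINT x:{0<..}. g x / k x)"
proof -
  have im: "(\<lambda>x::real. exp (- x)) ` {0<..} = {0<..<1}"
  proof (intro equalityI subsetI)
    fix u :: real assume "u \<in> {0<..<1}"
    then show "u \<in> (\<lambda>x. exp (- x)) ` {0<..}" by (intro image_eqI[of _ _ "- ln u"]) auto
  qed auto
  have "(LBINT u:{0<..<1}. g (- ln u) / (u * k (- ln u)))
      = (LBINT x:{0<..}. \<bar>- exp (- x)\<bar> * (g (- ln (exp (- x))) / (exp (- x) * k (- ln (exp (- x))))))"
    by (rule set_integral_substitution[OF _ im])
       (auto intro!: derivative_eq_intros inj_onI simp: set_borel_measurable_def)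
  then show ?thesis by simp
qed

lemma A_r_P_eq:
  assumes \<omega>: "\<omega> \<in> space M"
  shows "A_r_P A C \<alpha> t \<omega> = - (A t)\<^sup>2 * (\<integral>x. indicator {0<..} x * transformed_process x \<omega> \<partial>lborel)"
proof -
  have "(LBINT u:{0<..<1}. copula_process C \<alpha> (u powr (1 - t)) (u powr t) \<omega> / u)
      = (LBINT u:{0<..<1}. transformed_process (- ln u) \<omega> / (u * 1))"
    by (rule set_lebesgue_integral_cong) (auto simp: copula_process_exp)
  also have "\<dots> = (LBINT x:{0<..}. transformed_process x \<omega> / 1)"
    by (rule integral_log_substitution[where k = "\<lambda>_. 1"]) (use transformed_process_measurable[OF \<omega>] in auto)
  finally show ?thesis by (simp add: A_r_P_def set_lebesgue_integral_def)
qed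

lemma A_r_CFG_eq:
  assumes \<omega>: "\<omega> \<in> space M"
  shows "A_r_CFG A C \<alpha> t \<omega> = - A t * (\<integral>x. indicator {0<..} x / x * transformed_process x \<omega> \<partial>lborel)"
proof -
  have "(LBINT u:{0<..<1}. copula_process C \<alpha> (u powr (1 - t)) (u powr t) \<omega> / (u * ln u))
      = (LBINT u:{0<..<1}. transformed_process (- ln u) \<omega> / (u * - (- ln u)))"
    by (rule set_lebesgue_integral_cong) (auto simp: copula_process_exp)
  also have "\<dots> = (LBINT x:{0<..}. transformed_process x \<omega> / - x)"
    by (rule integral_log_substitution) (use transformed_process_measurable[OF \<omega>] in auto)
  also have "\<dots> = - (\<integral>x. indicator {0<..} x / x * transformed_process x \<omega> \<partial>lborel)"
    by (simp add: set_lebesgue_integral_def)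
  finally show ?thesis by (simp add: A_r_CFG_def)
qed

lemma variance_A_r_P:
  defines "S \<equiv> (\<lambda>T T'. LBINT w:{0<..}. 1 / (joint_rate A T T' w)\<^sup>2 - 1 / (A t * (1 + w))\<^sup>2)"
    and "T0 \<equiv> (0, 1 - t, t)" and "T1 \<equiv> (A t - (1 - t), 1 - t, 0)" and "T2 \<equiv> (A t - t, 0, t)"
  shows "variance (A_r_P A C \<alpha> t) / (A t)\<^sup>2 = (A t)\<^sup>2 *
    (S T0 T0 + \<mu>\<^sup>2 * S T1 T1 + \<nu>\<^sup>2 * S T2 T2 - 2 * \<mu> * S T0 T1 - 2 * \<nu> * S T0 T2 + 2 * \<mu> * \<nu> * S T1 T2)"
proof -
  note T = admissible_triples[OF t, folded T0_def T1_def T2_def]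
  have a: "0 < A t" using pickands_function_bounds[OF A, of t] t by auto
  let ?X = "\<lambda>\<omega>. \<integral>x. indicator {0<..} x * transformed_process x \<omega> \<partial>lborel"
  \<comment> \<open>The pathwise identity is known only on \<open>space M\<close>, so it is inserted
    under each expectation separately, first in the mean and then in the outer one.\<close>
  have "expectation (A_r_P A C \<alpha> t) = expectation (\<lambda>\<omega>. - (A t)\<^sup>2 * ?X \<omega>)"
    by (rule Bochner_Integration.integral_cong[OF refl A_r_P_eq])
  then have "variance (A_r_P A C \<alpha> t) = variance (\<lambda>\<omega>. - (A t)\<^sup>2 * ?X \<omega>)"
    by (intro Bochner_Integration.integral_cong refl) (simp add: A_r_P_eq)
  also have "\<dots> = (- (A t)\<^sup>2)\<^sup>2 * variance ?X" by (rule variance_cmult)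
  also have "variance ?X = S T0 T0 + \<mu>\<^sup>2 * S T1 T1 + \<nu>\<^sup>2 * S T2 T2 - 2 * \<mu> * S T0 T1 - 2 * \<nu> * S T0 T2 + 2 * \<mu> * \<nu> * S T1 T2"
    unfolding transformed_process_def \<mu>[symmetric] \<nu>[symmetric] S_def T0_def[symmetric] T1_def[symmetric] T2_def[symmetric]
    by (subst variance_scaled_sheet_combination[OF _ _ integrable_moment_bound[OF a] T])
       (auto simp: integral_cov_kernel_P[OF a] T)
  finally show ?thesis using a by (simp add: power2_eq_square)
qed

lemma variance_A_r_CFG:
  defines "S \<equiv> (\<lambda>T T'. LBINT w:{0<..}. ln (A t * (1 + w) / joint_rate A T T' w) / w)"
    and "T0 \<equiv> (0, 1 - t, t)" and "T1 \<equiv> (A t - (1 - t), 1 - t, 0)" and "T2 \<equiv> (A t - t, 0, t)"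
  shows "variance (A_r_CFG A C \<alpha> t) / (A t)\<^sup>2 =
    S T0 T0 + \<mu>\<^sup>2 * S T1 T1 + \<nu>\<^sup>2 * S T2 T2 - 2 * \<mu> * S T0 T1 - 2 * \<nu> * S T0 T2 + 2 * \<mu> * \<nu> * S T1 T2"
proof -
  note T = admissible_triples[OF t, folded T0_def T1_def T2_def]
  have a: "0 < A t" using pickands_function_bounds[OF A, of t] t by auto
  let ?X = "\<lambda>\<omega>. \<integral>x. indicator {0<..} x / x * transformed_process x \<omega> \<partial>lborel"
  have "expectation (A_r_CFG A C \<alpha> t) = expectation (\<lambda>\<omega>. - A t * ?X \<omega>)"
    by (rule Bochner_Integration.integral_cong[OF refl A_r_CFG_eq])
  then have "variance (A_r_CFG A C \<alpha> t) = variance (\<lambda>\<omega>. - A t * ?X \<omega>)"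
    by (intro Bochner_Integration.integral_cong refl) (simp add: A_r_CFG_eq)
  also have "\<dots> = (- A t)\<^sup>2 * variance ?X" by (rule variance_cmult)
  also have "variance ?X = S T0 T0 + \<mu>\<^sup>2 * S T1 T1 + \<nu>\<^sup>2 * S T2 T2 - 2 * \<mu> * S T0 T1 - 2 * \<nu> * S T0 T2 + 2 * \<mu> * \<nu> * S T1 T2"
    unfolding transformed_process_def \<mu>[symmetric] \<nu>[symmetric] S_def T0_def[symmetric] T1_def[symmetric] T2_def[symmetric]
    by (subst variance_scaled_sheet_combination[OF _ _ integrable_moment_bound_div[OF a] T])
       (auto simp: integral_cov_kernel_CFG[OF a] T simp del: times_divide_eq_left times_divide_eq_right)
  finally show ?thesis using a by (simp add: power2_eq_square)
qed

end

end

section \<open>Elementary integrals and the dilogarithm\<close>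

lemma set_integral_split_Ioi:
  fixes f :: "real \<Rightarrow> real"
  assumes f: "set_integrable lborel {0<..} f"
  shows "(LBINT w:{0<..}. f w) = (LBINT w:{0<..<1}. f w) + (LBINT w:{1<..}. f w)"
    and "set_integrable lborel {0<..<1} f" "set_integrable lborel {1<..} f"
proof -
  have eq: "AE w in lborel. indicat_real {0<..} w *\<^sub>R f w = indicat_real ({0<..<1} \<union> {1<..}) w *\<^sub>R f w"
    using AE_lborel_singleton[of "1::real"] by eventually_elim (auto split: split_indicator)
  show *: "set_integrable lborel {0<..<1} f" "set_integrable lborel {1<..} f"
    by (rule set_integrable_subset[OF f]; auto)+
  have "(LBINT w:{0<..}. f w) = (LBINT w:{0<..<1} \<union> {1<..}. f w)"
    unfolding set_lebesgue_integral_def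
  proof (rule integral_cong_AE[OF _ _ eq])
    show "(\<lambda>w. indicat_real {0<..} w *\<^sub>R f w) \<in> borel_measurable lborel"
      using f unfolding set_integrable_def by (rule borel_measurable_integrable)
    have "set_integrable lborel ({0<..<1} \<union> {1<..}) f" by (rule set_integrable_Un) (use * in auto)
    then show "(\<lambda>w. indicat_real ({0<..<1} \<union> {1<..}) w *\<^sub>R f w) \<in> borel_measurable lborel"
      unfolding set_integrable_def by (rule borel_measurable_integrable)
  qed
  also have "\<dots> = (LBINT w:{0<..<1}. f w) + (LBINT w:{1<..}. f w)"
    by (rule set_integral_Un) (use * in auto)
  finally show "(LBINT w:{0<..}. f w) = (LBINT w:{0<..<1}. f w) + (LBINT w:{1<..}. f w)" .
qed

text \<open>In the coordinates (x, w) the map \<open>w -> 1 / w\<close> corresponds to exchanging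
  the two times x and y.\<close>

lemma
  fixes f k :: "real \<Rightarrow> real"
  assumes [measurable]: "f \<in> borel_measurable borel" "k \<in> borel_measurable borel"
    and k: "\<And>w. 0 < w \<Longrightarrow> w < 1 \<Longrightarrow> f (1 / w) / w\<^sup>2 = k w"
  shows set_integral_inversion: "(LBINT w:{1<..}. f w) = (LBINT w:{0<..<1}. k w)"
    and set_integrable_inversion: "set_integrable lborel {1<..} f \<longleftrightarrow> set_integrable lborel {0<..<1} k"
proof -
  have im: "(\<lambda>w::real. 1 / w) ` {0<..<1} = {1<..}"
  proof (intro equalityI subsetI)
    fix u :: real assume "u \<in> {1<..}"
    then show "u \<in> (\<lambda>w. 1 / w) ` {0<..<1}" by (intro image_eqI[of _ _ "1 / u"]) auto
  qed auto
  note sub = set_integral_substitution[OF _ im, where g' = "\<lambda>w. - 1 / w\<^sup>2"]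
    set_integrable_substitution[OF _ im, where g' = "\<lambda>w. - 1 / w\<^sup>2"]
  have "(LBINT w:{1<..}. f w) = (LBINT w:{0<..<1}. \<bar>- 1 / w\<^sup>2\<bar> * f (1 / w))"
    by (rule sub) (auto intro!: derivative_eq_intros inj_onI simp: set_borel_measurable_def power2_eq_square)
  also have "\<dots> = (LBINT w:{0<..<1}. k w)"
    by (rule set_lebesgue_integral_cong) (auto simp: k[symmetric])
  finally show "(LBINT w:{1<..}. f w) = (LBINT w:{0<..<1}. k w)" .
  have "set_integrable lborel {1<..} f \<longleftrightarrow> set_integrable lborel {0<..<1} (\<lambda>w. \<bar>- 1 / w\<^sup>2\<bar> * f (1 / w))"
    by (rule sub) (auto intro!: derivative_eq_intros inj_onI simp: set_borel_measurable_def power2_eq_square)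
  also have "\<dots> \<longleftrightarrow> set_integrable lborel {0<..<1} k"
    by (rule set_integrable_cong) (auto simp: k[symmetric])
  finally show "set_integrable lborel {1<..} f \<longleftrightarrow> set_integrable lborel {0<..<1} k" .
qed

lemma
  fixes a e :: real
  assumes a: "0 < a" and e: "0 \<le> e"
  shows integral_inverse_square: "(LBINT w:{0<..<1}. 1 / (e * w + a)\<^sup>2) = 1 / (a * (a + e))"
    and integrable_inverse_square: "set_integrable lborel {0<..<1} (\<lambda>w. 1 / (e * w + a)\<^sup>2)"
proof -
  have pos: "0 < e * w + a" if "0 \<le> w" for w using a e that by (simp add: add_nonneg_pos)
  \<comment> \<open>This antiderivative vanishes at 0 and, unlike
    \<open>- 1 / (e * (e * w + a))\<close>, also makes sense for \<open>e = 0\<close>, which occurs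
    for the sheet term itself.\<close>
  have F: "((\<lambda>w. w / (a * (e * w + a))) has_real_derivative 1 / (e * w + a)\<^sup>2) (at w)" if "0 \<le> w" for w
  proof -
    have "((\<lambda>w. w / (a * (e * w + a))) has_real_derivative
        (1 * (a * (e * w + a)) - w * (a * e)) / ((a * (e * w + a)) * (a * (e * w + a)))) (at w)"
      using pos[OF that] a by (intro DERIV_divide) (auto intro!: derivative_eq_intros)
    also have "1 * (a * (e * w + a)) - w * (a * e) = a * a" by (simp add: algebra_simps)
    also have "a * a / ((a * (e * w + a)) * (a * (e * w + a))) = 1 / (e * w + a)\<^sup>2"
      using a by (simp add: power2_eq_square)
    finally show ?thesis .
  qed
  have c: "continuous_on {0..1} (\<lambda>w. 1 / (e * w + a)\<^sup>2)"
    using pos by (auto intro!: continuous_intros) (metis less_irrefl)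
  show "set_integrable lborel {0<..<1} (\<lambda>w. 1 / (e * w + a)\<^sup>2)"
    by (rule set_integrable_subset[OF borel_integrable_atLeastAtMost'[OF c]]) auto
  have "(LBINT w:{0<..<1}. 1 / (e * w + a)\<^sup>2) = (LBINT w=0..1. 1 / (e * w + a)\<^sup>2)"
    by (simp add: interval_lebesgue_integral_def zero_ereal_def one_ereal_def)
  also have "\<dots> = (LBINT w=ereal 0..ereal 1. 1 / (e * w + a)\<^sup>2)"
    by (simp add: zero_ereal_def one_ereal_def)
  also have "\<dots> = 1 / (a * (e * 1 + a)) - 0 / (a * (e * 0 + a))"
    by (rule interval_integral_FTC_finite)
       (use c F in \<open>auto intro: has_field_derivative_at_within simp flip: has_real_derivative_iff_has_vector_derivative\<close>)
  finally show "(LBINT w:{0<..<1}. 1 / (e * w + a)\<^sup>2) = 1 / (a * (a + e))" by (simp add: add.commute)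
qed

text \<open>With \<open>s = sqrt (1 - z)\<close>, the inequality
  \<open>ln (1 / s) \<le> 1 / s - 1\<close> gives \<open>- ln (1 - z) \<le> 2 * z / s\<close>. The
  factor \<open>z\<close> removes the singularity at 0, and \<open>1 / s\<close> is integrable at
  1.\<close>

lemma integrable_ln_one_minus_over: "set_integrable lborel {0<..<1::real} (\<lambda>z. ln (1 - z) / z)"
proof -
  have im: "(\<lambda>z::real. 1 - z) ` {0<..<1} = {0<..<1}"
  proof (intro equalityI subsetI)
    fix u :: real assume "u \<in> {0<..<1}"
    then show "u \<in> (\<lambda>z. 1 - z) ` {0<..<1}" by (intro image_eqI[of _ _ "1 - u"]) auto
  qed auto
  have "set_integrable lborel {0<..<1::real} (\<lambda>z. \<bar>- 1\<bar> * (1 / sqrt (1 - z)))"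
    by (subst set_integrable_substitution[OF _ im, symmetric])
       (auto intro!: derivative_eq_intros inj_onI integrable_inverse_sqrt simp: set_borel_measurable_def)
  then have "set_integrable lborel {0<..<1::real} (\<lambda>z. 1 / sqrt (1 - z))" by simp
  then have i: "set_integrable lborel {0<..<1::real} (\<lambda>z. 2 * (1 / sqrt (1 - z)))"
    by (rule set_integrable_mult_right)
  show ?thesis
  proof (rule set_integrable_bound[OF i])
    show "AE z in lborel. z \<in> {0<..<1} \<longrightarrow> norm (ln (1 - z) / z) \<le> norm (2 * (1 / sqrt (1 - z)))"
    proof (intro AE_I2 impI)
      fix z :: real assume z: "z \<in> {0<..<1}"
      define s where "s = sqrt (1 - z)"
      have s: "0 < s" "s < 1" "s\<^sup>2 = 1 - z" using z by (auto simp: s_def)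
      have "- ln (1 - z) = 2 * ln (1 / s)"
        using s by (simp flip: s(3) add: ln_realpow ln_div)
      also have "\<dots> \<le> 2 * (1 / s - 1)" using s by (intro mult_left_mono ln_le_minus_one) auto
      also have "\<dots> = 2 * (1 - s) / s" using s by (simp add: field_simps)
      also have "\<dots> \<le> 2 * ((1 - s) * (1 + s)) / s"
        using s by (intro divide_right_mono mult_left_mono) (auto simp: algebra_simps power2_eq_square)
      also have "(1 - s) * (1 + s) = z" using s(3) by (simp add: algebra_simps power2_eq_square)
      finally have "- ln (1 - z) \<le> 2 * z / s" .
      moreover have "ln (1 - z) \<le> 0" using z by simp
      ultimately show "norm (ln (1 - z) / z) \<le> norm (2 * (1 / sqrt (1 - z)))"
        using z s by (simp add: s_def[symmetric] field_simps)
    qed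
  qed (simp add: set_borel_measurable_def)
qed

text \<open>The substitution \<open>z = - (k * w)\<close> maps onto the interval from
  \<open>- k\<close> to 0, whose reversed orientation in \<open>L2\<close> accounts for the sign. It
  degenerates at \<open>k = 0\<close>, where both sides are 0.\<close>

lemma
  fixes k :: real assumes k: "0 \<le> k"
  shows integral_ln_one_plus_over: "(LBINT w:{0<..<1}. ln (1 + k * w) / w) = - L2 (- k)"
    and integrable_ln_one_plus_over: "set_integrable lborel {0<..<1} (\<lambda>w. ln (1 + k * w) / w)"
proof -
  show "set_integrable lborel {0<..<1} (\<lambda>w. ln (1 + k * w) / w)"
  proof (rule set_integrable_bound)
    show "set_integrable lborel {0<..<1::real} (\<lambda>w. k)"
      by (simp add: set_integrable_def integrable_mult_left)
    show "AE w in lborel. w \<in> {0<..<1} \<longrightarrow> norm (ln (1 + k * w) / w) \<le> norm k"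
    proof (intro AE_I2 impI)
      fix w :: real assume w: "w \<in> {0<..<1}"
      have "0 \<le> k * w" using w k by simp
      then have "0 \<le> ln (1 + k * w)" "ln (1 + k * w) \<le> k * w" using ln_add_one_self_le_self by auto
      then show "norm (ln (1 + k * w) / w) \<le> norm k" using w k by (simp add: divide_le_eq)
    qed
  qed (simp add: set_borel_measurable_def)
  show "(LBINT w:{0<..<1}. ln (1 + k * w) / w) = - L2 (- k)"
  proof (cases "k = 0")
    case True
    then show ?thesis by (simp add: L2_def zero_ereal_def[symmetric])
  next
    case False
    then have k: "0 < k" using k by simp
    have im: "(\<lambda>w. - (k * w)) ` {0<..<1} = {- k<..<0}"
    proof (intro equalityI subsetI)
      fix u :: real assume "u \<in> {- k<..<0}"
      then show "u \<in> (\<lambda>w. - (k * w)) ` {0<..<1}" using k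
        by (intro image_eqI[of _ _ "- (u / k)"]) (auto simp: field_simps)
    qed (use k in auto)
    have "L2 (- k) = (LBINT z:{- k<..<0}. ln (1 - z) / z)"
      using k by (simp add: L2_def interval_lebesgue_integral_def zero_ereal_def)
    also have "\<dots> = (LBINT w:{0<..<1}. \<bar>- k\<bar> * (ln (1 - - (k * w)) / - (k * w)))"
      by (rule set_integral_substitution[OF _ im])
         (use k in \<open>auto intro!: derivative_eq_intros inj_onI simp: set_borel_measurable_def\<close>)
    also have "\<dots> = (LBINT w:{0<..<1}. - (ln (1 + k * w) / w))"
      using k by (intro set_lebesgue_integral_cong) auto
    also have "\<dots> = - (LBINT w:{0<..<1}. ln (1 + k * w) / w)" by (simp add: set_lebesgue_integral_def)
    finally show ?thesis by simp
  qed
qed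

text \<open>Duplication: substitute \<open>y = z^2\<close> in \<open>\<integral> ln (1 - y) / y\<close> over the unit interval.\<close>
lemma L2_minus_one: "L2 (- 1) = - L2 1 / 2"
proof -
  have im: "(\<lambda>x::real. x\<^sup>2) ` {0<..<1} = {0<..<1}"
  proof (intro equalityI subsetI)
    fix y :: real assume "y \<in> {0<..<1}"
    then show "y \<in> (\<lambda>x. x\<^sup>2) ` {0<..<1}" by (intro image_eqI[of _ _ "sqrt y"]) auto
  qed (auto simp: power_less_one_iff)
  have L1: "L2 1 = - (LBINT z:{0<..<1}. ln (1 - z) / z)"
    by (simp add: L2_def interval_lebesgue_integral_def zero_ereal_def)
  have "(LBINT z:{0<..<1}. ln (1 - z) / z) = (LBINT z:{0<..<1::real}. \<bar>2 * z\<bar> * (ln (1 - z\<^sup>2) / z\<^sup>2))"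
    by (rule set_integral_substitution[OF _ im])
       (auto intro!: derivative_eq_intros inj_onI simp: set_borel_measurable_def)
  also have "\<dots> = (LBINT z:{0<..<1}. 2 * (ln (1 - z) / z) + 2 * (ln (1 + 1 * z) / z))"
  proof (rule set_lebesgue_integral_cong, goal_cases)
    case 2
    show ?case
    proof (intro allI impI)
      fix z :: real assume z: "z \<in> {0<..<1}"
      have "1 - z\<^sup>2 = (1 - z) * (1 + z)" by (simp add: algebra_simps power2_eq_square)
      then have "ln (1 - z\<^sup>2) = ln (1 - z) + ln (1 + z)" using z by (simp add: ln_mult)
      then show "\<bar>2 * z\<bar> * (ln (1 - z\<^sup>2) / z\<^sup>2) = 2 * (ln (1 - z) / z) + 2 * (ln (1 + 1 * z) / z)"
        using z by (simp add: field_simps power2_eq_square)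
    qed
  qed simp
  also have "\<dots> = 2 * (LBINT z:{0<..<1}. ln (1 - z) / z) + 2 * (LBINT z:{0<..<1}. ln (1 + 1 * z) / z)"
  proof -
    have "set_integrable lborel {0<..<1::real} (\<lambda>z. 2 * (ln (1 - z) / z))"
      "set_integrable lborel {0<..<1::real} (\<lambda>z. 2 * (ln (1 + 1 * z) / z))"
      by (rule set_integrable_mult_right, rule integrable_ln_one_minus_over)
         (rule set_integrable_mult_right, rule integrable_ln_one_plus_over, simp)
    from set_integral_add(2)[OF this] show ?thesis by (simp only: set_integral_mult_right)
  qed
  finally show ?thesis using L1 integral_ln_one_plus_over[of 1] by simp
qed

text \<open>Cancelling \<open>a\<close> leaves \<open>(1 + w) / (1 + e / a * w)\<close>. The
  numerator contributes \<open>- L2 (- 1)\<close>, which duplication turns into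
  \<open>L2 1 / 2\<close>.\<close>

lemma
  fixes a e :: real
  assumes a: "0 < a" and e: "0 \<le> e"
  shows integral_ln_ratio_over:
    "(LBINT w:{0<..<1}. ln (a * (1 + w) / (e * w + a)) / w) = L2 1 / 2 + L2 (- (e / a))"
proof -
  have "(LBINT w:{0<..<1}. ln (a * (1 + w) / (e * w + a)) / w)
      = (LBINT w:{0<..<1}. ln (1 + 1 * w) / w - ln (1 + e / a * w) / w)"
  proof (rule set_lebesgue_integral_cong, goal_cases)
    case 2
    show ?case
    proof (intro allI impI)
      fix w :: real assume w: "w \<in> {0<..<1}"
      have p: "0 < 1 + e / a * w" using a e w by (simp add: add_pos_nonneg)
      have "e * w + a = a * (1 + e / a * w)" using a by (simp add: field_simps)
      then have "a * (1 + w) / (e * w + a) = (1 + 1 * w) / (1 + e / a * w)" using a by simp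
      then show "ln (a * (1 + w) / (e * w + a)) / w = ln (1 + 1 * w) / w - ln (1 + e / a * w) / w"
        using w p by (simp only: ln_div) (simp add: ln_div diff_divide_distrib)
    qed
  qed simp
  also have "\<dots> = - L2 (- 1) + L2 (- (e / a))"
    using integrable_ln_one_plus_over[of 1] integrable_ln_one_plus_over[of "e / a"]
      integral_ln_one_plus_over[of 1] integral_ln_one_plus_over[of "e / a"] a e
    by (subst set_integral_diff) auto
  finally show ?thesis by (simp add: L2_minus_one)
qed

section \<open>Substitutions and joint rates\<close>

text \<open>The variable \<open>s\<close> is the argument at which \<open>A\<close> is evaluated in
  the joint rate: on the left \<open>(1 - t) w : t = (1 - s) : s\<close>, on the right
  \<open>(1 - t) : t w = (1 - s) : s\<close>. Solving for \<open>w\<close> gives the two fractional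
  linear maps, and the share of the second entry gives their inverses.\<close>

lemma
  fixes f k :: "real \<Rightarrow> real" and t :: real
  assumes t: "t \<in> {0<..<1}" and f [measurable]: "f \<in> borel_measurable borel"
  shows set_integral_substitution_left:
    "(\<And>s. 0 < s \<Longrightarrow> s < t \<Longrightarrow> t / ((1 - t) * s\<^sup>2) * f (t * (1 - s) / ((1 - t) * s)) = k s) \<Longrightarrow>
     (LBINT w:{1<..}. f w) = (LBINT s:{0<..<t}. k s)"
   and set_integral_substitution_right:
    "(\<And>s. t < s \<Longrightarrow> s < 1 \<Longrightarrow> (1 - t) / (t * (1 - s)\<^sup>2) * f ((1 - t) * s / (t * (1 - s))) = k s) \<Longrightarrow>
     (LBINT w:{1<..}. f w) = (LBINT s:{t<..<1}. k s)"
   and set_integral_substitution_unit: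
    "(\<And>s. 0 < s \<Longrightarrow> s < 1 \<Longrightarrow> (1 - t) / (t * (1 - s)\<^sup>2) * f ((1 - t) * s / (t * (1 - s))) = k s) \<Longrightarrow>
     (LBINT w:{0<..}. f w) = (LBINT s:{0<..<1}. k s)"
proof -
  let ?l = "\<lambda>s. t * (1 - s) / ((1 - t) * s)" and ?r = "\<lambda>s. (1 - t) * s / (t * (1 - s))"
  have t01: "0 < t" "0 < 1 - t" using t by auto
  have inv_l: "t / ((1 - t) * ?l s + t) = s" if "0 < s" for s
  proof -
    have "(1 - t) * ?l s + t = t / s" using t01 that by (simp add: field_simps)
    then show ?thesis using t01 by simp
  qed
  have inv_r: "t * ?r s / ((1 - t) + t * ?r s) = s" if "s < 1" for s
  proof -
    have "(1 - t) + t * ?r s = (1 - t) / (1 - s)" "t * ?r s = (1 - t) * s / (1 - s)"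
      using t01 that by (simp_all add: field_simps)
    then show ?thesis using t01 that by simp
  qed
  have dl: "(?l has_real_derivative - (t / ((1 - t) * s\<^sup>2))) (at s)" if "0 < s" for s
  proof -
    have "(?l has_real_derivative ((t * (0 - 1)) * ((1 - t) * s) - t * (1 - s) * ((1 - t) * 1)) / (((1 - t) * s) * ((1 - t) * s))) (at s)"
      using that t01 by (intro DERIV_divide) (auto intro!: derivative_eq_intros)
    also have "((t * (0 - 1)) * ((1 - t) * s) - t * (1 - s) * ((1 - t) * 1)) = - (t * (1 - t))" by (simp add: algebra_simps)
    also have "- (t * (1 - t)) / (((1 - t) * s) * ((1 - t) * s)) = - (t / ((1 - t) * s\<^sup>2))"
      using that t01 by (simp add: power2_eq_square)
    finally show ?thesis .
  qed
  have dr: "(?r has_real_derivative (1 - t) / (t * (1 - s)\<^sup>2)) (at s)" if "s < 1" for s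
  proof -
    have "(?r has_real_derivative (((1 - t) * 1) * (t * (1 - s)) - (1 - t) * s * (t * (0 - 1))) / ((t * (1 - s)) * (t * (1 - s)))) (at s)"
      using that t01 by (intro DERIV_divide) (auto intro!: derivative_eq_intros)
    also have "((1 - t) * 1) * (t * (1 - s)) - (1 - t) * s * (t * (0 - 1)) = t * (1 - t)" by (simp add: algebra_simps)
    also have "t * (1 - t) / ((t * (1 - s)) * (t * (1 - s))) = (1 - t) / (t * (1 - s)\<^sup>2)"
      using that t01 by (simp add: power2_eq_square)
    finally show ?thesis .
  qed
  show "(LBINT w:{1<..}. f w) = (LBINT s:{0<..<t}. k s)"
    if k: "\<And>s. 0 < s \<Longrightarrow> s < t \<Longrightarrow> t / ((1 - t) * s\<^sup>2) * f (?l s) = k s"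
  proof -
    have im: "?l ` {0<..<t} = {1<..}"
    proof (intro equalityI subsetI)
      fix w assume "w \<in> ?l ` {0<..<t}"
      then obtain s where s: "0 < s" "s < t" "w = ?l s" by auto
      have "(1 - t) * s < t * (1 - s)" using s by (simp add: algebra_simps)
      then show "w \<in> {1<..}" using s t01 by (simp add: less_divide_eq)
    next
      fix w :: real assume w: "w \<in> {1<..}"
      let ?s = "t / ((1 - t) * w + t)"
      have p: "0 < (1 - t) * w + t" using t01 w by (simp add: add_pos_pos)
      have "t < t * ((1 - t) * w + t)"
      proof -
        have "(1 - t) * 1 < (1 - t) * w" using t01 w by (intro mult_strict_left_mono) auto
        then have "1 < (1 - t) * w + t" by simp
        then show ?thesis using t01 by simp
      qed
      then have "?s \<in> {0<..<t}" using p t01 by (simp add: divide_less_eq)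
      moreover have "w = ?l ?s"
      proof -
        have "1 - ?s = (1 - t) * w / ((1 - t) * w + t)" using p by (simp add: field_simps)
        then show ?thesis using p t01 by simp
      qed
      ultimately show "w \<in> ?l ` {0<..<t}" by blast
    qed
    have "(LBINT w:{1<..}. f w) = (LBINT s:{0<..<t}. \<bar>- (t / ((1 - t) * s\<^sup>2))\<bar> * f (?l s))"
      by (rule set_integral_substitution[OF _ im])
         (auto intro!: dl intro: inj_on_inverseI[where g = "\<lambda>w. t / ((1 - t) * w + t)"]
           simp: inv_l set_borel_measurable_def simp del: times_divide_eq_right)
    also have "\<dots> = (LBINT s:{0<..<t}. k s)"
      using t01 by (intro set_lebesgue_integral_cong) (auto simp: k[symmetric])
    finally show ?thesis .
  qed
  \<comment> \<open>The lower limit stays variable because the same map serves twice: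
    \<open>l = t\<close> corresponds to \<open>w = 1\<close>, and \<open>l = 0\<close> to
    \<open>w = 0\<close>.\<close>
  have R: "w \<in> ?r ` {l<..<1} \<longleftrightarrow> (1 - t) * l / (t * (1 - l)) < w" if l: "0 \<le> l" "l < 1" for w l
  proof
    assume "w \<in> ?r ` {l<..<1}"
    then obtain s where s: "l < s" "s < 1" "w = ?r s" by auto
    have "l / (1 - l) < s / (1 - s)" using s by (simp add: frac_less2 divide_simps algebra_simps)
    then have "(1 - t) / t * (l / (1 - l)) < (1 - t) / t * (s / (1 - s))"
      using t01 by (intro mult_strict_left_mono) auto
    then show "(1 - t) * l / (t * (1 - l)) < w" unfolding s by simp
  next
    assume w: "(1 - t) * l / (t * (1 - l)) < w"
    let ?s = "t * w / ((1 - t) + t * w)"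
    have "0 \<le> (1 - t) * l / (t * (1 - l))" using t01 l by simp
    then have w0: "0 < w" using w by linarith
    have p: "0 < (1 - t) + t * w" using t01 w0 by (simp add: add_pos_pos)
    have "(1 - t) * l < w * (t * (1 - l))" using w t01 l by (simp add: divide_less_eq)
    then have "l * ((1 - t) + t * w) < t * w" by (simp add: algebra_simps)
    then have "l < ?s" using p by (simp add: less_divide_eq)
    then have "?s \<in> {l<..<1}" using p t01 by (simp add: divide_less_eq)
    moreover have "w = ?r ?s"
    proof -
      have "1 - ?s = (1 - t) / ((1 - t) + t * w)" using p by (simp add: field_simps)
      then show ?thesis using p t01 by simp
    qed
    ultimately show "w \<in> ?r ` {l<..<1}" by (rule image_eqI[rotated])
  qed
  have right: "(LBINT w:{(1 - t) * l / (t * (1 - l))<..}. f w) = (LBINT s:{l<..<1}. k s)"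
    if l: "0 \<le> l" "l < 1"
      and k: "\<And>s. l < s \<Longrightarrow> s < 1 \<Longrightarrow> (1 - t) / (t * (1 - s)\<^sup>2) * f (?r s) = k s" for l
  proof -
    let ?W = "{(1 - t) * l / (t * (1 - l))<..}"
    have im: "?r ` {l<..<1} = ?W"
      by (rule set_eqI) (unfold R[OF l] greaterThan_iff, rule refl)
    have "(LBINT w:?W. f w) = (LBINT s:{l<..<1}. \<bar>(1 - t) / (t * (1 - s)\<^sup>2)\<bar> * f (?r s))"
    proof (rule set_integral_substitution[OF _ im])
      show "inj_on ?r {l<..<1}"
      proof (rule inj_on_inverseI)
        fix s assume "s \<in> {l<..<1}"
        then show "t * ?r s / ((1 - t) + t * ?r s) = s" by (intro inv_r) simp
      qed
      show "(?r has_real_derivative (1 - t) / (t * (1 - s)\<^sup>2)) (at s)" if "s \<in> {l<..<1}" for s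
        using that by (intro dr) simp
    qed (simp_all add: set_borel_measurable_def)
    also have "\<dots> = (LBINT s:{l<..<1}. k s)"
    proof (rule set_lebesgue_integral_cong, goal_cases)
      case 2
      show ?case
      proof (intro allI impI)
        fix s assume "s \<in> {l<..<1}"
        then have s: "l < s" "s < 1" by auto
        show "\<bar>(1 - t) / (t * (1 - s)\<^sup>2)\<bar> * f (?r s) = k s"
          unfolding k[OF s, symmetric] using t01 s by (subst abs_of_nonneg) auto
      qed
    qed simp
    finally show ?thesis .
  qed
  show "(LBINT w:{1<..}. f w) = (LBINT s:{t<..<1}. k s)"
    if "\<And>s. t < s \<Longrightarrow> s < 1 \<Longrightarrow> (1 - t) / (t * (1 - s)\<^sup>2) * f (?r s) = k s"
  proof -
    have "(1 - t) * t / (t * (1 - t)) = 1" using t01 by simp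
    then show ?thesis using right[of t, OF _ _ that] t01 by simp
  qed
  show "(LBINT w:{0<..}. f w) = (LBINT s:{0<..<1}. k s)"
    if "\<And>s. 0 < s \<Longrightarrow> s < 1 \<Longrightarrow> (1 - t) / (t * (1 - s)\<^sup>2) * f (?r s) = k s"
    using right[of 0, OF _ _ that] by simp
qed

text \<open>For two equal triples, exchanging the times changes nothing; by homogeneity this becomes
  a symmetry under \<open>w -> 1 / w\<close>.\<close>

lemma joint_rate_inverse: "0 < w \<Longrightarrow> joint_rate A T T (1 / w) = joint_rate A T T w / w"
proof -
  assume w: "0 < w"
  obtain e p q where T: "T = (e, p, q)" by (cases T)
  have "max p (p * w) = w * max p (p * (1 / w))" "max q (q * w) = w * max q (q * (1 / w))"
    using w by (simp_all add: max_mult_distrib_left max.commute mult.commute)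
  then have "tail_dep A (max p (p * w)) (max q (q * w)) = w * tail_dep A (max p (p * (1 / w))) (max q (q * (1 / w)))"
    using tail_dep_scale[OF w] by simp
  then show ?thesis using w unfolding T joint_rate_def prod.case by (simp add: field_simps)
qed

context
  fixes A :: "real \<Rightarrow> real" and t a :: real
  assumes A: "pickands_function A" and t: "t \<in> {0<..<1}" and a: "a = A t"
begin

text \<open>For \<open>w \<le> 1\<close> the maxima are attained by the first triple, whose
  constants add up to \<open>a\<close>; only the exponent \<open>e\<close> of the second triple
  remains as slope. The pair of the two marginal triples is absent: its maxima come from different
  triples for every \<open>w\<close>.\<close>

lemma joint_rate_triples_le:
  shows "\<forall>w\<in>{0<..1}. joint_rate A (0, 1 - t, t) (0, 1 - t, t) w = 0 * w + a"
    "\<forall>w\<in>{0<..1}. joint_rate A (a - (1 - t), 1 - t, 0) (a - (1 - t), 1 - t, 0) w = (a - (1 - t)) * w + a"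
    "\<forall>w\<in>{0<..1}. joint_rate A (a - t, 0, t) (a - t, 0, t) w = (a - t) * w + a"
    "\<forall>w\<in>{0<..1}. joint_rate A (0, 1 - t, t) (a - (1 - t), 1 - t, 0) w = (a - (1 - t)) * w + a"
    "\<forall>w\<in>{0<..1}. joint_rate A (0, 1 - t, t) (a - t, 0, t) w = (a - t) * w + a"
proof -
  have m: "max (1 - t) ((1 - t) * w) = 1 - t" "max t (t * w) = t" "max (1 - t) 0 = 1 - t" "max t 0 = t"
    if "w \<in> {0<..1}" for w
    using t that by (simp_all add: mult_left_le)
  have "tail_dep A (1 - t) t = a" using t by (simp add: tail_dep_pos a)
  then show "\<forall>w\<in>{0<..1}. joint_rate A (0, 1 - t, t) (0, 1 - t, t) w = 0 * w + a"
    "\<forall>w\<in>{0<..1}. joint_rate A (a - (1 - t), 1 - t, 0) (a - (1 - t), 1 - t, 0) w = (a - (1 - t)) * w + a"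
    "\<forall>w\<in>{0<..1}. joint_rate A (a - t, 0, t) (a - t, 0, t) w = (a - t) * w + a"
    "\<forall>w\<in>{0<..1}. joint_rate A (0, 1 - t, t) (a - (1 - t), 1 - t, 0) w = (a - (1 - t)) * w + a"
    "\<forall>w\<in>{0<..1}. joint_rate A (0, 1 - t, t) (a - t, 0, t) w = (a - t) * w + a"
    by (auto simp: joint_rate_def m)
qed

text \<open>Here \<open>w > 1\<close>, so the maxima \<open>(1 - t) * w\<close> and \<open>t\<close>
  come from different triples. They add up to \<open>t / s\<close>, and the share of the second is
  \<open>s\<close>.\<close>

lemma joint_rate_left:
  assumes s: "0 < s" "s < t"
  shows "joint_rate A (0, 1 - t, t) (a - (1 - t), 1 - t, 0) (t * (1 - s) / ((1 - t) * s))
    = t / s * (A s + (1 - s) * (a / (1 - t) - 1))"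
proof -
  let ?w = "t * (1 - s) / ((1 - t) * s)"
  have t': "0 < t" "0 < 1 - t" using t by auto
  have "(1 - t) * s \<le> t * (1 - s)" using s by (simp add: algebra_simps)
  then have w: "1 \<le> ?w" using s t' by (simp add: le_divide_eq)
  have e: "(1 - t) * ?w = t * (1 - s) / s" using t' by simp
  have "(1 - t) * 1 \<le> (1 - t) * ?w" by (rule mult_left_mono[OF w]) (use t' in simp)
  then have "max (1 - t) ((1 - t) * ?w) = t * (1 - s) / s" unfolding e by simp
  moreover have "max t (0 * ?w) = t" using t' by simp
  moreover have "tail_dep A (t * (1 - s) / s) t = t / s * A s"
  proof -
    have sum: "t * (1 - s) / s + t = t / s" using s by (simp add: field_simps)
    have "tail_dep A (t * (1 - s) / s) t = (t * (1 - s) / s + t) * A (t / (t * (1 - s) / s + t))"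
      using s t by (intro tail_dep_pos) auto
    then show ?thesis unfolding sum using t' by simp
  qed
  ultimately have "joint_rate A (0, 1 - t, t) (a - (1 - t), 1 - t, 0) ?w = (a - (1 - t)) * ?w + t / s * A s"
    by (simp add: joint_rate_def)
  also have "\<dots> = t / s * (A s + (1 - s) * (a / (1 - t) - 1))"
    using s t' by (simp add: divide_simps) (simp add: algebra_simps)
  finally show ?thesis .
qed

lemma tail_dep_right:
  assumes s: "0 < s" "s < 1"
  shows "tail_dep A (1 - t) (t * ((1 - t) * s / (t * (1 - s)))) = (1 - t) / (1 - s) * A s"
proof -
  have t': "0 < t" "0 < 1 - t" using t by auto
  have e: "t * ((1 - t) * s / (t * (1 - s))) = (1 - t) * s / (1 - s)" using t' by simp
  have sum: "1 - t + (1 - t) * s / (1 - s) = (1 - t) / (1 - s)" using s by (simp add: field_simps)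
  have "tail_dep A (1 - t) ((1 - t) * s / (1 - s))
      = (1 - t + (1 - t) * s / (1 - s)) * A ((1 - t) * s / (1 - s) / (1 - t + (1 - t) * s / (1 - s)))"
    using s t by (intro tail_dep_pos) auto
  then show ?thesis unfolding sum e using t' s by simp
qed

lemma joint_rate_right:
  assumes s: "t < s" "s < 1"
  shows "joint_rate A (0, 1 - t, t) (a - t, 0, t) ((1 - t) * s / (t * (1 - s)))
    = (1 - t) / (1 - s) * (A s + s * (a / t - 1))"
proof -
  let ?w = "(1 - t) * s / (t * (1 - s))"
  have t': "0 < t" "0 < 1 - t" "0 < s" using t s by auto
  have "t * (1 - s) \<le> (1 - t) * s" using s by (simp add: algebra_simps)
  then have w: "1 \<le> ?w" using s t' by (simp add: le_divide_eq)
  have "t * 1 \<le> t * ?w" by (rule mult_left_mono[OF w]) (use t' in simp)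
  then have "max t (t * ?w) = t * ?w" by (simp only: max_absorb2 mult_1_right)
  moreover have "max (1 - t) (0 * ?w) = 1 - t" using t' by simp
  ultimately have "joint_rate A (0, 1 - t, t) (a - t, 0, t) ?w = (a - t) * ?w + (1 - t) / (1 - s) * A s"
    unfolding joint_rate_def prod.case using tail_dep_right[OF t'(3) s(2)] by simp
  also have "\<dots> = (1 - t) / (1 - s) * (A s + s * (a / t - 1))"
    using s t' by (simp add: divide_simps) (simp add: algebra_simps)
  finally show ?thesis .
qed

lemma joint_rate_unit:
  assumes s: "0 < s" "s < 1"
  shows "joint_rate A (a - (1 - t), 1 - t, 0) (a - t, 0, t) ((1 - t) * s / (t * (1 - s)))
    = (1 - t) / (1 - s) * (A s + s * (a / t) + (1 - s) * (a / (1 - t)) - 1)"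
proof -
  let ?w = "(1 - t) * s / (t * (1 - s))"
  have t': "0 < t" "0 < 1 - t" using t by auto
  have "0 \<le> t * ?w" using s t' by simp
  then have m: "max 0 (t * ?w) = t * ?w" "max (1 - t) (0 * ?w) = 1 - t" using t' by auto
  have "joint_rate A (a - (1 - t), 1 - t, 0) (a - t, 0, t) ?w
      = (a - (1 - t)) + (a - t) * ?w + (1 - t) / (1 - s) * A s"
    unfolding joint_rate_def prod.case m tail_dep_right[OF s] ..
  also have "\<dots> = (1 - t) / (1 - s) * (A s + s * (a / t) + (1 - s) * (a / (1 - t)) - 1)"
    using s t' by (simp add: divide_simps) (simp add: algebra_simps)
  finally show ?thesis .
qed

end

section \<open>Evaluation of the half-line integrals\<close>

lemma
  fixes a :: real assumes a: "0 < a"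
  shows integral_marginal_square_lower: "(LBINT w:{0<..<1}. 1 / (a * (1 + w))\<^sup>2) = 1 / (2 * a\<^sup>2)"
    and integrable_marginal_square_lower: "set_integrable lborel {0<..<1} (\<lambda>w. 1 / (a * (1 + w))\<^sup>2)"
    and integral_marginal_square_upper: "(LBINT w:{1<..}. 1 / (a * (1 + w))\<^sup>2) = 1 / (2 * a\<^sup>2)"
    and integrable_marginal_square_upper: "set_integrable lborel {1<..} (\<lambda>w. 1 / (a * (1 + w))\<^sup>2)"
    and integral_marginal_square: "(LBINT w:{0<..}. 1 / (a * (1 + w))\<^sup>2) = 1 / a\<^sup>2"
    and integrable_marginal_square: "set_integrable lborel {0<..} (\<lambda>w. 1 / (a * (1 + w))\<^sup>2)"
proof -
  let ?q = "\<lambda>w. 1 / (a * (1 + w))\<^sup>2"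
  \<comment> \<open>The affine case with slope \<open>e = a\<close>; inversion maps this integrand
    to itself, so both halves contribute equally.\<close>
  have eq: "?q = (\<lambda>w. 1 / (a * w + a)\<^sup>2)" by (simp add: algebra_simps)
  have k: "?q (1 / w) / w\<^sup>2 = ?q w" if "0 < w" "w < 1" for w
  proof -
    have "a * (1 + 1 / w) = a * (1 + w) / w" using that by (simp add: field_simps)
    then show ?thesis using that by (simp add: power_divide)
  qed
  show l: "(LBINT w:{0<..<1}. ?q w) = 1 / (2 * a\<^sup>2)" and li: "set_integrable lborel {0<..<1} ?q"
    using integral_inverse_square[of a a] integrable_inverse_square[of a a] a
    unfolding eq by (simp_all add: power2_eq_square)
  show u: "(LBINT w:{1<..}. ?q w) = 1 / (2 * a\<^sup>2)" and ui: "set_integrable lborel {1<..} ?q"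
    using set_integral_inversion[of ?q ?q, OF _ _ k] set_integrable_inversion[of ?q ?q, OF _ _ k] l li by simp_all
  have "set_integrable lborel ({0<..<1} \<union> {1<..}) ?q"
    by (rule set_integrable_Un[OF li ui]) auto
  moreover have "set_integrable lborel ({0<..<1} \<union> {1<..}) ?q \<longleftrightarrow> set_integrable lborel {0<..} ?q"
    unfolding set_integrable_def
  proof (rule integrable_cong_AE)
    show "AE w in lborel. indicat_real ({0<..<1} \<union> {1<..}) w *\<^sub>R ?q w = indicat_real {0<..} w *\<^sub>R ?q w"
      using AE_lborel_singleton[of "1::real"] by eventually_elim (auto split: split_indicator)
  qed measurable
  ultimately show i: "set_integrable lborel {0<..} ?q" by simp
  show "(LBINT w:{0<..}. ?q w) = 1 / a\<^sup>2"
    using set_integral_split_Ioi(1)[OF i] l u by simp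
qed

context pickands_sheet
begin

text \<open>On \<open>w < 1\<close> a pair of triples enters only through the slope
  \<open>e\<close>. This setting fits five of the six pairs, all except that of the two marginal
  triples.\<close>

context
  fixes a e :: real and T T' :: "real \<times> real \<times> real"
  assumes a: "0 < a" and e: "0 \<le> e" and T: "admissible A a T" "admissible A a T'"
    and low: "\<forall>w\<in>{0<..1}. joint_rate A T T' w = e * w + a"
begin

lemma integral_rate_P_lower:
  "(LBINT w:{0<..<1}. 1 / (joint_rate A T T' w)\<^sup>2 - 1 / (a * (1 + w))\<^sup>2) = 1 / (a * (a + e)) - 1 / (2 * a\<^sup>2)"
proof -
  have "(LBINT w:{0<..<1}. 1 / (joint_rate A T T' w)\<^sup>2 - 1 / (a * (1 + w))\<^sup>2)
      = (LBINT w:{0<..<1}. 1 / (e * w + a)\<^sup>2 - 1 / (a * (1 + w))\<^sup>2)"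
    by (rule set_lebesgue_integral_cong) (auto simp: low)
  then show ?thesis
    using set_integral_diff(2)[OF integrable_inverse_square[OF a e] integrable_marginal_square_lower[OF a]]
    by (simp add: integral_inverse_square[OF a e] integral_marginal_square_lower[OF a])
qed

lemma integral_rate_CFG_lower:
  "(LBINT w:{0<..<1}. ln (a * (1 + w) / joint_rate A T T' w) / w) = L2 1 / 2 + L2 (- (e / a))"
proof -
  have "(LBINT w:{0<..<1}. ln (a * (1 + w) / joint_rate A T T' w) / w)
      = (LBINT w:{0<..<1}. ln (a * (1 + w) / (e * w + a)) / w)"
    by (rule set_lebesgue_integral_cong) (auto simp: low)
  then show ?thesis by (simp add: integral_ln_ratio_over[OF a e])
qed

text \<open>Beyond 1 the subtracted square is integrable by itself and is split off; its two halves
  \<open>1 / (2 * a^2)\<close> combine to \<open>1 / a^2\<close>.\<close>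

lemma integral_rate_P_cross:
  "(LBINT w:{0<..}. 1 / (joint_rate A T T' w)\<^sup>2 - 1 / (a * (1 + w))\<^sup>2)
    = 1 / (a * (a + e)) - 1 / a\<^sup>2 + (LBINT w:{1<..}. 1 / (joint_rate A T T' w)\<^sup>2)"
proof -
  note sp = set_integral_split_Ioi[OF integrable_rate_P[OF a T]]
  show ?thesis
    using sp(1) integral_rate_P_lower set_integral_add(2)[OF sp(3) integrable_marginal_square_upper[OF a]]
    by (simp add: integral_marginal_square_upper[OF a])
qed

text \<open>The logarithm beyond 1 stays in one piece, because \<open>ln (a * (1 + w)) / w\<close>
  alone is not integrable there.\<close>

lemma integral_rate_CFG_cross:
  "(LBINT w:{0<..}. ln (a * (1 + w) / joint_rate A T T' w) / w)
    = L2 1 / 2 + L2 (- (e / a)) + (LBINT w:{1<..}. ln (a * (1 + w) / joint_rate A T T' w) / w)"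
  using set_integral_split_Ioi(1)[OF integrable_rate_CFG[OF a T]] integral_rate_CFG_lower by simp

text \<open>Both integrands are invariant under inversion, so the half beyond 1 equals the explicit
  lower half.\<close>

lemma integral_rate_self:
  assumes TT: "T = T'"
  shows "(LBINT w:{0<..}. 1 / (joint_rate A T T' w)\<^sup>2 - 1 / (a * (1 + w))\<^sup>2) = 2 / (a * (a + e)) - 1 / a\<^sup>2"
    "(LBINT w:{0<..}. ln (a * (1 + w) / joint_rate A T T' w) / w) = L2 1 + 2 * L2 (- (e / a))"
proof -
  have [measurable]: "joint_rate A T T' \<in> borel_measurable borel"
    using borel_measurable_joint_rate[OF A_diff, of "\<lambda>x. x" borel] by simp
  have inv: "joint_rate A T T' (1 / w) = joint_rate A T T' w / w" if "0 < w" for w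
    using that unfolding TT by (rule joint_rate_inverse)
  have m: "a * (1 + 1 / w) = a * (1 + w) / w" if "0 < w" for w using that by (simp add: field_simps)
  let ?f = "\<lambda>w. 1 / (joint_rate A T T' w)\<^sup>2 - 1 / (a * (1 + w))\<^sup>2"
  let ?g = "\<lambda>w. ln (a * (1 + w) / joint_rate A T T' w) / w"
  have "?f (1 / w) / w\<^sup>2 = ?f w" if "0 < w" "w < 1" for w
    unfolding inv[OF that(1)] m[OF that(1)] using that by (simp add: power_divide diff_divide_distrib)
  from set_integral_inversion[of ?f ?f, OF _ _ this]
  show "(LBINT w:{0<..}. ?f w) = 2 / (a * (a + e)) - 1 / a\<^sup>2"
    using set_integral_split_Ioi(1)[OF integrable_rate_P[OF a T]] integral_rate_P_lower by simp
  have "?g (1 / w) / w\<^sup>2 = ?g w" if "0 < w" "w < 1" for w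
    unfolding inv[OF that(1)] m[OF that(1)] using that by (simp add: power2_eq_square)
  from set_integral_inversion[of ?g ?g, OF _ _ this]
  show "(LBINT w:{0<..}. ?g w) = L2 1 + 2 * L2 (- (e / a))"
    using set_integral_split_Ioi(1)[OF integrable_rate_CFG[OF a T]] integral_rate_CFG_lower by simp
qed

end

context
  fixes t a :: real
  assumes t: "t \<in> {0<..<1}" and a: "a = A t"
begin

lemma a_bounds: "0 < a" "1 - t \<le> a" "t \<le> a" "0 < t" "0 < 1 - t"
  using t pickands_function_bounds[OF A, of t] by (auto simp: a)

lemma measurable_rate [measurable]: "joint_rate A T T' \<in> borel_measurable borel"
  using borel_measurable_joint_rate[OF A_diff, of "\<lambda>x. x" borel] by simp

text \<open>The Jacobian \<open>t / ((1 - t) * s^2)\<close> meets the squared prefactor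
  \<open>(t / s)^2\<close> of the rate, and only \<open>1 / (t * (1 - t))\<close> survives.\<close>

lemma integral_rate_P_left:
  "(LBINT w:{1<..}. 1 / (joint_rate A (0, 1 - t, t) (a - (1 - t), 1 - t, 0) w)\<^sup>2)
    = 1 / (t * (1 - t)) * (LBINT s:{0<..<t}. 1 / (A s + (1 - s) * (a / (1 - t) - 1))\<^sup>2)"
proof -
  have "(LBINT w:{1<..}. 1 / (joint_rate A (0, 1 - t, t) (a - (1 - t), 1 - t, 0) w)\<^sup>2)
      = (LBINT s:{0<..<t}. 1 / (t * (1 - t)) * (1 / (A s + (1 - s) * (a / (1 - t) - 1))\<^sup>2))"
  proof (rule set_integral_substitution_left[OF t])
    fix s assume s: "0 < s" "s < t"
    show "t / ((1 - t) * s\<^sup>2) * (1 / (joint_rate A (0, 1 - t, t) (a - (1 - t), 1 - t, 0) (t * (1 - s) / ((1 - t) * s)))\<^sup>2)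
      = 1 / (t * (1 - t)) * (1 / (A s + (1 - s) * (a / (1 - t) - 1))\<^sup>2)"
      unfolding joint_rate_left[OF A t a s] power_mult_distrib
      using s a_bounds by (simp add: power2_eq_square)
  qed measurable
  then show ?thesis by (simp only: set_integral_mult_right)
qed

lemma integral_rate_P_right:
  "(LBINT w:{1<..}. 1 / (joint_rate A (0, 1 - t, t) (a - t, 0, t) w)\<^sup>2)
    = 1 / (t * (1 - t)) * (LBINT s:{t<..<1}. 1 / (A s + s * (a / t - 1))\<^sup>2)"
proof -
  have "(LBINT w:{1<..}. 1 / (joint_rate A (0, 1 - t, t) (a - t, 0, t) w)\<^sup>2)
      = (LBINT s:{t<..<1}. 1 / (t * (1 - t)) * (1 / (A s + s * (a / t - 1))\<^sup>2))"
  proof (rule set_integral_substitution_right[OF t])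
    fix s assume s: "t < s" "s < 1"
    show "(1 - t) / (t * (1 - s)\<^sup>2) * (1 / (joint_rate A (0, 1 - t, t) (a - t, 0, t) ((1 - t) * s / (t * (1 - s))))\<^sup>2)
      = 1 / (t * (1 - t)) * (1 / (A s + s * (a / t - 1))\<^sup>2)"
      unfolding joint_rate_right[OF A t a s] power_mult_distrib
      using s a_bounds by (simp add: power2_eq_square)
  qed measurable
  then show ?thesis by (simp only: set_integral_mult_right)
qed

lemma integral_rate_P_unit:
  "(LBINT w:{0<..}. 1 / (joint_rate A (a - (1 - t), 1 - t, 0) (a - t, 0, t) w)\<^sup>2 - 1 / (a * (1 + w))\<^sup>2)
    = 1 / (t * (1 - t)) * (LBINT s:{0<..<1}. 1 / (A s + s * (a / t) + (1 - s) * (a / (1 - t)) - 1)\<^sup>2) - 1 / a\<^sup>2"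
proof -
  have "(LBINT w:{0<..}. 1 / (joint_rate A (a - (1 - t), 1 - t, 0) (a - t, 0, t) w)\<^sup>2)
      = (LBINT s:{0<..<1}. 1 / (t * (1 - t)) * (1 / (A s + s * (a / t) + (1 - s) * (a / (1 - t)) - 1)\<^sup>2))"
  proof (rule set_integral_substitution_unit[OF t])
    fix s assume s: "0 < s" "s < (1::real)"
    show "(1 - t) / (t * (1 - s)\<^sup>2) * (1 / (joint_rate A (a - (1 - t), 1 - t, 0) (a - t, 0, t) ((1 - t) * s / (t * (1 - s))))\<^sup>2)
      = 1 / (t * (1 - t)) * (1 / (A s + s * (a / t) + (1 - s) * (a / (1 - t)) - 1)\<^sup>2)"
      unfolding joint_rate_unit[OF A t a s] power_mult_distrib
      using s a_bounds by (simp add: power2_eq_square)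
  qed measurable
  \<comment> \<open>No lower half is explicit here, so the subtracted square is added back on the
    whole half-line, where its integral is \<open>1 / a^2\<close>.\<close>
  moreover have "(LBINT w:{0<..}. 1 / (joint_rate A (a - (1 - t), 1 - t, 0) (a - t, 0, t) w)\<^sup>2 - 1 / (a * (1 + w))\<^sup>2)
      + 1 / a\<^sup>2 = (LBINT w:{0<..}. 1 / (joint_rate A (a - (1 - t), 1 - t, 0) (a - t, 0, t) w)\<^sup>2)"
    using set_integral_add(2)[OF integrable_rate_P[OF a_bounds(1) admissible_triples(2,3)[OF t, folded a]]
        integrable_marginal_square[OF a_bounds(1)]]
    by (simp add: integral_marginal_square[OF a_bounds(1)])
  ultimately show ?thesis by (simp only: set_integral_mult_right)
qed

text \<open>Up to orientation \<open>dw / w\<close> becomes \<open>ds / (s * (1 - s))\<close>. The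
  logarithm's argument is the reciprocal of the one in the final formula, hence the minus
  sign.\<close>

lemma integral_rate_CFG_left:
  "(LBINT w:{1<..}. ln (a * (1 + w) / joint_rate A (0, 1 - t, t) (a - (1 - t), 1 - t, 0) w) / w)
    = - (LBINT s:{0<..<t}. ln (1 - t * (1 - t) / a *
          ((1 - A s + s * (a / t - 1)) / (t * (1 - s) + (1 - t) * s))) / (s * (1 - s)))"
proof -
  have "(LBINT w:{1<..}. ln (a * (1 + w) / joint_rate A (0, 1 - t, t) (a - (1 - t), 1 - t, 0) w) / w)
      = (LBINT s:{0<..<t}. - (ln (1 - t * (1 - t) / a *
          ((1 - A s + s * (a / t - 1)) / (t * (1 - s) + (1 - t) * s))) / (s * (1 - s))))"
  proof (rule set_integral_substitution_left[OF t])
    fix s assume s: "0 < s" "s < t"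
    let ?w = "t * (1 - s) / ((1 - t) * s)" and ?D = "t * (1 - s) + (1 - t) * s"
    let ?X = "A s + (1 - s) * (a / (1 - t) - 1)"
    have D: "0 < ?D" using s a_bounds t by (simp add: add_pos_pos)
    have s1: "0 < 1 - s" using s t by simp
    have r1: "a * (1 + ?w) = a * (?D / ((1 - t) * s))" using s a_bounds by (simp add: field_simps)
    have "a * (1 + ?w) / (t / s * ?X) = inverse (t * (1 - t) * ?X / (a * ?D))"
    proof -
      \<comment> \<open>Stated for arbitrary \<open>X\<close> and \<open>D\<close>, so that the
        simplifier only has to cancel \<open>s\<close>.\<close>
      have "a * (D / ((1 - t) * s)) / (t / s * X) = inverse (t * (1 - t) * X / (a * D))" for X D :: real
        using s by simp
      then show ?thesis unfolding r1 .
    qed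
    also have "t * (1 - t) * ?X / (a * ?D) = 1 - t * (1 - t) / a * ((1 - A s + s * (a / t - 1)) / ?D)"
    proof -
      \<comment> \<open>In the sum of the two brackets \<open>A s\<close> and the constants cancel;
        what remains is \<open>a\<close> times \<open>?D\<close>.\<close>
      have "t * (1 - t) * ?X = a * ?D - t * (1 - t) * (1 - A s + s * (a / t - 1))"
        using a_bounds by (simp add: divide_simps) (simp add: algebra_simps)
      then show ?thesis using D a_bounds by (simp add: diff_divide_distrib)
    qed
    finally have "ln (a * (1 + ?w) / (t / s * ?X)) = - ln (1 - t * (1 - t) / a * ((1 - A s + s * (a / t - 1)) / ?D))"
      by (simp only: ln_inverse)
    then show "t / ((1 - t) * s\<^sup>2) * (ln (a * (1 + ?w) / joint_rate A (0, 1 - t, t) (a - (1 - t), 1 - t, 0) ?w) / ?w)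
      = - (ln (1 - t * (1 - t) / a * ((1 - A s + s * (a / t - 1)) / ?D)) / (s * (1 - s)))"
      unfolding joint_rate_left[OF A t a s] using s s1 a_bounds by (simp add: power2_eq_square)
  qed measurable
  then show ?thesis by (simp add: set_lebesgue_integral_def)
qed

text \<open>The computation for the left part with \<open>t\<close> and \<open>1 - t\<close>, and
  likewise \<open>s\<close> and \<open>1 - s\<close>, exchanged outside the argument of
  \<open>A\<close>.\<close>

lemma integral_rate_CFG_right:
  "(LBINT w:{1<..}. ln (a * (1 + w) / joint_rate A (0, 1 - t, t) (a - t, 0, t) w) / w)
    = - (LBINT s:{t<..<1}. ln (1 - t * (1 - t) / a *
          ((1 - A s + (1 - s) * (a / (1 - t) - 1)) / (t * (1 - s) + (1 - t) * s))) / (s * (1 - s)))"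
proof -
  have "(LBINT w:{1<..}. ln (a * (1 + w) / joint_rate A (0, 1 - t, t) (a - t, 0, t) w) / w)
      = (LBINT s:{t<..<1}. - (ln (1 - t * (1 - t) / a *
          ((1 - A s + (1 - s) * (a / (1 - t) - 1)) / (t * (1 - s) + (1 - t) * s))) / (s * (1 - s))))"
  proof (rule set_integral_substitution_right[OF t])
    fix s assume s: "t < s" "s < 1"
    let ?w = "(1 - t) * s / (t * (1 - s))" and ?D = "t * (1 - s) + (1 - t) * s"
    let ?X = "A s + s * (a / t - 1)"
    have s0: "0 < s" "0 < 1 - s" using s a_bounds by auto
    have D: "0 < ?D" using s0 a_bounds by (simp add: add_pos_pos)
    have r1: "a * (1 + ?w) = a * (?D / (t * (1 - s)))" using s0 a_bounds by (simp add: field_simps)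
    have "a * (1 + ?w) / ((1 - t) / (1 - s) * ?X) = inverse (t * (1 - t) * ?X / (a * ?D))"
    proof -
      have "a * (D / (t * (1 - s))) / ((1 - t) / (1 - s) * X) = inverse (t * (1 - t) * X / (a * D))" for X D :: real
        using s by simp
      then show ?thesis unfolding r1 .
    qed
    also have "t * (1 - t) * ?X / (a * ?D) = 1 - t * (1 - t) / a * ((1 - A s + (1 - s) * (a / (1 - t) - 1)) / ?D)"
    proof -
      have "t * (1 - t) * ?X = a * ?D - t * (1 - t) * (1 - A s + (1 - s) * (a / (1 - t) - 1))"
        using a_bounds by (simp add: divide_simps) (simp add: algebra_simps)
      then show ?thesis using D a_bounds by (simp add: diff_divide_distrib)
    qed
    finally have "ln (a * (1 + ?w) / ((1 - t) / (1 - s) * ?X)) = - ln (1 - t * (1 - t) / a * ((1 - A s + (1 - s) * (a / (1 - t) - 1)) / ?D))"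
      by (simp only: ln_inverse)
    then show "(1 - t) / (t * (1 - s)\<^sup>2) * (ln (a * (1 + ?w) / joint_rate A (0, 1 - t, t) (a - t, 0, t) ?w) / ?w)
      = - (ln (1 - t * (1 - t) / a * ((1 - A s + (1 - s) * (a / (1 - t) - 1)) / ?D)) / (s * (1 - s)))"
      unfolding joint_rate_right[OF A t a s] using s0 a_bounds by (simp add: power2_eq_square)
  qed measurable
  then show ?thesis by (simp add: set_lebesgue_integral_def)
qed

lemma integral_rate_CFG_unit:
  "(LBINT w:{0<..}. ln (a * (1 + w) / joint_rate A (a - (1 - t), 1 - t, 0) (a - t, 0, t) w) / w)
    = - (LBINT s:{0<..<1}. ln (1 - t * (1 - t) / a * ((1 - A s) / (t * (1 - s) + (1 - t) * s))) / (s * (1 - s)))"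
proof -
  have "(LBINT w:{0<..}. ln (a * (1 + w) / joint_rate A (a - (1 - t), 1 - t, 0) (a - t, 0, t) w) / w)
      = (LBINT s:{0<..<1}. - (ln (1 - t * (1 - t) / a * ((1 - A s) / (t * (1 - s) + (1 - t) * s))) / (s * (1 - s))))"
  proof (rule set_integral_substitution_unit[OF t])
    fix s assume s: "0 < s" "s < (1::real)"
    let ?w = "(1 - t) * s / (t * (1 - s))" and ?D = "t * (1 - s) + (1 - t) * s"
    let ?X = "A s + s * (a / t) + (1 - s) * (a / (1 - t)) - 1"
    have s0: "0 < s" "0 < 1 - s" using s by auto
    have D: "0 < ?D" using s0 a_bounds by (simp add: add_pos_pos)
    have r1: "a * (1 + ?w) = a * (?D / (t * (1 - s)))" using s0 a_bounds by (simp add: field_simps)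
    have "a * (1 + ?w) / ((1 - t) / (1 - s) * ?X) = inverse (t * (1 - t) * ?X / (a * ?D))"
    proof -
      have "a * (D / (t * (1 - s))) / ((1 - t) / (1 - s) * X) = inverse (t * (1 - t) * X / (a * D))" for X D :: real
        using s by simp
      then show ?thesis unfolding r1 .
    qed
    also have "t * (1 - t) * ?X / (a * ?D) = 1 - t * (1 - t) / a * ((1 - A s) / ?D)"
    proof -
      have "t * (1 - t) * ?X = a * ?D - t * (1 - t) * (1 - A s)"
        using a_bounds by (simp add: divide_simps) (simp add: algebra_simps)
      then show ?thesis using D a_bounds by (simp add: diff_divide_distrib[of "a * ?D"])
    qed
    finally have "ln (a * (1 + ?w) / ((1 - t) / (1 - s) * ?X)) = - ln (1 - t * (1 - t) / a * ((1 - A s) / ?D))"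
      by (simp only: ln_inverse)
    then show "(1 - t) / (t * (1 - s)\<^sup>2) * (ln (a * (1 + ?w) / joint_rate A (a - (1 - t), 1 - t, 0) (a - t, 0, t) ?w) / ?w)
      = - (ln (1 - t * (1 - t) / a * ((1 - A s) / ?D)) / (s * (1 - s)))"
      unfolding joint_rate_unit[OF A t a s] using s0 a_bounds by (simp add: power2_eq_square)
  qed measurable
  then show ?thesis by (simp add: set_lebesgue_integral_def)
qed

end

end

section \<open>Assembly of the two variance formulas\<close>

theorem proposition3p3:
  fixes M :: "'w measure"
    and A :: "real \<Rightarrow> real"
    and C :: "real \<Rightarrow> real \<Rightarrow> real"
    and \<alpha> :: "real \<times> real \<Rightarrow> 'w \<Rightarrow> real"
    and t :: real
  assumes "prob_space M"
    and "pickands_function A"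
    and "\<forall>s\<in>{0<..<1}. A differentiable (at s)"
    and "extreme_value_copula A C"
    and "pinned_brownian_sheet M C \<alpha>"
    and "t \<in> {0<..<1}"
  shows
    "let \<mu> = A t - t * deriv A t;
         \<nu> = A t + (1 - t) * deriv A t;
         A1 = A t / t;
         A2 = A t / (1 - t);
         \<mu>' = 1 - \<mu>;
         \<nu>' = 1 - \<nu>
     in
       prob_space.variance M (A_r_P A C \<alpha> t) / (A t)\<^sup>2 =
         2 - (\<mu> + \<nu> - 1)\<^sup>2
         - 2 * \<mu> * \<mu>' * A2 / (2 * A2 - 1)
         - 2 * \<nu> * \<nu>' * A1 / (2 * A1 - 1)
         + 2 * \<mu> * \<nu> * A1 * A2 *
             (LBINT s:{0<..<1}. 1 / (A s + s * A1 + (1 - s) * A2 - 1)\<^sup>2)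
         - 2 * \<mu> * A1 * A2 *
             (LBINT s:{0<..<t}. 1 / (A s + (1 - s) * (A2 - 1))\<^sup>2)
         - 2 * \<nu> * A1 * A2 *
             (LBINT s:{t<..<1}. 1 / (A s + s * (A1 - 1))\<^sup>2)
       \<and>
       prob_space.variance M (A_r_CFG A C \<alpha> t) / (A t)\<^sup>2 =
         (1 + \<mu>\<^sup>2 + \<nu>\<^sup>2 - \<mu> - \<nu>) * L2 1
         - 2 * \<mu> * \<mu>' * L2 (- 1 + 1 / A2)
         - 2 * \<nu> * \<nu>' * L2 (- 1 + 1 / A1)
         - 2 * \<mu> * \<nu> *
             (LBINT s:{0<..<1}.
                ln (1 - t * (1 - t) / A t * ((1 - A s) / (t * (1 - s) + (1 - t) * s)))
                / (s * (1 - s)))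
         + 2 * \<mu> *
             (LBINT s:{0<..<t}.
                ln (1 - t * (1 - t) / A t *
                      ((1 - A s + s * (A1 - 1)) / (t * (1 - s) + (1 - t) * s)))
                / (s * (1 - s)))
         + 2 * \<nu> *
             (LBINT s:{t<..<1}.
                ln (1 - t * (1 - t) / A t *
                      ((1 - A s + (1 - s) * (A2 - 1)) / (t * (1 - s) + (1 - t) * s)))
                / (s * (1 - s)))"
proof -
  interpret prob_space M by fact
  interpret pickands_sheet M A C \<alpha> by unfold_locales fact+
  note t = \<open>t \<in> {0<..<1}\<close>
  define a \<mu> \<nu> where "a = A t" and "\<mu> = A t - t * deriv A t" and "\<nu> = A t + (1 - t) * deriv A t"
  note bnd = a_bounds[OF t a_def]
  note T = admissible_triples[OF t, folded a_def]
  note low = joint_rate_triples_le[OF A t a_def]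
  have e: "0 \<le> a - (1 - t)" "0 \<le> a - t" using bnd by auto
  note self = integral_rate_self[OF bnd(1) order_refl T(1) T(1) low(1) refl]
    integral_rate_self[OF bnd(1) e(1) T(2) T(2) low(2) refl]
    integral_rate_self[OF bnd(1) e(2) T(3) T(3) low(3) refl]
  note cross_P = integral_rate_P_cross[OF bnd(1) e(1) T(1) T(2) low(4)]
    integral_rate_P_cross[OF bnd(1) e(2) T(1) T(3) low(5)]
  note cross_CFG = integral_rate_CFG_cross[OF bnd(1) e(1) T(1) T(2) low(4)]
    integral_rate_CFG_cross[OF bnd(1) e(2) T(1) T(3) low(5)]
  define I J K where "I = (LBINT s:{0<..<1}. 1 / (A s + s * (a / t) + (1 - s) * (a / (1 - t)) - 1)\<^sup>2)"
    and "J = (LBINT s:{0<..<t}. 1 / (A s + (1 - s) * (a / (1 - t) - 1))\<^sup>2)"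
    and "K = (LBINT s:{t<..<1}. 1 / (A s + s * (a / t - 1))\<^sup>2)"
  have P: "variance (A_r_P A C \<alpha> t) / a\<^sup>2 = a\<^sup>2 *
    ((2 / (a * (a + 0)) - 1 / a\<^sup>2) + \<mu>\<^sup>2 * (2 / (a * (a + (a - (1 - t)))) - 1 / a\<^sup>2) + \<nu>\<^sup>2 * (2 / (a * (a + (a - t))) - 1 / a\<^sup>2)
     - 2 * \<mu> * (1 / (a * (a + (a - (1 - t)))) - 1 / a\<^sup>2 + 1 / (t * (1 - t)) * J)
     - 2 * \<nu> * (1 / (a * (a + (a - t))) - 1 / a\<^sup>2 + 1 / (t * (1 - t)) * K)
     + 2 * \<mu> * \<nu> * (1 / (t * (1 - t)) * I - 1 / a\<^sup>2))"
    unfolding variance_A_r_P[OF t \<mu>_def \<nu>_def, folded a_def] self(1,3,5) cross_P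
      integral_rate_P_left[OF t a_def] integral_rate_P_right[OF t a_def] integral_rate_P_unit[OF t a_def]
      I_def J_def K_def ..
  have dif: "a + (a - (1 - t)) \<noteq> 0" "a + (a - t) \<noteq> 0" using bnd by auto
  have r: "2 * \<mu> * (1 - \<mu>) * (a / (1 - t)) / (2 * (a / (1 - t)) - 1) = 2 * \<mu> * (1 - \<mu>) * (a / (a + (a - (1 - t))))"
    "2 * \<nu> * (1 - \<nu>) * (a / t) / (2 * (a / t) - 1) = 2 * \<nu> * (1 - \<nu>) * (a / (a + (a - t)))"
  proof -
    have "2 * (a / (1 - t)) - 1 = (a + (a - (1 - t))) / (1 - t)" "2 * (a / t) - 1 = (a + (a - t)) / t"
      using bnd by (simp_all add: field_simps)
    then show "2 * \<mu> * (1 - \<mu>) * (a / (1 - t)) / (2 * (a / (1 - t)) - 1) = 2 * \<mu> * (1 - \<mu>) * (a / (a + (a - (1 - t))))"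
      "2 * \<nu> * (1 - \<nu>) * (a / t) / (2 * (a / t) - 1) = 2 * \<nu> * (1 - \<nu>) * (a / (a + (a - t)))"
      using bnd by simp_all
  qed
  have P': "variance (A_r_P A C \<alpha> t) / a\<^sup>2 = 2 - (\<mu> + \<nu> - 1)\<^sup>2
      - 2 * \<mu> * (1 - \<mu>) * (a / (1 - t)) / (2 * (a / (1 - t)) - 1)
      - 2 * \<nu> * (1 - \<nu>) * (a / t) / (2 * (a / t) - 1)
      + 2 * \<mu> * \<nu> * (a / t) * (a / (1 - t)) * I
      - 2 * \<mu> * (a / t) * (a / (1 - t)) * J - 2 * \<nu> * (a / t) * (a / (1 - t)) * K"
  proof -
    \<comment> \<open>The quotients \<open>A2 / (2 * A2 - 1)\<close> and
      \<open>A1 / (2 * A1 - 1)\<close>, kept opaque so that the remaining identity is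
      polynomial.\<close>
    define R1 R2 where "R1 = a / (a + (a - (1 - t)))" and "R2 = a / (a + (a - t))"
    have c0: "a\<^sup>2 * (2 / (a * (a + 0))) = 2" "a\<^sup>2 * (1 / a\<^sup>2) = 1"
      "a\<^sup>2 * (2 / (a * (a + (a - (1 - t))))) = 2 * R1" "a\<^sup>2 * (1 / (a * (a + (a - (1 - t))))) = R1"
      "a\<^sup>2 * (2 / (a * (a + (a - t)))) = 2 * R2" "a\<^sup>2 * (1 / (a * (a + (a - t)))) = R2"
      "\<And>x. a\<^sup>2 * (1 / (t * (1 - t)) * x) = (a / t) * (a / (1 - t)) * x"
      using bnd dif by (simp_all add: R1_def R2_def power2_eq_square)
    have c: "a\<^sup>2 * (2 / (a * (a + 0)) - 1 / a\<^sup>2) = 1"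
      "a\<^sup>2 * (2 / (a * (a + (a - (1 - t)))) - 1 / a\<^sup>2) = 2 * R1 - 1"
      "a\<^sup>2 * (2 / (a * (a + (a - t))) - 1 / a\<^sup>2) = 2 * R2 - 1"
      "\<And>x. a\<^sup>2 * (1 / (a * (a + (a - (1 - t)))) - 1 / a\<^sup>2 + 1 / (t * (1 - t)) * x) = R1 - 1 + (a / t) * (a / (1 - t)) * x"
      "\<And>x. a\<^sup>2 * (1 / (a * (a + (a - t))) - 1 / a\<^sup>2 + 1 / (t * (1 - t)) * x) = R2 - 1 + (a / t) * (a / (1 - t)) * x"
      "\<And>x. a\<^sup>2 * (1 / (t * (1 - t)) * x - 1 / a\<^sup>2) = (a / t) * (a / (1 - t)) * x - 1"
      unfolding distrib_left[of "a\<^sup>2"] right_diff_distrib[of "a\<^sup>2"] c0 by simp_all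
    have lin: "k * (x0 + \<mu>\<^sup>2 * x1 + \<nu>\<^sup>2 * x2 - 2 * \<mu> * y1 - 2 * \<nu> * y2 + 2 * \<mu> * \<nu> * y3)
        = k * x0 + \<mu>\<^sup>2 * (k * x1) + \<nu>\<^sup>2 * (k * x2) - 2 * \<mu> * (k * y1) - 2 * \<nu> * (k * y2) + 2 * \<mu> * \<nu> * (k * y3)"
      for k x0 x1 x2 y1 y2 y3 by (simp add: algebra_simps)
    \<comment> \<open>The constants collect to
      \<open>1 - \<mu>^2 - \<nu>^2 - 2 \<mu> \<nu> + 2 \<mu> + 2 \<nu>\<close>, which is
      \<open>2 - (\<mu> + \<nu> - 1)^2\<close>; the coefficient of \<open>R1\<close> is
      \<open>2 \<mu>^2 - 2 \<mu>\<close>, and that of \<open>R2\<close> is analogous.\<close>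
    show ?thesis unfolding P lin c r R1_def[symmetric] R2_def[symmetric]
      by (simp add: algebra_simps power2_eq_square)
  qed
  have L: "- (0 / a) = 0" "- ((a - (1 - t)) / a) = - 1 + 1 / (a / (1 - t))" "- ((a - t) / a) = - 1 + 1 / (a / t)"
    using bnd by (simp_all add: field_simps)
  have L0: "L2 0 = 0" by (simp add: L2_def zero_ereal_def[symmetric])
  note Q = variance_A_r_CFG[OF t \<mu>_def \<nu>_def, folded a_def, unfolded self(2,4,6) cross_CFG
      integral_rate_CFG_left[OF t a_def] integral_rate_CFG_right[OF t a_def] integral_rate_CFG_unit[OF t a_def] L L0]
  \<comment> \<open>The premise copies the shape of \<open>Q\<close> literally, including
    \<open>2 * 0\<close> from \<open>L2 0\<close> and the signs \<open>+ -\<close>, so that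
    \<open>Q\<close> matches it by resolution.\<close>
  have Q': "V = (1 + \<mu>\<^sup>2 + \<nu>\<^sup>2 - \<mu> - \<nu>) * l - 2 * \<mu> * (1 - \<mu>) * l1 - 2 * \<nu> * (1 - \<nu>) * l2
      - 2 * \<mu> * \<nu> * i + 2 * \<mu> * j + 2 * \<nu> * k"
    if "V = l + 2 * 0 + \<mu>\<^sup>2 * (l + 2 * l1) + \<nu>\<^sup>2 * (l + 2 * l2)
      - 2 * \<mu> * (l / 2 + l1 + - j) - 2 * \<nu> * (l / 2 + l2 + - k) + 2 * \<mu> * \<nu> * - i"
    for V l l1 l2 i j k :: real
    unfolding that by (simp add: algebra_simps power2_eq_square)
  show ?thesis
    unfolding Let_def \<mu>_def[symmetric] \<nu>_def[symmetric] unfolding a_def[symmetric]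
    using P'[unfolded I_def J_def K_def] Q'[OF Q] by (rule conjI)
qed

end
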